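(* Let $\mu$ be a probability measure on $\mathbb{R}$ whose restriction to an interval $(x_0-\delta, x_0+\delta)$ has a local density function $p(x)$ of the form $$ p(x)= \begin{cases} c(x-x_0)^{\alpha-1}(1+f(x)), & x_0<x< x_0 + \delta, \\ 0, & x_0 - \delta < x <x_0, \end{cases} $$ where $c,\delta>0$ and $x_0\in\mathbb{R}$. Let $\theta(\alpha):= \left(\frac{1}{|\alpha-1|}-1\right)\pi$, and assume the following: (i) $\alpha \in \mathcal{I}:=\left(\bigcup_{n=1}^\infty\left(\frac{2n-1}{2n}, \frac{2n}{2n+1}\right) \right) \cup \left( \bigcup_{n=1}^\infty\left(\frac{2n+2}{2n+1}, \frac{2n+1}{2n}\right)\right) \subset \left(\frac{1}{2},\frac{3}{2}\right)$; (ii) the function $f(\cdot+x_0)$ is real analytic in $(0,\delta)$, and it extends to an analytic map in $\mathcal{S}_{(-\theta(\alpha)-\theta_0,\theta_0)}(\delta)$ for some $\theta_0\in(0,\frac{\pi}{4})$; (iii) there is a continuous function $g :[0,\delta) \to [0,\infty)$ such that $g(0)=0$ and $|f(x_0+re^{i\theta})|\leq g(r)$ for $r\in(0,\delta)$, $\theta \in (-\theta(\alpha)-\theta_0,\theta_0)$, where $f(x_0+re^{i\theta})$ denotes the value of the extension in (ii) at the point $re^{i\theta}$ of $\mathcal{S}$. Then $\mu$ is not freely infinitely divisible (FID).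
   Context: $\mathcal{S}$ is the Riemann surface of the logarithm (the helix-like surface obtained by gluing copies of $\mathbb{C}\setminus[0,\infty)$, i.e. the universal cover of $\mathbb{C}\setminus\{0\}$): its elements are written uniquely as $z=re^{i\theta}$ with $r=|z|>0$ and $\theta=\arg z\in\mathbb{R}$. For $J\subset\mathbb{R}$ and $R>0$, $\mathcal{S}_J(R)=\{z\in\mathcal{S}:\arg z\in J,\ 0<|z|<R\}$. The half line $(0,\infty)$ is identified with $\{\arg z=0\}$ and $\mathbb{C}^+$ with $\{\arg z\in(0,\pi)\}$. Free infinite divisibility: for a Borel probability measure $\mu$ on $\mathbb{R}$ let $G_\mu(z)=\int_{\mathbb{R}}\frac{1}{z-x}\mu(dx)$ and $F_\mu(z)=1/G_\mu(z)$ for $z\in\mathbb{C}^+$. For $\lambda,M>0$ put $\Gamma_{\lambda,M}=\{z\in\mathbb{C}^+: \mathrm{Im}\,z>M,\ |\mathrm{Re}\,z|<\lambda\,\mathrm{Im}\,z\}$. For each $\lambda>0$ there is $M>0$ such that $F_\mu$ has a right compositional inverse $F_\mu^{-1}$ on $\Gamma_{\lambda,M}$ (inverting the restriction of $F_\mu$ to a truncated cone of the same type where it is univalent); the Voiculescu transform is $\phi_\mu(z)=F_\mu^{-1}(z)-z$. The free additive convolution $\mu\boxplus\nu$ is the unique probability measure with $\phi_{\mu\boxplus\nu}=\phi_\mu+\phi_\nu$ on a common domain of the form $\Gamma_{\lambda',M'}$. The measure $\mu$ is FID if for each $n\in\{1,2,3,\dots\}$ there is a probability measure $\mu_n$ on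 $\mathbb{R}$ with $\mu=\mu_n\boxplus\cdots\boxplus\mu_n$ ($n$ times). *)

theory Defs
  imports "HOL-Probability.Probability" "HOL-Complex_Analysis.Complex_Analysis"
begin

subsection \<open>Free infinite divisibility\<close>

definition upper_half :: "complex set" where
  "upper_half = {z. Im z > 0}"

definition cauchy_G :: "real measure \<Rightarrow> complex \<Rightarrow> complex" where
  "cauchy_G \<mu> z = (\<integral>x. 1 / (z - complex_of_real x) \<partial>\<mu>)"

definition recip_F :: "real measure \<Rightarrow> complex \<Rightarrow> complex" where
  "recip_F \<mu> z = 1 / cauchy_G \<mu> z"

definition trunc_cone :: "real \<Rightarrow> real \<Rightarrow> complex set" where
  "trunc_cone l M = {z \<in> upper_half. Im z > M \<and> \<bar>Re z\<bar> < l * Im z}"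

text \<open>
  \<open>h\<close> is the right inverse of \<open>recip_F \<mu>\<close> on \<open>trunc_cone l M\<close>, obtained by inverting the
  restriction of \<open>recip_F \<mu>\<close> to some truncated cone on which it is univalent. Two such inverses on
  the same cone coincide: they agree far up in the cone and are holomorphic.
\<close>

definition F_right_inverse_on ::
  "real measure \<Rightarrow> real \<Rightarrow> real \<Rightarrow> (complex \<Rightarrow> complex) \<Rightarrow> bool" where
  "F_right_inverse_on \<mu> l M h \<longleftrightarrow>
     (\<exists>l'>0. \<exists>M'>0. inj_on (recip_F \<mu>) (trunc_cone l' M') \<and>
        (\<forall>z \<in> trunc_cone l M. h z \<in> trunc_cone l' M' \<and> recip_F \<mu> (h z) = z))"

definition voiculescu_transform_on ::
  "real measure \<Rightarrow> real \<Rightarrow> real \<Rightarrow> (complex \<Rightarrow> complex) \<Rightarrow> bool" where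
  "voiculescu_transform_on \<mu> l M \<phi> \<longleftrightarrow>
     (\<exists>h. F_right_inverse_on \<mu> l M h \<and> (\<forall>z \<in> trunc_cone l M. \<phi> z = h z - z))"

text \<open>
  The free additive convolution is rendered as the graph of a binary operation:
  \<open>is_free_add_conv \<mu> \<nu> \<rho>\<close> says that \<open>\<rho>\<close> is the probability measure \<open>\<mu> \<boxplus> \<nu>\<close>. Existence and
  uniqueness of \<open>\<rho>\<close> are theorems about the Voiculescu transform and are not built into the definition.
\<close>

definition is_free_add_conv :: "real measure \<Rightarrow> real measure \<Rightarrow> real measure \<Rightarrow> bool" where
  "is_free_add_conv \<mu> \<nu> \<rho> \<longleftrightarrow>
     real_distribution \<mu> \<and> real_distribution \<nu> \<and> real_distribution \<rho> \<and>
     (\<exists>l>0. \<exists>M>0. \<exists>\<phi>\<^sub>\<mu> \<phi>\<^sub>\<nu> \<phi>\<^sub>\<rho>.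
        voiculescu_transform_on \<mu> l M \<phi>\<^sub>\<mu> \<and>
        voiculescu_transform_on \<nu> l M \<phi>\<^sub>\<nu> \<and>
        voiculescu_transform_on \<rho> l M \<phi>\<^sub>\<rho> \<and>
        (\<forall>z \<in> trunc_cone l M. \<phi>\<^sub>\<rho> z = \<phi>\<^sub>\<mu> z + \<phi>\<^sub>\<nu> z))"

text \<open>\<open>is_free_conv_power \<nu> n \<rho>\<close>: \<open>\<rho> = \<nu> \<boxplus> \<dots> \<boxplus> \<nu>\<close> with \<open>n \<ge> 1\<close> copies of \<open>\<nu>\<close>.\<close>

inductive is_free_conv_power :: "real measure \<Rightarrow> nat \<Rightarrow> real measure \<Rightarrow> bool"
  for \<nu> :: "real measure" where
  one: "real_distribution \<nu> \<Longrightarrow> is_free_conv_power \<nu> 1 \<nu>"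
| Suc: "is_free_conv_power \<nu> n \<rho> \<Longrightarrow> is_free_add_conv \<rho> \<nu> \<rho>' \<Longrightarrow> is_free_conv_power \<nu> (Suc n) \<rho>'"

definition FID :: "real measure \<Rightarrow> bool" where
  "FID \<mu> \<longleftrightarrow> (\<forall>n\<ge>1. \<exists>\<mu>\<^sub>n. real_distribution \<mu>\<^sub>n \<and> is_free_conv_power \<mu>\<^sub>n n \<mu>)"

subsection \<open>The Riemann surface of the logarithm\<close>

text \<open>
  The point \<open>r e\<^sup>i\<^sup>\<theta>\<close> of the surface is the pair \<open>(r, \<theta>)\<close> with \<open>r > 0\<close> and \<open>\<theta>\<close> an unrestricted real.
  The covering map onto the punctured plane is a local homeomorphism for the product topology on
  pairs; its local inverses are the charts.
\<close>

definition log_surface :: "(real \<times> real) set" where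
  "log_surface = {(r, \<theta>). r > 0}"

definition log_proj :: "real \<times> real \<Rightarrow> complex" where
  "log_proj z = rcis (fst z) (snd z)"

definition log_sector :: "real set \<Rightarrow> real \<Rightarrow> (real \<times> real) set" where
  "log_sector J R = {(r, \<theta>) \<in> log_surface. \<theta> \<in> J \<and> r < R}"

text \<open>Analyticity on an open subset of the surface: analytic in the chart given by \<open>log_proj\<close>.\<close>

definition analytic_on_log_surface :: "(real \<times> real \<Rightarrow> complex) \<Rightarrow> (real \<times> real) set \<Rightarrow> bool" where
  "analytic_on_log_surface F U \<longleftrightarrow>
     (\<forall>z \<in> U. \<exists>h. h analytic_on {log_proj z} \<and> (\<forall>\<^sub>F w in nhds z. F w = h (log_proj w)))"

subsection \<open>Real analyticity and local densities\<close>

text \<open>Intended for open \<open>S\<close>.\<close>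

definition real_analytic_on :: "(real \<Rightarrow> real) \<Rightarrow> real set \<Rightarrow> bool" where
  "real_analytic_on f S \<longleftrightarrow>
     (\<forall>x \<in> S. \<exists>e>0. \<exists>a. \<forall>y. \<bar>y - x\<bar> < e \<longrightarrow> (\<lambda>n. a n * (y - x) ^ n) sums f y)"

definition has_local_density :: "real measure \<Rightarrow> real set \<Rightarrow> (real \<Rightarrow> real) \<Rightarrow> bool" where
  "has_local_density \<mu> I p \<longleftrightarrow>
     p \<in> borel_measurable (restrict_space lborel I) \<and> (\<forall>x \<in> I. 0 \<le> p x) \<and>
     restrict_space \<mu> I = density (restrict_space lborel I) (\<lambda>x. ennreal (p x))"

subsection \<open>The exponents\<close>

definition exponent_set :: "real set" where
  "exponent_set =
     (\<Union>n \<in> {1::nat..}. {(2 * real n - 1) / (2 * real n) <..< (2 * real n) / (2 * real n + 1)}) \<union>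
     (\<Union>n \<in> {1::nat..}. {(2 * real n + 2) / (2 * real n + 1) <..< (2 * real n + 1) / (2 * real n)})"

definition theta :: "real \<Rightarrow> real" where
  "theta \<alpha> = (1 / \<bar>\<alpha> - 1\<bar> - 1) * pi"

end

theory Submission
  imports Defs
begin

text \<open>
  Suppose \<open>\<mu>\<close> is FID, and let \<open>\<mu> = \<nu> \<boxplus> \<dots> \<boxplus> \<nu>\<close> with \<open>n\<close> factors. Analytic continuation
  from a truncated cone gives \<open>F\<^sub>\<nu> (((n - 1) F\<^sub>\<mu> z + z) / n) = F\<^sub>\<mu> z\<close> on the upper half plane. Hence, if
  \<open>F\<^sub>\<mu>\<close> is continued along a compact path on the logarithmic surface over \<open>x\<^sub>0\<close> on which \<open>Im F\<^sub>\<mu> > 0\<close>,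
  then for large \<open>n\<close> the identity continues with it, and \<open>Im F\<^sub>\<nu> w \<ge> Im w\<close> yields \<open>Im F\<^sub>\<mu> z \<ge> Im z\<close> on the path.

  On the other hand, rotating the contour of integration shows that \<open>G\<^sub>\<mu>\<close> continues to arguments down to
  slightly below \<open>- \<theta>(\<alpha>)\<close>, with \<open>G\<^sub>\<mu> (x\<^sub>0 + z) = b + C (e\<^sup>-\<^sup>i\<^sup>\<pi> z)\<^sup>\<alpha>\<^sup>-\<^sup>1 (1 + o(1))\<close>, where \<open>b\<close> is real and \<open>C\<close> has
  the sign of \<open>\<alpha> - 1\<close>. As the argument decreases, \<open>F\<^sub>\<mu>\<close> stays in the upper half plane until it reaches the
  real axis near the argument \<open>- \<theta>(\<alpha>)\<close>. The condition on \<open>\<alpha>\<close> says that \<open>sin \<theta>(\<alpha>) < 0\<close>, so \<open>Im z > 0\<close> there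
  while \<open>Im F\<^sub>\<mu> z\<close> tends to \<open>0\<close>, a contradiction.
\<close>

subsection \<open>Parameter integrals of holomorphic functions\<close>

text \<open>The coordinate \<zeta> = log (z - x0) turns the surface into a half strip of the plane
  and the Cauchy integral of the density into a convolution with exp (\<gamma> v) / (1 - exp v),
  whose poles are the points 2 pi i k. These poles limit a fixed contour: a ray of argument \<tau>
  serves only \<tau> < Im \<zeta> < \<tau> + 2 pi, while \<theta>(\<alpha>) is unbounded as \<alpha>
  tends to 1. The contour therefore turns along with \<zeta>, a fixed angle \<kappa> behind it,
  which also makes the leading constant and all error bounds uniform in Im \<zeta>. The angle
  \<theta>(\<alpha>) solves |\<alpha> - 1| (pi + \<theta>) = pi: at argument - \<theta>(\<alpha>)
  the leading term of G - b is real. The function F of the n-th convolution root is never continued: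
  ((n - 1) F(z) + z) / n stays in the upper half plane because its first term dominates, with n
  depending on the path. This demands Im F > 0 strictly on a compact path, so the inequality holds
  only before the first real value and reaches it as a limit; there G must be nonzero for the two
  sides to be incompatible.\<close>

lemma holomorphic_on_lebesgue_integral:
  fixes f :: "complex \<Rightarrow> 'a \<Rightarrow> complex"
  assumes "open U"
    and hol: "\<And>t. t \<in> space M \<Longrightarrow> (\<lambda>z. f z t) holomorphic_on U"
    and meas: "\<And>z. z \<in> U \<Longrightarrow> f z \<in> borel_measurable M"
    and bound: "\<And>z. z \<in> U \<Longrightarrow> \<exists>r>0. \<exists>B. cball z r \<subseteq> U \<and> integrable M B \<and>
                  (\<forall>w\<in>cball z r. \<forall>t\<in>space M. norm (f w t) \<le> B t)"
  shows "(\<lambda>z. \<integral>t. f z t \<partial>M) holomorphic_on U"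
proof -
  have "(\<lambda>z. \<integral>t. f z t \<partial>M) field_differentiable (at z)" if z: "z \<in> U" for z
  proof -
    obtain r B where r: "r > 0" "cball z r \<subseteq> U" and B: "integrable M B"
      and fB: "\<And>w t. w \<in> cball z r \<Longrightarrow> t \<in> space M \<Longrightarrow> norm (f w t) \<le> B t"
      using bound[OF z] by blast
    have [measurable]: "B \<in> borel_measurable M" using B by auto
    have df: "((\<lambda>z. f z t) has_field_derivative deriv (\<lambda>z. f z t) w) (at w)"
      if "w \<in> U" "t \<in> space M" for w t
      using hol[OF that(2)] that(1) \<open>open U\<close> holomorphic_derivI by blast
    \<comment> \<open>Discs of radius \<open>r/2\<close> about points of \<open>ball z (r/2)\<close>
      stay in \<open>cball z r\<close>, so the Cauchy estimate bounds all derivatives by one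
      integrable function; the mean value inequality passes this bound on to the difference
      quotients.\<close>
    have dbound: "norm (deriv (\<lambda>z. f z t) w) \<le> B t / (r/2)"
      if w: "w \<in> ball z (r/2)" and t: "t \<in> space M" for w t
    proof -
      have sub: "cball w (r/2) \<subseteq> cball z r"
        using w by (auto simp: dist_norm) (smt (verit) dist_norm dist_triangle field_sum_of_halves)
      have "norm ((deriv ^^ 1) (\<lambda>z. f z t) w) \<le> fact 1 * B t / (r/2) ^ 1"
      proof (rule Cauchy_inequality)
        have "(\<lambda>z. f z t) holomorphic_on cball w (r/2)"
          using hol[OF t] sub r(2) by (meson holomorphic_on_subset subset_trans)
        then show "(\<lambda>z. f z t) holomorphic_on ball w (r/2)" "continuous_on (cball w (r/2)) (\<lambda>z. f z t)"
          by (auto intro: holomorphic_on_subset holomorphic_on_imp_continuous_on)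
        fix x assume "norm (w - x) = r/2"
        then have "x \<in> cball w (r/2)" by (simp add: dist_norm)
        then show "norm (f x t) \<le> B t" using sub fB t by blast
      qed (use r in auto)
      then show ?thesis by simp
    qed
    have diff: "norm (f w t - f z t) \<le> B t / (r/2) * norm (w - z)"
      if w: "w \<in> ball z (r/2)" and t: "t \<in> space M" for w t
    proof (rule field_differentiable_bound[of "ball z (r/2)" "\<lambda>z. f z t" "deriv (\<lambda>z. f z t)"])
      fix x assume x: "x \<in> ball z (r/2)"
      then have "x \<in> cball z r" using r by auto
      then show "((\<lambda>z. f z t) has_field_derivative deriv (\<lambda>z. f z t) x) (at x within ball z (r/2))"
        using df r(2) t by (meson has_field_derivative_at_within subsetD)
    qed (use dbound w t r in auto)
    have int: "integrable M (f w)" if "w \<in> cball z r" for w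
      by (rule Bochner_Integration.integrable_bound[OF B])
         (use meas r(2) that fB in \<open>auto intro!: AE_I2 order_trans[OF fB abs_ge_self]\<close>)
    let ?D = "\<integral>t. deriv (\<lambda>z. f z t) z \<partial>M"
    have "((\<lambda>w. ((\<integral>t. f w t \<partial>M) - (\<integral>t. f z t \<partial>M)) / (w - z)) \<longlongrightarrow> ?D) (at z within ball z (r/2))"
      unfolding tendsto_at_iff_sequentially
    proof (intro allI impI)
      fix X :: "nat \<Rightarrow> complex"
      assume X: "\<forall>i. X i \<in> ball z (r/2) - {z}" and Xz: "X \<longlonglongrightarrow> z"
      have Xc: "X i \<in> cball z r" for i using X[rule_format, of i] r by auto
      have XU: "X i \<in> U" for i using Xc[of i] r(2) by auto
      have lim: "(\<lambda>i. (f (X i) t - f z t) / (X i - z)) \<longlonglongrightarrow> deriv (\<lambda>z. f z t) z" if "t \<in> space M" for t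
      proof -
        have "((\<lambda>w. (f w t - f z t) / (w - z)) \<longlongrightarrow> deriv (\<lambda>z. f z t) z) (at z)"
          using df[OF z that] by (simp add: has_field_derivative_iff)
        then show ?thesis using X Xz unfolding tendsto_at_iff_sequentially comp_def by auto
      qed
      have mm: "(\<lambda>t. (f (X i) t - f z t) / (X i - z)) \<in> borel_measurable M" for i
        using meas[OF XU[of i]] meas[OF z] by measurable
      have "(\<lambda>i. \<integral>t. (f (X i) t - f z t) / (X i - z) \<partial>M) \<longlonglongrightarrow> ?D"
      proof (rule integral_dominated_convergence[where w="\<lambda>t. B t / (r/2)"])
        show "(\<lambda>t. deriv (\<lambda>z. f z t) z) \<in> borel_measurable M"
          by (rule borel_measurable_LIMSEQ_metric[OF mm lim])
        show "AE t in M. (\<lambda>i. (f (X i) t - f z t) / (X i - z)) \<longlonglongrightarrow> deriv (\<lambda>z. f z t) z"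
          using lim by auto
        show "AE t in M. norm ((f (X i) t - f z t) / (X i - z)) \<le> B t / (r/2)" for i
        proof (rule AE_I2)
          fix t assume "t \<in> space M"
          from diff[OF _ this, of "X i"] X show "norm ((f (X i) t - f z t) / (X i - z)) \<le> B t / (r/2)"
            by (auto simp: norm_divide divide_le_eq)
        qed
      qed (use mm B in auto)
      moreover have "(\<integral>t. (f (X i) t - f z t) / (X i - z) \<partial>M)
          = ((\<integral>t. f (X i) t \<partial>M) - (\<integral>t. f z t \<partial>M)) / (X i - z)" for i
        using int[OF Xc[of i]] int[of z] r by simp
      ultimately show "((\<lambda>w. ((\<integral>t. f w t \<partial>M) - (\<integral>t. f z t \<partial>M)) / (w - z)) \<circ> X) \<longlonglongrightarrow> ?D"
        by (simp only: comp_def)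
    qed
    then have "((\<lambda>z. \<integral>t. f z t \<partial>M) has_field_derivative ?D) (at z within ball z (r/2))"
      by (simp add: has_field_derivative_iff)
    then have "((\<lambda>z. \<integral>t. f z t \<partial>M) has_field_derivative ?D) (at z)"
      using r(1) by (subst (asm) at_within_open) auto
    then show ?thesis by (auto simp: field_differentiable_def)
  qed
  then show ?thesis
    using \<open>open U\<close> by (simp add: holomorphic_on_open field_differentiable_def)
qed

subsection \<open>Cauchy transforms\<close>

lemma norm_resolvent_le: "Im z > 0 \<Longrightarrow> norm (1 / (z - complex_of_real x)) \<le> 1 / Im z"
  using abs_Im_le_cmod[of "z - complex_of_real x"] by (simp add: norm_divide frac_le)

lemma open_upper_half: "open upper_half"
  unfolding upper_half_def by (rule open_halfspace_Im_gt)

lemma convex_upper_half: "convex upper_half"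
  unfolding upper_half_def by (rule convex_halfspace_Im_gt)

context real_distribution
begin

lemma integrable_resolvent: "Im z > 0 \<Longrightarrow> integrable M (\<lambda>x. 1 / (z - complex_of_real x))"
  by (rule integrable_const_bound[where B="1 / Im z"]) (use norm_resolvent_le in auto)

lemma integrable_resolvent_sq: "Im z > 0 \<Longrightarrow> integrable M (\<lambda>x. (norm (1 / (z - complex_of_real x)))\<^sup>2)"
  by (rule integrable_const_bound[where B="(1 / Im z)\<^sup>2"])
     (use norm_resolvent_le in \<open>auto intro!: power_mono simp del: power_divide\<close>)

lemma holomorphic_cauchy_G: "cauchy_G M holomorphic_on upper_half"
proof -
  have "(\<lambda>z. \<integral>x. 1 / (z - complex_of_real x) \<partial>M) holomorphic_on upper_half"
  proof (rule holomorphic_on_lebesgue_integral[OF open_upper_half])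
    show "(\<lambda>z. 1 / (z - complex_of_real t)) holomorphic_on upper_half" for t
      by (intro holomorphic_intros) (auto simp: upper_half_def complex_eq_iff)
    fix z assume "z \<in> upper_half"
    then have z: "Im z > 0" by (simp add: upper_half_def)
    have I: "Im w \<ge> Im z / 2" if "w \<in> cball z (Im z / 2)" for w
      using that abs_Im_le_cmod[of "z - w"] by (auto simp: dist_norm)
    show "\<exists>r>0. \<exists>B. cball z r \<subseteq> upper_half \<and> integrable M B \<and>
        (\<forall>w\<in>cball z r. \<forall>t\<in>space M. norm (1 / (w - complex_of_real t)) \<le> B t)"
    proof (intro exI[of _ "Im z / 2"] exI[of _ "\<lambda>_. 1 / (Im z / 2)"] conjI ballI)
      fix w t assume w: "w \<in> cball z (Im z / 2)"
      have "norm (1 / (w - complex_of_real t)) \<le> 1 / Im w"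
        using I[OF w] z by (intro norm_resolvent_le) linarith
      also have "\<dots> \<le> 1 / (Im z / 2)" using I[OF w] z by (intro divide_left_mono) auto
      finally show "norm (1 / (w - complex_of_real t)) \<le> 1 / (Im z / 2)" .
    qed (use z I in \<open>auto simp: upper_half_def dest!: I\<close>)
  qed simp
  then show ?thesis by (simp add: cauchy_G_def[abs_def])
qed

lemma Im_cauchy_G:
  assumes "Im z > 0"
  shows "Im (cauchy_G M z) = - Im z * (\<integral>x. (norm (1 / (z - complex_of_real x)))\<^sup>2 \<partial>M)"
proof -
  have "Im (cauchy_G M z) = (\<integral>x. Im (1 / (z - complex_of_real x)) \<partial>M)"
    unfolding cauchy_G_def using integrable_resolvent[OF assms] by simp
  also have "\<dots> = (\<integral>x. - Im z * (norm (1 / (z - complex_of_real x)))\<^sup>2 \<partial>M)"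
    by (intro Bochner_Integration.integral_cong refl)
       (simp add: Im_divide norm_divide power_divide cmod_power2)
  finally show ?thesis by simp
qed

lemma resolvent_sq_pos:
  assumes "Im z > 0"
  shows "(\<integral>x. (norm (1 / (z - complex_of_real x)))\<^sup>2 \<partial>M) > 0"
proof -
  have "z \<noteq> complex_of_real x" for x using assms by auto
  then have "\<not> (AE x in M. (norm (1 / (z - complex_of_real x)))\<^sup>2 = 0)"
    by simp
  then show ?thesis
    using integral_nonneg_eq_0_iff_AE[OF integrable_resolvent_sq[OF assms]]
    by (auto simp: less_le intro: Bochner_Integration.integral_nonneg)
qed

lemma Im_cauchy_G_neg: "Im z > 0 \<Longrightarrow> Im (cauchy_G M z) < 0"
  using resolvent_sq_pos by (simp add: Im_cauchy_G)

lemma cauchy_G_nonzero: "Im z > 0 \<Longrightarrow> cauchy_G M z \<noteq> 0"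
  using Im_cauchy_G_neg by force

text \<open>The variance of |1 / (z - x)| is nonnegative; this is the Cauchy-Schwarz inequality for
  a probability measure.\<close>

lemma norm_cauchy_G_sq_le:
  assumes "Im z > 0"
  shows "(norm (cauchy_G M z))\<^sup>2 \<le> (\<integral>x. (norm (1 / (z - complex_of_real x)))\<^sup>2 \<partial>M)"
proof -
  let ?f = "\<lambda>x. norm (1 / (z - complex_of_real x))"
  have i: "integrable M ?f" using integrable_resolvent[OF assms] by auto
  have "norm (cauchy_G M z) \<le> expectation ?f"
    unfolding cauchy_G_def by (rule integral_norm_bound)
  then have "(norm (cauchy_G M z))\<^sup>2 \<le> (expectation ?f)\<^sup>2" by (intro power_mono) auto
  also have "\<dots> \<le> expectation (\<lambda>x. (?f x)\<^sup>2)"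
    using variance_eq[OF i integrable_resolvent_sq[OF assms]] variance_positive[of ?f]
    by linarith
  finally show ?thesis .
qed

text \<open>Since Im F = - Im G / |G|^2 and - Im G is Im z times the second moment of the resolvent,
  the claim reduces to the second moment bound for |G|^2. The final contradiction comes from
  applying it to the convolution roots.\<close>

lemma Im_recip_F_ge:
  assumes "Im z > 0"
  shows "Im (recip_F M z) \<ge> Im z"
proof -
  let ?G = "cauchy_G M z" and ?I = "\<integral>x. (norm (1 / (z - complex_of_real x)))\<^sup>2 \<partial>M"
  have G: "(norm ?G)\<^sup>2 > 0" using cauchy_G_nonzero[OF assms] by simp
  have "Im (recip_F M z) = - Im ?G / (norm ?G)\<^sup>2"
    by (simp add: recip_F_def Im_divide cmod_power2)
  also have "\<dots> = Im z * (?I / (norm ?G)\<^sup>2)" using Im_cauchy_G[OF assms] by simp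
  also have "\<dots> \<ge> Im z * 1"
    using norm_cauchy_G_sq_le[OF assms] G assms by (intro mult_left_mono) auto
  finally show ?thesis by simp
qed

lemma recip_F_in_upper_half: "z \<in> upper_half \<Longrightarrow> recip_F M z \<in> upper_half"
  using Im_recip_F_ge[of z] by (auto simp: upper_half_def)

lemma holomorphic_recip_F: "recip_F M holomorphic_on upper_half"
  unfolding recip_F_def[abs_def] using cauchy_G_nonzero
  by (intro holomorphic_intros holomorphic_cauchy_G) (auto simp: upper_half_def)

end

subsection \<open>Right inverses and Voiculescu transforms\<close>

lemma open_trunc_cone: "open (trunc_cone l M)"
proof -
  have "trunc_cone l M = {z. Im z > 0} \<inter> {z. Im z > M} \<inter> {z. \<bar>Re z\<bar> < l * Im z}"
    by (auto simp: trunc_cone_def upper_half_def)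
  then show ?thesis
    by (auto intro!: open_Int open_halfspace_Im_gt open_Collect_less continuous_intros)
qed

lemma trunc_cone_mono: "l \<le> l' \<Longrightarrow> M' \<le> M \<Longrightarrow> trunc_cone l M \<subseteq> trunc_cone l' M'"
  by (auto simp: trunc_cone_def upper_half_def intro: less_le_trans mult_right_mono)

lemma trunc_cone_nonempty: "l > 0 \<Longrightarrow> trunc_cone l M \<noteq> {}"
proof -
  assume "l > 0"
  then have "Complex 0 (\<bar>M\<bar> + 1) \<in> trunc_cone l M"
    by (auto simp: trunc_cone_def upper_half_def)
  then show ?thesis by blast
qed

lemma F_right_inverse_on_subset:
  "F_right_inverse_on \<mu> l M h \<Longrightarrow> trunc_cone l' M' \<subseteq> trunc_cone l M \<Longrightarrow> F_right_inverse_on \<mu> l' M' h"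
  unfolding F_right_inverse_on_def by blast

lemma F_right_inverse_on_D:
  assumes "F_right_inverse_on \<mu> l M h" "z \<in> trunc_cone l M"
  shows "recip_F \<mu> (h z) = z" "h z \<in> upper_half"
  using assms by (auto simp: F_right_inverse_on_def trunc_cone_def)

context real_distribution
begin

text \<open>The part of the cone below height \<open>C\<close> lies in a compact rectangle with Im w
  >= \<open>M'\<close> > 0. Hence a point of the cone whose image is large must lie high up.\<close>

lemma recip_F_bounded_on_slab:
  assumes "M' > 0"
  shows "\<exists>B. \<forall>w \<in> trunc_cone l' M'. Im w \<le> C \<longrightarrow> norm (recip_F M w) \<le> B"
proof -
  let ?K = "{w. M' \<le> Im w \<and> Im w \<le> C \<and> \<bar>Re w\<bar> \<le> \<bar>l'\<bar> * C}"
  have "closed ?K"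
    by (intro closed_Collect_conj closed_Collect_le continuous_intros)
  moreover have "bounded ?K"
  proof (rule boundedI)
    fix w assume "w \<in> ?K"
    then show "norm w \<le> \<bar>l'\<bar> * C + C" using cmod_le[of w] assms by auto
  qed
  ultimately have "compact ?K" by (simp add: compact_eq_bounded_closed)
  moreover have "?K \<subseteq> upper_half" using assms by (auto simp: upper_half_def)
  then have "continuous_on ?K (recip_F M)"
    using holomorphic_recip_F holomorphic_on_imp_continuous_on continuous_on_subset by blast
  ultimately have "bounded (recip_F M ` ?K)"
    using compact_continuous_image compact_imp_bounded by blast
  then obtain B where B: "\<And>w. w \<in> ?K \<Longrightarrow> norm (recip_F M w) \<le> B"
    by (auto simp: bounded_iff)
  have "w \<in> ?K" if "w \<in> trunc_cone l' M'" "Im w \<le> C" for w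
  proof -
    have "\<bar>Re w\<bar> \<le> l' * Im w" "Im w > 0" "M' < Im w"
      using that by (auto simp: trunc_cone_def upper_half_def)
    moreover have "l' * Im w \<le> \<bar>l'\<bar> * C" using that calculation by (intro mult_mono) auto
    ultimately show ?thesis using that by auto
  qed
  then show ?thesis using B by blast
qed

text \<open>For \<open>z\<close> high enough, \<open>h1 z\<close> lies above height
  \<open>M2\<close>, hence in the wider cone, where F is injective and where \<open>h2 z\<close> has
  the same image. The order of the apertures fixes which value is moved into the other cone.\<close>

lemma right_inverses_agree_aux:
  assumes 1: "l1 > 0" "M1 > 0" "inj_on (recip_F M) (trunc_cone l1 M1)"
      "\<And>z. z \<in> trunc_cone la Ma \<Longrightarrow> h1 z \<in> trunc_cone l1 M1 \<and> recip_F M (h1 z) = z"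
    and 2: "inj_on (recip_F M) (trunc_cone l2 M2)"
      "\<And>z. z \<in> trunc_cone lb Mb \<Longrightarrow> h2 z \<in> trunc_cone l2 M2 \<and> recip_F M (h2 z) = z"
    and le: "l1 \<le> l2"
  shows "\<exists>M0. \<forall>z. z \<in> trunc_cone la Ma \<longrightarrow> z \<in> trunc_cone lb Mb \<longrightarrow> Im z > M0 \<longrightarrow> h1 z = h2 z"
proof -
  obtain B where B: "\<And>w. w \<in> trunc_cone l1 M1 \<Longrightarrow> Im w \<le> M2 \<Longrightarrow> norm (recip_F M w) \<le> B"
    using recip_F_bounded_on_slab[OF 1(2)] by blast
  have "h1 z = h2 z" if z: "z \<in> trunc_cone la Ma" "z \<in> trunc_cone lb Mb" "Im z > B" for z
  proof -
    have h: "h1 z \<in> trunc_cone l1 M1" "recip_F M (h1 z) = z" using 1(4)[OF z(1)] by auto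
    have "Im (h1 z) > M2"
    proof (rule ccontr)
      assume "\<not> Im (h1 z) > M2"
      then have "norm z \<le> B" using B[OF h(1)] h(2) by simp
      then show False using z(3) abs_Im_le_cmod[of z] by linarith
    qed
    then have "h1 z \<in> trunc_cone l1 M2" using h(1) by (auto simp: trunc_cone_def)
    then have "h1 z \<in> trunc_cone l2 M2" using trunc_cone_mono[OF le order_refl] by blast
    then show ?thesis using 2 z(2) h(2) by (metis inj_onD)
  qed
  then show ?thesis by blast
qed

lemma right_inverses_agree:
  assumes "F_right_inverse_on M la Ma h1" "F_right_inverse_on M lb Mb h2"
  shows "\<exists>M0. \<forall>z. z \<in> trunc_cone la Ma \<longrightarrow> z \<in> trunc_cone lb Mb \<longrightarrow> Im z > M0 \<longrightarrow> h1 z = h2 z"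
proof -
  obtain l1 M1 where 1: "l1 > 0" "M1 > 0" "inj_on (recip_F M) (trunc_cone l1 M1)"
      "\<And>z. z \<in> trunc_cone la Ma \<Longrightarrow> h1 z \<in> trunc_cone l1 M1 \<and> recip_F M (h1 z) = z"
    using assms(1) unfolding F_right_inverse_on_def by blast
  obtain l2 M2 where 2: "l2 > 0" "M2 > 0" "inj_on (recip_F M) (trunc_cone l2 M2)"
      "\<And>z. z \<in> trunc_cone lb Mb \<Longrightarrow> h2 z \<in> trunc_cone l2 M2 \<and> recip_F M (h2 z) = z"
    using assms(2) unfolding F_right_inverse_on_def by blast
  show ?thesis
    using right_inverses_agree_aux[OF 1 2(3,4)] right_inverses_agree_aux[OF 2 1(3,4)]
    by (cases "l1 \<le> l2") (force)+
qed

end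

text \<open>Every convolution step brings its own right inverses, obtained from possibly different
  cones; they must be identified before Voiculescu transforms from different steps can be
  added.\<close>

lemma right_inverses_agree_cone:
  assumes "real_distribution \<mu>" "la > 0" "lb > 0" "F_right_inverse_on \<mu> la Ma h1" "F_right_inverse_on \<mu> lb Mb h2"
  obtains l M where "l > 0" "M > 0" "trunc_cone l M \<subseteq> trunc_cone la Ma" "trunc_cone l M \<subseteq> trunc_cone lb Mb"
    "\<And>z. z \<in> trunc_cone l M \<Longrightarrow> h1 z = h2 z"
proof -
  interpret real_distribution \<mu> by fact
  obtain M0 where M0: "\<And>z. z \<in> trunc_cone la Ma \<Longrightarrow> z \<in> trunc_cone lb Mb \<Longrightarrow> Im z > M0 \<Longrightarrow> h1 z = h2 z"
    using right_inverses_agree[OF assms(4,5)] by blast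
  define l M where "l = min la lb" and "M = Max {Ma, Mb, M0, 1}"
  have a: "trunc_cone l M \<subseteq> trunc_cone la Ma" "trunc_cone l M \<subseteq> trunc_cone lb Mb"
    by (intro trunc_cone_mono; simp add: l_def M_def)+
  have "h1 z = h2 z" if z: "z \<in> trunc_cone l M" for z
  proof -
    have "M < Im z" using z by (auto simp: trunc_cone_def)
    then have "M0 < Im z" by (simp add: M_def)
    then show ?thesis using M0 a z by blast
  qed
  then show ?thesis using that[of l M] a assms(2,3) by (auto simp: l_def M_def)
qed

text \<open>Adding transforms step by step gives \<open>n\<close> times the transform of
  \<open>\<nu>\<close>. The case \<open>n = 1\<close> stands apart because the first rule of the
  induction provides no right inverse.\<close>

lemma is_free_conv_power_transform:
  assumes "is_free_conv_power \<nu> n \<rho>"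
  shows "real_distribution \<nu> \<and> real_distribution \<rho> \<and> (n = 1 \<and> \<rho> = \<nu> \<or>
    (\<exists>l>0. \<exists>M>0. \<exists>h k. F_right_inverse_on \<rho> l M h \<and> F_right_inverse_on \<nu> l M k \<and>
      (\<forall>z \<in> trunc_cone l M. h z - z = of_nat n * (k z - z))))"
  using assms
proof induction
  case one
  then show ?case by simp
next
  case (Suc n \<rho> \<rho>')
  have rd: "real_distribution \<nu>" "real_distribution \<rho>" "real_distribution \<rho>'"
    using Suc by (auto simp: is_free_add_conv_def)
  obtain l M h k h' where lM: "l > 0" "M > 0"
    and h: "F_right_inverse_on \<rho> l M h" and k: "F_right_inverse_on \<nu> l M k"
    and h': "F_right_inverse_on \<rho>' l M h'"
    and eq: "\<And>z. z \<in> trunc_cone l M \<Longrightarrow> h' z - z = (h z - z) + (k z - z)"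
    using Suc(2) unfolding is_free_add_conv_def voiculescu_transform_on_def by metis
  have "\<exists>l>0. \<exists>M>0. \<exists>h k. F_right_inverse_on \<rho>' l M h \<and> F_right_inverse_on \<nu> l M k \<and>
      (\<forall>z \<in> trunc_cone l M. h z - z = of_nat (Suc n) * (k z - z))"
    using Suc.IH
  proof (elim conjE disjE)
    \<comment> \<open>Here \<open>h\<close> and \<open>k\<close> both invert F of
      \<open>\<nu>\<close>, so they agree on a smaller cone and the sum is twice
      \<open>k z - z\<close>.\<close>
    assume n: "n = 1" "\<rho> = \<nu>"
    obtain l' M' where *: "l' > 0" "M' > 0" "trunc_cone l' M' \<subseteq> trunc_cone l M"
      "\<And>z. z \<in> trunc_cone l' M' \<Longrightarrow> h z = k z"
      using right_inverses_agree_cone[OF rd(1) lM(1) lM(1) h[unfolded n(2)] k] by metis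
    show ?thesis
    proof (intro exI conjI ballI)
      show "F_right_inverse_on \<rho>' l' M' h'" "F_right_inverse_on \<nu> l' M' k"
        using h' k *(3) F_right_inverse_on_subset by blast+
      show "h' z - z = of_nat (Suc n) * (k z - z)" if "z \<in> trunc_cone l' M'" for z
        using eq[of z] *(3,4) that n by (auto simp: algebra_simps)
    qed fact+
  next
    assume "\<exists>l>0. \<exists>M>0. \<exists>h k. F_right_inverse_on \<rho> l M h \<and> F_right_inverse_on \<nu> l M k \<and>
      (\<forall>z \<in> trunc_cone l M. h z - z = of_nat n * (k z - z))"
    then obtain l2 M2 h2 k2 where 2: "l2 > 0" "M2 > 0" "F_right_inverse_on \<rho> l2 M2 h2"
       "F_right_inverse_on \<nu> l2 M2 k2"
       "\<And>z. z \<in> trunc_cone l2 M2 \<Longrightarrow> h2 z - z = of_nat n * (k2 z - z)" by blast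
    \<comment> \<open>Two pairs have to be matched on a common cone: \<open>h\<close> with
      \<open>h2\<close> for \<open>\<rho>\<close>, then \<open>k\<close> with \<open>k2\<close> for
      \<open>\<nu>\<close>.\<close>
    obtain l3 M3 where 3: "l3 > 0" "M3 > 0" "trunc_cone l3 M3 \<subseteq> trunc_cone l M" "trunc_cone l3 M3 \<subseteq> trunc_cone l2 M2"
      "\<And>z. z \<in> trunc_cone l3 M3 \<Longrightarrow> h z = h2 z"
      using right_inverses_agree_cone[OF rd(2) lM(1) 2(1) h 2(3)] by metis
    have k3: "F_right_inverse_on \<nu> l3 M3 k" using k 3(3) F_right_inverse_on_subset by blast
    obtain l4 M4 where 4: "l4 > 0" "M4 > 0" "trunc_cone l4 M4 \<subseteq> trunc_cone l3 M3" "trunc_cone l4 M4 \<subseteq> trunc_cone l2 M2"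
      "\<And>z. z \<in> trunc_cone l4 M4 \<Longrightarrow> k z = k2 z"
      using right_inverses_agree_cone[OF rd(1) 3(1) 2(1) k3 2(4)] by metis
    show ?thesis
    proof (intro exI conjI ballI)
      show "F_right_inverse_on \<rho>' l4 M4 h'" "F_right_inverse_on \<nu> l4 M4 k"
        using h' k 3(3) 4(3) F_right_inverse_on_subset by blast+
      show "h' z - z = of_nat (Suc n) * (k z - z)" if z: "z \<in> trunc_cone l4 M4" for z
      proof -
        have m: "z \<in> trunc_cone l3 M3" "z \<in> trunc_cone l2 M2" "z \<in> trunc_cone l M"
          using z 3 4 by blast+
        show ?thesis using eq[OF m(3)] 2(5)[OF m(2)] 3(5)[OF m(1)] 4(5)[OF z]
          by (simp add: algebra_simps)
      qed
    qed fact+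
  qed
  then show ?case using rd by simp
qed

text \<open>
  On the range of the inverse \<open>h\<close> of \<open>F\<^sub>\<mu>\<close> the identity below is the statement that
  \<open>z + (h z - z) / n\<close> inverts \<open>F\<^sub>\<nu>\<close>; both sides are analytic in the half plane.
\<close>

lemma FID_subordination:
  assumes "FID \<mu>" "n \<ge> 2"
  obtains \<nu> where "real_distribution \<nu>"
    "\<And>z. z \<in> upper_half \<Longrightarrow>
       recip_F \<nu> ((of_nat (n - 1) * recip_F \<mu> z + z) / of_nat n) = recip_F \<mu> z"
proof -
  obtain \<nu> where "is_free_conv_power \<nu> n \<mu>" using assms unfolding FID_def by (metis one_le_numeral order_trans)
  from is_free_conv_power_transform[OF this] assms(2)
  obtain l M h k where rd: "real_distribution \<nu>" "real_distribution \<mu>" and lM: "l > 0" "M > 0"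
    and h: "F_right_inverse_on \<mu> l M h" and k: "F_right_inverse_on \<nu> l M k"
    and eq: "\<And>z. z \<in> trunc_cone l M \<Longrightarrow> h z - z = of_nat n * (k z - z)" by auto
  interpret \<mu>: real_distribution \<mu> by fact
  interpret \<nu>: real_distribution \<nu> by fact
  obtain l' M' where l': "l' > 0" "M' > 0" and inj: "inj_on (recip_F \<mu>) (trunc_cone l' M')"
    and hh: "\<And>z. z \<in> trunc_cone l M \<Longrightarrow> h z \<in> trunc_cone l' M' \<and> recip_F \<mu> (h z) = z"
    using h unfolding F_right_inverse_on_def by blast
  \<comment> \<open>\<open>V\<close> is exactly the image of \<open>trunc_cone l M\<close> under
    \<open>h\<close>: by injectivity a point \<open>z\<close> of \<open>V\<close> is recovered as
    \<open>h (recip_F \<mu> z)\<close>. Written as a preimage it is visibly open.\<close>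
  define V where "V = (recip_F \<mu> -` trunc_cone l M) \<inter> trunc_cone l' M'"
  have sub: "trunc_cone l' M' \<subseteq> upper_half" by (auto simp: trunc_cone_def)
  have "continuous_on (trunc_cone l' M') (recip_F \<mu>)"
    using \<mu>.holomorphic_recip_F sub holomorphic_on_imp_continuous_on continuous_on_subset by blast
  then have "open V" unfolding V_def
    using open_trunc_cone by (metis continuous_on_open_vimage)
  have "V \<noteq> {}"
  proof -
    obtain z where "z \<in> trunc_cone l M" using trunc_cone_nonempty[OF lM(1)] by blast
    then have "h z \<in> V" using hh unfolding V_def by auto
    then show ?thesis by blast
  qed
  have n: "(of_nat n :: complex) \<noteq> 0" using assms by simp
  let ?\<omega> = "\<lambda>z. (of_nat (n - 1) * recip_F \<mu> z + z) / of_nat n"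
  have om: "?\<omega> z \<in> upper_half" if z: "z \<in> upper_half" for z
  proof -
    have "Im (?\<omega> z) = (of_nat (n - 1) * Im (recip_F \<mu> z) + Im z) / of_nat n"
      using assms by (simp add: Im_divide_of_nat)
    moreover have "Im (recip_F \<mu> z) > 0" "Im z > 0"
      using \<mu>.recip_F_in_upper_half[OF z] z by (auto simp: upper_half_def)
    ultimately show ?thesis using assms(2)
      by (auto simp: upper_half_def intro!: divide_pos_pos add_nonneg_pos)
  qed
  have "recip_F \<nu> (?\<omega> z) = recip_F \<mu> z" if "z \<in> upper_half" for z
  proof (rule analytic_continuation_open[OF \<open>open V\<close> open_upper_half \<open>V \<noteq> {}\<close>,
      where f = "\<lambda>z. recip_F \<nu> (?\<omega> z)" and g = "recip_F \<mu>"])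
    show "connected upper_half" by (intro convex_connected convex_upper_half)
    show "V \<subseteq> upper_half" using sub by (auto simp: V_def)
    have "(recip_F \<nu> \<circ> ?\<omega>) holomorphic_on upper_half"
    proof (rule holomorphic_on_compose_gen[OF _ \<nu>.holomorphic_recip_F])
      show "?\<omega> holomorphic_on upper_half"
        using n by (intro holomorphic_intros \<mu>.holomorphic_recip_F) auto
    qed (use om in auto)
    then show "(\<lambda>z. recip_F \<nu> (?\<omega> z)) holomorphic_on upper_half" by (simp add: comp_def)
    show "recip_F \<mu> holomorphic_on upper_half" by (rule \<mu>.holomorphic_recip_F)
    fix z assume "z \<in> V"
    then have z: "z \<in> trunc_cone l' M'" "recip_F \<mu> z \<in> trunc_cone l M" by (auto simp: V_def)
    define w where "w = recip_F \<mu> z"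
    have w: "w \<in> trunc_cone l M" using z w_def by simp
    have "h w = z" using hh[OF w] z inj unfolding w_def by (metis inj_onD)
    then have "z - w = of_nat n * (k w - w)" using eq[OF w] by simp
    then have "k w = (of_nat (n - 1) * w + z) / of_nat n"
      using n assms(2) by (simp add: field_simps of_nat_diff)
    then have "k w = ?\<omega> z" unfolding w_def .
    then show "recip_F \<nu> (?\<omega> z) = recip_F \<mu> z"
      using F_right_inverse_on_D(1)[OF k w] unfolding w_def by simp
  qed fact
  then show ?thesis using that rd(1) by blast
qed

subsection \<open>Moving horizontal contours\<close>

text \<open>The contour shifts work with a primitive on a convex set, so each side of a rectangle
  becomes a difference of two of its values. The sides that escape to infinity are only estimated,
  by the mean value inequality.\<close>

lemma primitive_vertical_bound:
  assumes "convex S" "\<And>z. z \<in> S \<Longrightarrow> (\<Phi> has_field_derivative f z) (at z within S)"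
    and "Complex x y \<in> S" "Complex x y' \<in> S"
    and "\<And>t. min y y' \<le> t \<Longrightarrow> t \<le> max y y' \<Longrightarrow> norm (f (Complex x t)) \<le> B"
  shows "norm (\<Phi> (Complex x y) - \<Phi> (Complex x y')) \<le> B * \<bar>y - y'\<bar>"
proof -
  let ?I = "closed_segment (Complex x y') (Complex x y)"
  have sub: "?I \<subseteq> S" using assms(1,3,4) by (simp add: closed_segment_subset)
  have "norm (\<Phi> (Complex x y) - \<Phi> (Complex x y')) \<le> B * norm (Complex x y - Complex x y')"
  proof (rule field_differentiable_bound[of ?I])
    show "(\<Phi> has_field_derivative f z) (at z within ?I)" if "z \<in> ?I" for z
      using assms(2) that sub by (meson DERIV_subset subsetD)
    show "norm (f z) \<le> B" if "z \<in> ?I" for z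
    proof -
      from that have "Re z = x" "min y y' \<le> Im z" "Im z \<le> max y y'"
        by (auto simp: closed_segment_same_Re closed_segment_eq_real_ivl split: if_splits)
      then show ?thesis using assms(5)[of "Im z"] by (metis complex_surj)
    qed
  qed auto
  then show ?thesis by (simp add: cmod_def)
qed

lemma primitive_horizontal_integral:
  assumes prim: "\<And>z. z \<in> S \<Longrightarrow> (\<Phi> has_field_derivative f z) (at z within S)" and "open S"
    and "continuous_on S f" and "a \<le> b" and sub: "\<And>u. a \<le> u \<Longrightarrow> u \<le> b \<Longrightarrow> Complex u y \<in> S"
  shows "(LBINT u:{a..b}. f (Complex u y)) = \<Phi> (Complex b y) - \<Phi> (Complex a y)"
  unfolding set_lebesgue_integral_def
proof (rule integral_FTC_atLeastAtMost)
  fix u assume u: "a \<le> u" "u \<le> b"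
  have "(\<Phi> has_field_derivative f (Complex u y)) (at (Complex u y))"
    using prim[OF sub[OF u]] unfolding at_within_open[OF sub[OF u] \<open>open S\<close>] .
  moreover have "((\<lambda>u. Complex u y) has_vector_derivative 1) (at u within {a..b})"
    by (auto simp: Complex_eq intro!: derivative_eq_intros)
  ultimately show "((\<lambda>u. \<Phi> (Complex u y)) has_vector_derivative f (Complex u y)) (at u within {a..b})"
    using field_vector_diff_chain_within[of "\<lambda>u. Complex u y" 1 u "{a..b}" \<Phi> "f (Complex u y)"]
    by (simp add: comp_def has_field_derivative_at_within)
next
  show "continuous_on {a..b} (\<lambda>u. f (Complex u y))"
    by (rule continuous_on_compose2[OF assms(3)]) (auto intro!: continuous_intros sub[unfolded Complex_eq] simp: Complex_eq)
qed fact

lemma primitive_vertical_integral: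
  assumes prim: "\<And>z. z \<in> S \<Longrightarrow> (\<Phi> has_field_derivative f z) (at z within S)" and "open S"
    and "continuous_on S f" and "a \<le> b" and sub: "\<And>t. a \<le> t \<Longrightarrow> t \<le> b \<Longrightarrow> Complex x t \<in> S"
  shows "(LBINT t:{a..b}. \<i> * f (Complex x t)) = \<Phi> (Complex x b) - \<Phi> (Complex x a)"
  unfolding set_lebesgue_integral_def
proof (rule integral_FTC_atLeastAtMost)
  fix t assume t: "a \<le> t" "t \<le> b"
  have "(\<Phi> has_field_derivative f (Complex x t)) (at (Complex x t))"
    using prim[OF sub[OF t]] unfolding at_within_open[OF sub[OF t] \<open>open S\<close>] .
  moreover have "((\<lambda>t. Complex x t) has_vector_derivative \<i>) (at t within {a..b})"
    by (auto simp: Complex_eq intro!: derivative_eq_intros)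
  ultimately show "((\<lambda>t. \<Phi> (Complex x t)) has_vector_derivative \<i> * f (Complex x t)) (at t within {a..b})"
    using field_vector_diff_chain_within[of "\<lambda>t. Complex x t" \<i> t "{a..b}" \<Phi> "f (Complex x t)"]
    by (simp add: comp_def has_field_derivative_at_within)
next
  show "continuous_on {a..b} (\<lambda>t. \<i> * f (Complex x t))"
    by (intro continuous_intros continuous_on_compose2[OF assms(3)])
       (auto intro!: continuous_intros sub[unfolded Complex_eq] simp: Complex_eq)
qed fact

lemma set_integral_tendsto:
  fixes f :: "real \<Rightarrow> complex"
  assumes "set_integrable lborel A f" and "\<And>n. B n \<in> sets borel" and "\<And>n. B n \<subseteq> A"
    and "\<And>x. x \<in> A \<Longrightarrow> eventually (\<lambda>n. x \<in> B n) sequentially"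
  shows "(\<lambda>n. LBINT x:B n. f x) \<longlonglongrightarrow> (LBINT x:A. f x)"
  unfolding set_lebesgue_integral_def
proof (rule integral_dominated_convergence[where w="\<lambda>x. norm (indicator A x *\<^sub>R f x)"])
  show "integrable lborel (\<lambda>x. norm (indicator A x *\<^sub>R f x))"
    using assms(1) unfolding set_integrable_def by (rule integrable_norm)
  show m: "(\<lambda>x. indicator A x *\<^sub>R f x) \<in> borel_measurable lborel"
    using assms(1) by (auto simp: set_integrable_def)
  show "(\<lambda>x. indicator (B n) x *\<^sub>R f x) \<in> borel_measurable lborel" for n
  proof -
    have "(\<lambda>x. indicator (B n) x *\<^sub>R (indicator A x *\<^sub>R f x)) \<in> borel_measurable lborel"
      using assms(2) by (intro borel_measurable_scaleR m) auto
    also have "(\<lambda>x. indicator (B n) x *\<^sub>R (indicator A x *\<^sub>R f x)) = (\<lambda>x. indicator (B n) x *\<^sub>R f x)"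
      using assms(3)[of n] by (auto simp: indicator_def fun_eq_iff)
    finally show ?thesis .
  qed
  show "AE x in lborel. (\<lambda>n. indicator (B n) x *\<^sub>R f x) \<longlonglongrightarrow> indicator A x *\<^sub>R f x"
  proof (rule AE_I2)
    fix x
    have "eventually (\<lambda>n. indicator A x *\<^sub>R f x = indicator (B n) x *\<^sub>R f x) sequentially"
    proof (cases "x \<in> A")
      case True
      from assms(4)[OF this] show ?thesis by eventually_elim (auto simp: True)
    next
      case False
      then have "x \<notin> B n" for n using assms(3)[of n] by blast
      with False show ?thesis by simp
    qed
    then show "(\<lambda>n. indicator (B n) x *\<^sub>R f x) \<longlonglongrightarrow> indicator A x *\<^sub>R f x"
      by (rule Lim_transform_eventually[OF tendsto_const])
  qed
  show "AE x in lborel. norm (indicator (B n) x *\<^sub>R f x) \<le> norm (indicator A x *\<^sub>R f x)" for n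
    using assms(3)[of n] by (auto simp: indicator_def)
qed

text \<open>Cauchy's theorem on the rectangle from - n to \<open>l\<close>, with n tending to
  infinity: the left side is bounded by \<open>B (- n)\<close> times the height and disappears,
  while the right side survives as the vertical integral.\<close>

lemma shift_left_ray:
  assumes S: "open S" "convex S" "f holomorphic_on S" and "y' \<le> y"
    and sub: "\<And>u t. u \<le> l \<Longrightarrow> y' \<le> t \<Longrightarrow> t \<le> y \<Longrightarrow> Complex u t \<in> S"
    and bound: "\<And>u t. u \<le> l \<Longrightarrow> y' \<le> t \<Longrightarrow> t \<le> y \<Longrightarrow> norm (f (Complex u t)) \<le> B u"
    and "(B \<longlongrightarrow> 0) at_bot"
    and int: "set_integrable lborel {..l} (\<lambda>u. f (Complex u y))"
      "set_integrable lborel {..l} (\<lambda>u. f (Complex u y'))"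
  shows "(LBINT u:{..l}. f (Complex u y)) =
    (LBINT u:{..l}. f (Complex u y')) + (LBINT t:{y'..y}. \<i> * f (Complex l t))"
proof -
  obtain \<Phi> where \<Phi>: "\<And>z. z \<in> S \<Longrightarrow> (\<Phi> has_field_derivative f z) (at z within S)"
    using holomorphic_convex_primitive'[OF S(2,1,3)] by blast
  have cont: "continuous_on S f" using S(3) by (rule holomorphic_on_imp_continuous_on)
  have ev: "eventually (\<lambda>n. - real n \<le> l) sequentially"
    using eventually_ge_at_top[of "nat \<lceil>- l\<rceil>"] by eventually_elim linarith
  have lim: "(\<lambda>n. LBINT u:{- real n..l}. f (Complex u t)) \<longlonglongrightarrow> (LBINT u:{..l}. f (Complex u t))"
    if "set_integrable lborel {..l} (\<lambda>u. f (Complex u t))" for t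
  proof (rule set_integral_tendsto[OF that])
    fix x assume "x \<in> {..l}"
    have "eventually (\<lambda>n. - x \<le> real n) sequentially"
      using eventually_ge_at_top[of "nat \<lceil>- x\<rceil>"] by eventually_elim linarith
    then show "eventually (\<lambda>n. x \<in> {- real n..l}) sequentially"
      by eventually_elim (use \<open>x \<in> {..l}\<close> in auto)
  qed auto
  have "(\<lambda>n. (LBINT u:{- real n..l}. f (Complex u y)) - (LBINT u:{- real n..l}. f (Complex u y'))
      - (\<Phi> (Complex l y) - \<Phi> (Complex l y'))) \<longlonglongrightarrow> 0"
  proof (rule Lim_null_comparison)
    show "eventually (\<lambda>n. norm ((LBINT u:{- real n..l}. f (Complex u y)) - (LBINT u:{- real n..l}. f (Complex u y'))
      - (\<Phi> (Complex l y) - \<Phi> (Complex l y'))) \<le> B (- real n) * \<bar>y' - y\<bar>) sequentially"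
      using ev
    proof eventually_elim
      case (elim n)
      have i: "(LBINT u:{- real n..l}. f (Complex u t)) = \<Phi> (Complex l t) - \<Phi> (Complex (- real n) t)"
        if "y' \<le> t" "t \<le> y" for t
        by (rule primitive_horizontal_integral[OF \<Phi> S(1) cont elim]) (use sub that in auto)
      have "norm (\<Phi> (Complex (- real n) y') - \<Phi> (Complex (- real n) y)) \<le> B (- real n) * \<bar>y' - y\<bar>"
        by (rule primitive_vertical_bound[OF S(2) \<Phi>]) (use sub bound elim \<open>y' \<le> y\<close> in auto)
      moreover have "(LBINT u:{- real n..l}. f (Complex u y)) - (LBINT u:{- real n..l}. f (Complex u y'))
          - (\<Phi> (Complex l y) - \<Phi> (Complex l y')) = \<Phi> (Complex (- real n) y') - \<Phi> (Complex (- real n) y)"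
        unfolding i[OF \<open>y' \<le> y\<close> order_refl] i[OF order_refl \<open>y' \<le> y\<close>] by simp
      ultimately show ?case by simp
    qed
    have "filterlim (\<lambda>n. - real n) at_bot sequentially"
      by (simp add: filterlim_uminus_at_bot filterlim_real_sequentially)
    then have "(\<lambda>n. B (- real n)) \<longlonglongrightarrow> 0" using \<open>(B \<longlongrightarrow> 0) at_bot\<close> filterlim_compose by blast
    then show "(\<lambda>n. B (- real n) * \<bar>y' - y\<bar>) \<longlonglongrightarrow> 0" by (rule tendsto_mult_left_zero)
  qed
  moreover have "(\<lambda>n. (LBINT u:{- real n..l}. f (Complex u y)) - (LBINT u:{- real n..l}. f (Complex u y'))
      - (\<Phi> (Complex l y) - \<Phi> (Complex l y'))) \<longlonglongrightarrow> (LBINT u:{..l}. f (Complex u y)) - (LBINT u:{..l}. f (Complex u y'))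
      - (\<Phi> (Complex l y) - \<Phi> (Complex l y'))"
    by (intro tendsto_intros lim int)
  ultimately have "(LBINT u:{..l}. f (Complex u y)) - (LBINT u:{..l}. f (Complex u y'))
      - (\<Phi> (Complex l y) - \<Phi> (Complex l y')) = 0"
    using LIMSEQ_unique by blast
  moreover have "(LBINT t:{y'..y}. \<i> * f (Complex l t)) = \<Phi> (Complex l y) - \<Phi> (Complex l y')"
    by (rule primitive_vertical_integral[OF \<Phi> S(1) cont \<open>y' \<le> y\<close>]) (use sub in auto)
  ultimately have "(LBINT u:{..l}. f (Complex u y)) - (LBINT u:{..l}. f (Complex u y')) =
      (LBINT t:{y'..y}. \<i> * f (Complex l t))" by simp
  then show ?thesis by (metis diff_add_cancel add.commute)
qed

text \<open>The end \<open>l\<close> of a shifted left ray is sent to plus infinity, where the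
  remaining vertical integral vanishes as well.\<close>

lemma shift_line:
  assumes S: "open S" "convex S" "f holomorphic_on S" and "y' \<le> y"
    and sub: "\<And>u t. y' \<le> t \<Longrightarrow> t \<le> y \<Longrightarrow> Complex u t \<in> S"
    and bound: "\<And>u t. y' \<le> t \<Longrightarrow> t \<le> y \<Longrightarrow> norm (f (Complex u t)) \<le> B u"
    and lim: "(B \<longlongrightarrow> 0) at_bot" "(B \<longlongrightarrow> 0) at_top"
    and int: "integrable lborel (\<lambda>u. f (Complex u y))" "integrable lborel (\<lambda>u. f (Complex u y'))"
  shows "(LBINT u. f (Complex u y)) = (LBINT u. f (Complex u y'))"
proof -
  have cont: "continuous_on S f" using S(3) by (rule holomorphic_on_imp_continuous_on)
  have si: "set_integrable lborel A (\<lambda>u. f (Complex u t))"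
    if "integrable lborel (\<lambda>u. f (Complex u t))" "A \<in> sets borel" for t A
    unfolding set_integrable_def by (rule integrable_mult_indicator) (use that in auto)
  have lim': "(\<lambda>n. LBINT u:{..real n}. f (Complex u t)) \<longlonglongrightarrow> (LBINT u. f (Complex u t))"
    if "integrable lborel (\<lambda>u. f (Complex u t))" for t
  proof -
    have "(\<lambda>n. LBINT u:{..real n}. f (Complex u t)) \<longlonglongrightarrow> (LBINT u:UNIV. f (Complex u t))"
    proof (rule set_integral_tendsto)
      show "set_integrable lborel UNIV (\<lambda>u. f (Complex u t))" using that by (auto intro: si)
      fix x :: real
      have "eventually (\<lambda>n. x \<le> real n) sequentially"
        using eventually_ge_at_top[of "nat \<lceil>x\<rceil>"] by eventually_elim linarith
      then show "eventually (\<lambda>n. x \<in> {..real n}) sequentially" by simp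
    qed auto
    then show ?thesis by (simp add: set_lebesgue_integral_def)
  qed
  have "(\<lambda>n. (LBINT u:{..real n}. f (Complex u y)) - (LBINT u:{..real n}. f (Complex u y'))) \<longlonglongrightarrow> 0"
  proof (rule Lim_null_comparison)
    show "eventually (\<lambda>n. norm ((LBINT u:{..real n}. f (Complex u y)) - (LBINT u:{..real n}. f (Complex u y')))
       \<le> B (real n) * \<bar>y - y'\<bar>) sequentially"
    proof (rule always_eventually, rule allI)
      fix n
      obtain \<Phi> where \<Phi>: "\<And>z. z \<in> S \<Longrightarrow> (\<Phi> has_field_derivative f z) (at z within S)"
        using holomorphic_convex_primitive'[OF S(2,1,3)] by blast
      have "(LBINT u:{..real n}. f (Complex u y)) =
          (LBINT u:{..real n}. f (Complex u y')) + (LBINT t:{y'..y}. \<i> * f (Complex (real n) t))"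
        by (rule shift_left_ray[OF S \<open>y' \<le> y\<close>, of _ B]) (use sub bound lim int in \<open>auto intro: si\<close>)
      moreover have "(LBINT t:{y'..y}. \<i> * f (Complex (real n) t)) = \<Phi> (Complex (real n) y) - \<Phi> (Complex (real n) y')"
        by (rule primitive_vertical_integral[OF \<Phi> S(1) cont \<open>y' \<le> y\<close>]) (use sub in auto)
      moreover have "norm (\<Phi> (Complex (real n) y) - \<Phi> (Complex (real n) y')) \<le> B (real n) * \<bar>y - y'\<bar>"
        by (rule primitive_vertical_bound[OF S(2) \<Phi>]) (use sub bound \<open>y' \<le> y\<close> in auto)
      ultimately show "norm ((LBINT u:{..real n}. f (Complex u y)) - (LBINT u:{..real n}. f (Complex u y')))
          \<le> B (real n) * \<bar>y - y'\<bar>" by simp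
    qed
    have "(\<lambda>n. B (real n)) \<longlonglongrightarrow> 0" using lim(2) filterlim_real_sequentially filterlim_compose by blast
    then show "(\<lambda>n. B (real n) * \<bar>y - y'\<bar>) \<longlonglongrightarrow> 0" by (rule tendsto_mult_left_zero)
  qed
  moreover have "(\<lambda>n. (LBINT u:{..real n}. f (Complex u y)) - (LBINT u:{..real n}. f (Complex u y')))
     \<longlonglongrightarrow> (LBINT u. f (Complex u y)) - (LBINT u. f (Complex u y'))"
    by (intro tendsto_intros lim' int)
  ultimately show ?thesis using LIMSEQ_unique by fastforce
qed

subsection \<open>The Mellin kernel\<close>

text \<open>Substituting t - x0 = exp s and z - x0 = exp \<zeta> in the integral of (t - x0)^\<beta>
  / (z - t) gives exp (\<beta> \<zeta>) times this function of s - \<zeta>, with \<gamma> = \<beta>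
  + 1; after subtraction of the value at the edge, \<gamma> = \<beta>.\<close>

definition mellin_kernel :: "real \<Rightarrow> complex \<Rightarrow> complex" where
  "mellin_kernel \<gamma> v = exp (of_real \<gamma> * v) / (1 - exp v)"

text \<open>Up to a constant phase this is the kernel on the line Im v = - pi; for 0 < \<gamma> < 1
  its integral is pi / sin (pi \<gamma>). Up to a constant it also bounds the kernel on every other
  horizontal line that avoids the poles.\<close>

definition mellin_weight :: "real \<Rightarrow> real \<Rightarrow> real" where
  "mellin_weight \<gamma> u = exp (\<gamma> * u) / (1 + exp u)"

text \<open>With y = exp (Re v) and s, c the sine and cosine of the half angle, |1 - exp v|^2 = s^2
  (1 + y)^2 + c^2 (1 - y)^2; the first summand is kept. It vanishes precisely on the lines Im v = 2
  pi k, which carry the poles of the kernel.\<close>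

lemma norm_one_minus_exp_ge: "\<bar>sin (Im v / 2)\<bar> * (1 + exp (Re v)) \<le> norm (1 - exp v)"
proof -
  define y c s where "y = exp (Re v)" and "c = cos (Im v / 2)" and "s = sin (Im v / 2)"
  have cs: "c\<^sup>2 + s\<^sup>2 = 1" by (simp add: c_def s_def)
  have C: "cos (Im v) = c\<^sup>2 - s\<^sup>2" using cos_double[of "Im v / 2"] by (simp add: c_def s_def)
  have expand: "(1 - y * a)\<^sup>2 + (y * b)\<^sup>2 = 1 - 2 * y * a + y\<^sup>2 * (b\<^sup>2 + a\<^sup>2)" for a b :: real
    by (simp add: power2_eq_square algebra_simps)
  have cs': "(sin (Im v))\<^sup>2 + (cos (Im v))\<^sup>2 = 1" by simp
  have "(norm (1 - exp v))\<^sup>2 = (1 - y * cos (Im v))\<^sup>2 + (y * sin (Im v))\<^sup>2"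
    by (simp add: cmod_power2 Re_exp Im_exp y_def)
  also have "\<dots> = 1 - 2 * y * cos (Im v) + y\<^sup>2 * ((sin (Im v))\<^sup>2 + (cos (Im v))\<^sup>2)"
    by (rule expand)
  also have "\<dots> = (c\<^sup>2 + s\<^sup>2) * (1 + y\<^sup>2) - 2 * y * (c\<^sup>2 - s\<^sup>2)"
    unfolding cs' cs by (simp add: C)
  also have "\<dots> = s\<^sup>2 * (1 + y)\<^sup>2 + c\<^sup>2 * (1 - y)\<^sup>2" by (simp add: power2_eq_square algebra_simps)
  finally have "(\<bar>s\<bar> * (1 + y))\<^sup>2 \<le> (norm (1 - exp v))\<^sup>2" by (simp add: power_mult_distrib)
  then show ?thesis unfolding s_def y_def by (rule power2_le_imp_le) simp
qed

lemma norm_mellin_kernel_le: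
  assumes "sin (Im v / 2) \<noteq> 0"
  shows "norm (mellin_kernel \<gamma> v) \<le> mellin_weight \<gamma> (Re v) / \<bar>sin (Im v / 2)\<bar>"
proof -
  have "norm (mellin_kernel \<gamma> v) = exp (\<gamma> * Re v) / norm (1 - exp v)"
    by (simp add: mellin_kernel_def norm_divide)
  also have "\<dots> \<le> exp (\<gamma> * Re v) / (\<bar>sin (Im v / 2)\<bar> * (1 + exp (Re v)))"
    using assms norm_one_minus_exp_ge[of v]
    by (intro divide_left_mono mult_pos_pos less_le_trans[OF _ norm_one_minus_exp_ge])
       (auto intro!: add_pos_pos)
  finally show ?thesis by (simp add: mellin_weight_def mult.commute)
qed

text \<open>For use on the arc, whose angular distance from \<zeta> may pass through multiples of 2
  pi, where the sine bound breaks down. The margin \<open>ln 2\<close> gives exp (Re v) - 1 >= exp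
  (Re v) / 2 instead.\<close>

lemma norm_mellin_kernel_right_le:
  assumes "Re v \<ge> ln 2"
  shows "norm (mellin_kernel \<gamma> v) \<le> 2 * exp (- (1 - \<gamma>) * Re v)"
proof -
  have e: "exp (Re v) \<ge> 2" using assms by (metis exp_le_cancel_iff exp_ln zero_less_numeral)
  have "exp (Re v) / 2 \<le> exp (Re v) - 1" using e by simp
  also have "\<dots> \<le> norm (1 - exp v)"
    using norm_triangle_ineq2[of "exp v" 1] by (simp add: norm_minus_commute)
  finally have "exp (\<gamma> * Re v) / norm (1 - exp v) \<le> exp (\<gamma> * Re v) / (exp (Re v) / 2)"
    using e by (intro divide_left_mono mult_pos_pos) (auto intro: less_le_trans)
  also have "\<dots> = 2 * exp (- (1 - \<gamma>) * Re v)"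
    by (simp add: field_simps flip: exp_add)
  finally show ?thesis by (simp add: mellin_kernel_def norm_divide)
qed

lemma exp_neq_1_if_sin:
  assumes "sin (Im v / 2) \<noteq> 0"
  shows "exp v \<noteq> (1::complex)"
proof
  assume "exp v = 1"
  then have "\<bar>sin (Im v / 2)\<bar> * (1 + exp (Re v)) \<le> 0" using norm_one_minus_exp_ge[of v] by simp
  moreover have "\<bar>sin (Im v / 2)\<bar> * (1 + exp (Re v)) > 0"
    using assms by (intro mult_pos_pos add_pos_pos) auto
  ultimately show False by linarith
qed

lemma holomorphic_mellin_kernel: "mellin_kernel \<gamma> holomorphic_on {v. exp v \<noteq> 1}"
  unfolding mellin_kernel_def[abs_def] by (intro holomorphic_intros) auto

lemma sin_half_nonzero: "0 < y \<Longrightarrow> y < 2 * pi \<Longrightarrow> sin (- y / 2) \<noteq> 0"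
  using sin_gt_zero[of "y / 2"] by simp

section \<open>Decay and integrability of the weight and the kernel\<close>

lemma mellin_weight_nonneg: "mellin_weight \<gamma> u \<ge> 0"
  by (simp add: mellin_weight_def add_nonneg_nonneg)

lemma mellin_weight_le_left: "mellin_weight \<gamma> u \<le> exp (\<gamma> * u)"
  by (simp add: mellin_weight_def divide_le_eq add_pos_pos algebra_simps)

lemma mellin_weight_le_right: "mellin_weight \<gamma> u \<le> exp (- (1 - \<gamma>) * u)"
proof -
  have "exp (\<gamma> * u) = exp (- (1 - \<gamma>) * u) * exp u" by (simp add: algebra_simps flip: exp_add)
  also have "\<dots> \<le> exp (- (1 - \<gamma>) * u) * (1 + exp u)" by (intro mult_left_mono) auto
  finally show ?thesis by (simp add: mellin_weight_def divide_le_eq add_pos_pos)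
qed

lemma borel_measurable_mellin_weight [measurable]: "mellin_weight \<gamma> \<in> borel_measurable borel"
  unfolding mellin_weight_def[abs_def] by measurable

lemma set_integrable_exp_left:
  fixes l \<gamma> :: real
  assumes "\<gamma> > 0"
  shows "set_integrable lborel {..l} (\<lambda>u. exp (\<gamma> * u))"
proof -
  have "set_integrable lborel (einterval (-\<infinity>) l) (\<lambda>u. exp (\<gamma> * u))"
  proof (rule interval_integral_FTC_nonneg(1)[where F="\<lambda>u. exp (\<gamma> * u) / \<gamma>" and A=0 and B="exp (\<gamma> * l) / \<gamma>"])
    show "(((\<lambda>u. exp (\<gamma> * u) / \<gamma>) \<circ> real_of_ereal) \<longlongrightarrow> 0) (at_right (-\<infinity>))"
      unfolding ereal_tendsto_simps using assms by real_asymp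
    show "(((\<lambda>u. exp (\<gamma> * u) / \<gamma>) \<circ> real_of_ereal) \<longlongrightarrow> exp (\<gamma> * l) / \<gamma>) (at_left (ereal l))"
      unfolding ereal_tendsto_simps using assms by (auto intro!: tendsto_intros)
  qed (use assms in \<open>auto intro!: derivative_eq_intros\<close>)
  moreover have "einterval (-\<infinity>) l = {..<l}" by (auto simp: einterval_def)
  moreover have "set_integrable lborel {..<l} (\<lambda>u. exp (\<gamma> * u)) \<longleftrightarrow> set_integrable lborel {..l} (\<lambda>u. exp (\<gamma> * u))"
    unfolding set_integrable_def
  proof (rule integrable_cong_AE)
    show "AE u in lborel. indicator {..<l} u *\<^sub>R exp (\<gamma> * u) = indicator {..l} u *\<^sub>R exp (\<gamma> * u)"
      using AE_lborel_singleton[of l] by eventually_elim (auto simp: indicator_def)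
  qed auto
  ultimately show ?thesis by simp
qed

lemma integrable_mellin_weight:
  assumes "0 < \<gamma>" "\<gamma> < 1"
  shows "integrable lborel (mellin_weight \<gamma>)"
proof -
  have 1: "integrable lborel (\<lambda>u. indicator {..0} u * exp (\<gamma> * u))"
    using set_integrable_exp_left[OF assms(1), of 0] by (simp add: set_integrable_def)
  have "integrable lborel (\<lambda>u. indicator {..0} u * exp ((1 - \<gamma>) * u))"
    using set_integrable_exp_left[of "1 - \<gamma>" 0] assms by (simp add: set_integrable_def)
  from lborel_integrable_real_affine[OF this, of "-1" 0]
  have "integrable lborel (\<lambda>u. indicator {..0} (- u) * exp ((1 - \<gamma>) * (- u)))" by simp
  with 1 have "integrable lborel (\<lambda>u. indicator {..0} u * exp (\<gamma> * u) + indicator {..0} (- u) * exp ((1 - \<gamma>) * (- u)))"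
    by (rule Bochner_Integration.integrable_add)
  then show ?thesis
  proof (rule Bochner_Integration.integrable_bound)
    show "AE u in lborel. norm (mellin_weight \<gamma> u) \<le>
       norm (indicator {..0} u * exp (\<gamma> * u) + indicator {..0} (- u) * exp ((1 - \<gamma>) * (- u)))"
    proof (rule AE_I2)
      fix u
      show "norm (mellin_weight \<gamma> u) \<le>
       norm (indicator {..0} u * exp (\<gamma> * u) + indicator {..0} (- u) * exp ((1 - \<gamma>) * (- u)))"
        using mellin_weight_le_left[of \<gamma> u] mellin_weight_le_right[of \<gamma> u] mellin_weight_nonneg[of \<gamma> u]
        by (auto simp: indicator_def algebra_simps)
    qed
  qed auto
qed

lemma mellin_weight_tendsto:
  assumes "0 < \<gamma>" "\<gamma> < 1"
  shows "(mellin_weight \<gamma> \<longlongrightarrow> 0) at_bot" "(mellin_weight \<gamma> \<longlongrightarrow> 0) at_top"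
  unfolding mellin_weight_def[abs_def] using assms by real_asymp+

lemma integrable_mellin_kernel:
  assumes "0 < \<gamma>" "\<gamma> < 1" "0 < \<kappa>" "\<kappa> < 2 * pi"
  shows "integrable lborel (\<lambda>u. mellin_kernel \<gamma> (Complex u (- \<kappa>)))"
proof (rule Bochner_Integration.integrable_bound[where f="\<lambda>u. mellin_weight \<gamma> u / \<bar>sin (- \<kappa> / 2)\<bar>"])
  show "integrable lborel (\<lambda>u. mellin_weight \<gamma> u / \<bar>sin (- \<kappa> / 2)\<bar>)"
    using integrable_mellin_weight[OF assms(1,2)] by simp
  have "continuous_on UNIV (\<lambda>u. mellin_kernel \<gamma> (Complex u (- \<kappa>)))"
    unfolding mellin_kernel_def Complex_eq
    by (intro continuous_intros)
       (use exp_neq_1_if_sin[of "Complex _ (- \<kappa>)"] sin_half_nonzero[OF assms(3,4)] in \<open>auto simp: Complex_eq\<close>)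
  then show "(\<lambda>u. mellin_kernel \<gamma> (Complex u (- \<kappa>))) \<in> borel_measurable lborel"
    using borel_measurable_continuous_onI by simp
  show "AE u in lborel. norm (mellin_kernel \<gamma> (Complex u (- \<kappa>))) \<le> norm (mellin_weight \<gamma> u / \<bar>sin (- \<kappa> / 2)\<bar>)"
    using norm_mellin_kernel_le[of "Complex _ (- \<kappa>)" \<gamma>] sin_half_nonzero[OF assms(3,4)]
    by (intro AE_I2) (simp add: mellin_weight_nonneg)
qed

text \<open>The sine rises up to pi / 2 and falls afterwards, so on a closed subinterval of (0, pi)
  its minimum is at an endpoint. A bound for the two extreme angles of a strip thus becomes one for
  all of it.\<close>

lemma sin_lower_bound_interval:
  assumes "0 < a" "a \<le> t" "t \<le> b" "b < pi"
  shows "sin t \<ge> min (sin a) (sin b)"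
proof (cases "t \<le> pi / 2")
  case True
  then have "sin a \<le> sin t" using assms by (intro sin_monotone_2pi_le) auto
  then show ?thesis by simp
next
  case False
  then have "sin (pi - b) \<le> sin (pi - t)" using assms by (intro sin_monotone_2pi_le) auto
  then show ?thesis by simp
qed

text \<open>No pole of the kernel lies in - 2 pi < Im v < 0, so the line can be moved to Im v = -
  pi. There 1 - exp v is the positive number 1 + exp u, and the whole phase comes from the
  numerator.\<close>

lemma mellin_integral:
  assumes "0 < \<gamma>" "\<gamma> < 1" "0 < \<kappa>" "\<kappa> < 2 * pi"
  shows "(LBINT u. mellin_kernel \<gamma> (Complex u (- \<kappa>))) = cis (- \<gamma> * pi) * of_real (LBINT u. mellin_weight \<gamma> u)"
proof -
  let ?S = "{v. -2 * pi < Im v} \<inter> {v. Im v < 0}"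
  have S: "open ?S" "convex ?S"
    by (auto intro: open_Int open_halfspace_Im_gt open_halfspace_Im_lt convex_Int convex_halfspace_Im_gt convex_halfspace_Im_lt)
  have hol: "mellin_kernel \<gamma> holomorphic_on ?S"
  proof (rule holomorphic_on_subset[OF holomorphic_mellin_kernel], safe)
    fix v assume "-2 * pi < Im v" "Im v < 0" "exp v = 1"
    then show False using exp_neq_1_if_sin[of v] sin_half_nonzero[of "- Im v"] by auto
  qed
  have key: "(LBINT u. mellin_kernel \<gamma> (Complex u (- k1))) = (LBINT u. mellin_kernel \<gamma> (Complex u (- k2)))"
    if k: "0 < k1" "k1 \<le> k2" "k2 < 2 * pi" for k1 k2
  proof (rule shift_line[OF S hol, where B="\<lambda>u. mellin_weight \<gamma> u / min (sin (k1/2)) (sin (k2/2))"])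
    fix u t assume t: "- k2 \<le> t" "t \<le> - k1"
    have m: "min (sin (k1/2)) (sin (k2/2)) > 0" using k by (auto intro!: sin_gt_zero)
    have "sin (- t / 2) \<ge> min (sin (k1/2)) (sin (k2/2))"
      by (rule sin_lower_bound_interval) (use k t in auto)
    then have s: "\<bar>sin (t / 2)\<bar> \<ge> min (sin (k1/2)) (sin (k2/2))" by simp
    then have "norm (mellin_kernel \<gamma> (Complex u t)) \<le> mellin_weight \<gamma> u / \<bar>sin (t / 2)\<bar>"
      using norm_mellin_kernel_le[of "Complex u t" \<gamma>] m by auto
    also have "\<dots> \<le> mellin_weight \<gamma> u / min (sin (k1/2)) (sin (k2/2))"
      using s m mellin_weight_nonneg by (intro divide_left_mono mult_pos_pos) auto
    finally show "norm (mellin_kernel \<gamma> (Complex u t)) \<le> mellin_weight \<gamma> u / min (sin (k1/2)) (sin (k2/2))" .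
  qed (use k assms mellin_weight_tendsto[OF assms(1,2)] in
        \<open>auto intro!: integrable_mellin_kernel tendsto_divide_zero\<close>)
  have "(LBINT u. mellin_kernel \<gamma> (Complex u (- \<kappa>))) = (LBINT u. mellin_kernel \<gamma> (Complex u (- pi)))"
    using key[of \<kappa> pi] key[of pi \<kappa>] assms by (cases "\<kappa> \<le> pi") auto
  also have "\<dots> = (LBINT u. cis (- \<gamma> * pi) * of_real (mellin_weight \<gamma> u))"
  proof (rule Bochner_Integration.integral_cong[OF refl])
    fix u
    have "exp (Complex u (- pi)) = - of_real (exp u)" by (simp add: complex_eq_iff Re_exp Im_exp)
    moreover have "exp (of_real \<gamma> * Complex u (- pi)) = of_real (exp (\<gamma> * u)) * cis (- \<gamma> * pi)"
      by (simp add: exp_eq_polar)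
    ultimately show "mellin_kernel \<gamma> (Complex u (- pi)) = cis (- \<gamma> * pi) * of_real (mellin_weight \<gamma> u)"
      by (simp add: mellin_kernel_def mellin_weight_def)
  qed
  also have "\<dots> = cis (- \<gamma> * pi) * of_real (LBINT u. mellin_weight \<gamma> u)" by simp
  finally show ?thesis .
qed

lemma mellin_integral_pos:
  assumes "0 < \<gamma>" "\<gamma> < 1"
  shows "(LBINT u. mellin_weight \<gamma> u) > 0"
proof -
  have "\<not> (AE u in lborel. mellin_weight \<gamma> u = 0)"
  proof
    assume "AE u in lborel. mellin_weight \<gamma> u = 0"
    then have "AE u in (lborel::real measure). False"
      by eventually_elim (simp add: mellin_weight_def add_pos_pos less_imp_neq[THEN not_sym])
    then show False by (simp add: AE_iff_null null_sets_def)
  qed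
  then show ?thesis
    using integral_nonneg_eq_0_iff_AE[OF integrable_mellin_weight[OF assms]] mellin_weight_nonneg
    by (auto simp: less_le intro: Bochner_Integration.integral_nonneg)
qed

subsection \<open>Analytic continuation of a Cauchy integral on the logarithmic half strip\<close>

text \<open>The logarithms v = ln r + i \<theta> of a sector of the surface. In this coordinate the
  sector is a convex subset of the plane, where ordinary holomorphy and primitives are at
  hand.\<close>

definition half_strip :: "real \<Rightarrow> real \<Rightarrow> real \<Rightarrow> complex set" where
  "half_strip a b r = {v. a < Im v \<and> Im v < b \<and> Re v < r}"

lemma open_half_strip: "open (half_strip a b r)"
  unfolding half_strip_def by (intro open_Collect_conj open_Collect_less continuous_intros)

lemma convex_half_strip: "convex (half_strip a b r)"
proof -
  have "half_strip a b r = {v. a < Im v} \<inter> {v. Im v < b} \<inter> {v. Re v < r}"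
    by (auto simp: half_strip_def)
  then show ?thesis
    by (auto intro!: convex_Int convex_halfspace_Im_gt convex_halfspace_Im_lt convex_halfspace_Re_lt)
qed

text \<open>
  \<open>N\<close> is the density divided by its power factor, in the coordinate \<open>v = log (x - x\<^sub>0)\<close>; the
  integral of the density along \<open>(x\<^sub>0, x\<^sub>0 + exp l)\<close> is replaced by the ray of argument \<open>\<tau>\<close> followed by
  an arc back to the real axis, so that the argument of the variable may go down to \<open>\<tau>\<close>.
\<close>

locale log_density =
  fixes \<gamma> a b r l c :: real and N :: "complex \<Rightarrow> complex" and g :: "real \<Rightarrow> real"
  assumes gamma: "0 < \<gamma>" "\<gamma> < 1" and ab: "a < 0" "0 < b" and lr: "l < r" and c: "c > 0"
    and hol_N: "N holomorphic_on half_strip a b r"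
    and N_bound: "\<And>v. v \<in> half_strip a b r \<Longrightarrow> norm (N v - of_real c) \<le> c * g (Re v)"
    and g_nonneg: "\<And>u. u < r \<Longrightarrow> g u \<ge> 0"
    and cont_g: "continuous_on {..<r} g" and g_lim: "(g \<longlongrightarrow> 0) at_bot"
begin

text \<open>Up to the factor exp (\<beta> \<zeta>), taken out so that the kernel depends on s -
  \<zeta> alone, this is the regularised Cauchy integral of the density over a ray of argument
  \<tau>.\<close>

definition ray :: "real \<Rightarrow> complex \<Rightarrow> complex" where
  "ray \<tau> \<zeta> = (LBINT s:{..l}. N (Complex s \<tau>) * mellin_kernel \<gamma> (Complex s \<tau> - \<zeta>))"

text \<open>Traversed upward from argument \<tau> to 0, so that \<open>ray\<close> plus
  \<open>arc\<close> belongs to one contour from the edge to distance \<open>exp l\<close> on the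
  real axis.\<close>

definition arc :: "real \<Rightarrow> complex \<Rightarrow> complex" where
  "arc \<tau> \<zeta> = (LBINT t:{\<tau>..0}. \<i> * (N (Complex l t) * mellin_kernel \<gamma> (Complex l t - \<zeta>)))"

section \<open>Bounds and holomorphy of the ray and arc integrals\<close>

lemma g_bounded: "\<exists>B\<ge>0. \<forall>u\<le>l. g u \<le> B"
proof -
  have "eventually (\<lambda>u. g u < 1) at_bot" using g_lim by (rule order_tendstoD) simp
  then obtain u0 where u0: "\<And>u. u \<le> u0 \<Longrightarrow> g u < 1" by (auto simp: eventually_at_bot_linorder)
  have "compact (g ` {u0..l})"
    by (rule compact_continuous_image) (use cont_g lr in \<open>auto intro: continuous_on_subset\<close>)
  then have "bounded (g ` {u0..l})" by (rule compact_imp_bounded)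
  then obtain B where B: "\<And>u. u \<in> {u0..l} \<Longrightarrow> norm (g u) \<le> B" unfolding bounded_iff by blast
  have "g u \<le> max B 1" if "u \<le> l" for u
    using u0[of u] B[of u] that by (cases "u \<le> u0") auto
  then show ?thesis by (intro exI[of _ "max B 1"]) auto
qed

lemma N_bounded: "\<exists>B>0. \<forall>u\<le>l. \<forall>t. a < t \<longrightarrow> t < b \<longrightarrow> norm (N (Complex u t)) \<le> B"
proof -
  obtain B where B: "B \<ge> 0" "\<And>u. u \<le> l \<Longrightarrow> g u \<le> B" using g_bounded by blast
  have "norm (N (Complex u t)) \<le> c + c * B" if "u \<le> l" "a < t" "t < b" for u t
  proof -
    have "norm (N (Complex u t) - of_real c) \<le> c * g u"
      using N_bound[of "Complex u t"] that lr by (auto simp: half_strip_def)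
    also have "\<dots> \<le> c * B" using B that c by (intro mult_left_mono) auto
    finally show ?thesis using norm_triangle_sub[of "N (Complex u t)" "of_real c"] c by simp
  qed
  then show ?thesis using B c by (intro exI[of _ "c + c * B"]) (auto intro: add_pos_nonneg)
qed

lemma continuous_on_N_horizontal: "a < \<tau> \<Longrightarrow> \<tau> < b \<Longrightarrow> continuous_on {..l} (\<lambda>s. N (Complex s \<tau>))"
  by (rule continuous_on_compose2[OF holomorphic_on_imp_continuous_on[OF hol_N]])
     (use lr in \<open>auto simp: half_strip_def Complex_eq intro!: continuous_intros\<close>)

lemma continuous_on_N_vertical: "a < \<tau> \<Longrightarrow> continuous_on {\<tau>..0} (\<lambda>t. N (Complex l t))"
  by (rule continuous_on_compose2[OF holomorphic_on_imp_continuous_on[OF hol_N]])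
     (use lr ab in \<open>auto simp: half_strip_def Complex_eq intro!: continuous_intros\<close>)

lemma continuous_on_kernel_horizontal:
  assumes "\<tau> < Im \<zeta>" "Im \<zeta> < \<tau> + 2 * pi"
  shows "continuous_on A (\<lambda>s. mellin_kernel \<gamma> (Complex s \<tau> - \<zeta>))"
proof (rule continuous_on_compose2[OF holomorphic_on_imp_continuous_on[OF holomorphic_mellin_kernel[of \<gamma>]]])
  show "(\<lambda>s. Complex s \<tau> - \<zeta>) ` A \<subseteq> {v. exp v \<noteq> 1}"
    using exp_neq_1_if_sin[of "Complex _ \<tau> - \<zeta>"] sin_half_nonzero[of "Im \<zeta> - \<tau>"] assms by auto
qed (auto simp: Complex_eq intro!: continuous_intros)

lemma exp_neq_1_if_Re: "Re v > 0 \<Longrightarrow> exp v \<noteq> (1::complex)"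
  by (metis norm_exp_eq_Re exp_eq_one_iff norm_one less_irrefl)

lemma continuous_on_kernel_vertical:
  assumes "Re \<zeta> < l"
  shows "continuous_on A (\<lambda>t. mellin_kernel \<gamma> (Complex l t - \<zeta>))"
proof (rule continuous_on_compose2[OF holomorphic_on_imp_continuous_on[OF holomorphic_mellin_kernel[of \<gamma>]]])
  show "(\<lambda>t. Complex l t - \<zeta>) ` A \<subseteq> {v. exp v \<noteq> 1}"
    using assms exp_neq_1_if_Re by auto
qed (auto simp: Complex_eq intro!: continuous_intros)

lemma ray_measurable:
  assumes "a < \<tau>" "\<tau> < b" "\<tau> < Im \<zeta>" "Im \<zeta> < \<tau> + 2 * pi"
  shows "(\<lambda>s. indicator {..l} s *\<^sub>R (N (Complex s \<tau>) * mellin_kernel \<gamma> (Complex s \<tau> - \<zeta>))) \<in> borel_measurable lborel"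
  unfolding measurable_lborel2 using assms
  by (intro borel_measurable_continuous_on_indicator continuous_on_mult
      continuous_on_N_horizontal continuous_on_kernel_horizontal) auto

text \<open>The strip has width 2 pi because the kernel becomes singular when \<zeta> meets the line
  of the ray or its translate by 2 pi i. On a small ball the angle to the ray stays in a compact
  part of (0, 2 pi), and exp (\<gamma> s) is integrable towards minus infinity.\<close>

lemma ray_dominated:
  assumes "a < \<tau>" "\<tau> < b" "\<tau> < Im \<zeta>" "Im \<zeta> < \<tau> + 2 * pi"
  shows "\<exists>\<rho>>0. \<exists>B. cball \<zeta> \<rho> \<subseteq> {z. \<tau> < Im z \<and> Im z < \<tau> + 2 * pi} \<and> integrable lborel B \<and>
    (\<forall>w\<in>cball \<zeta> \<rho>. \<forall>s. norm (indicator {..l} s *\<^sub>R (N (Complex s \<tau>) * mellin_kernel \<gamma> (Complex s \<tau> - w))) \<le> B s)"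
proof -
  obtain C where C: "C > 0" "\<And>u t. u \<le> l \<Longrightarrow> a < t \<Longrightarrow> t < b \<Longrightarrow> norm (N (Complex u t)) \<le> C"
    using N_bounded by blast
  let ?U = "{z. \<tau> < Im z \<and> Im z < \<tau> + 2 * pi}"
  have "open ?U" by (intro open_Collect_conj open_Collect_less continuous_intros)
  moreover have "\<zeta> \<in> ?U" using assms by simp
  ultimately obtain \<rho> where \<rho>: "\<rho> > 0" "cball \<zeta> \<rho> \<subseteq> ?U" by (meson open_contains_cball)
  define \<sigma> where "\<sigma> = min (sin ((Im \<zeta> - \<rho> - \<tau>) / 2)) (sin ((Im \<zeta> + \<rho> - \<tau>) / 2))"
  \<comment> \<open>The lowest and the highest point of the ball give the extreme angles that enter
    \<sigma>.\<close>
  have "\<zeta> - \<i> * of_real \<rho> \<in> ?U" "\<zeta> + \<i> * of_real \<rho> \<in> ?U"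
    by (rule subsetD[OF \<rho>(2)]; use \<rho>(1) in \<open>simp add: dist_norm norm_mult\<close>)+
  then have I: "Im \<zeta> - \<rho> > \<tau>" "Im \<zeta> + \<rho> < \<tau> + 2 * pi" by auto
  have sp: "\<sigma> > 0" unfolding \<sigma>_def using I \<rho>(1) by (auto intro!: sin_gt_zero)
  \<comment> \<open>The factor exp (\<gamma> (\<rho> - Re \<zeta>)) accounts for Re w >= Re \<zeta>
    - \<rho> on the ball.\<close>
  define B where "B = (\<lambda>s. (C / \<sigma> * exp (\<gamma> * (\<rho> - Re \<zeta>))) * (indicator {..l} s * exp (\<gamma> * s)))"
  have "integrable lborel B"
    using set_integrable_exp_left[OF gamma(1), of l] unfolding B_def set_integrable_def
    by (intro Bochner_Integration.integrable_mult_right) simp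
  moreover have "norm (indicator {..l} s *\<^sub>R (N (Complex s \<tau>) * mellin_kernel \<gamma> (Complex s \<tau> - w))) \<le> B s"
    if w: "w \<in> cball \<zeta> \<rho>" for w s
  proof (cases "s \<le> l")
    case True
    have d: "\<bar>Im (\<zeta> - w)\<bar> \<le> \<rho>" "\<bar>Re (\<zeta> - w)\<bar> \<le> \<rho>"
      using w abs_Im_le_cmod[of "\<zeta> - w"] abs_Re_le_cmod[of "\<zeta> - w"] by (auto simp: dist_norm)
    have "\<sigma> \<le> sin ((Im w - \<tau>) / 2)"
      unfolding \<sigma>_def by (rule sin_lower_bound_interval) (use d I in auto)
    moreover have "\<bar>sin (Im (Complex s \<tau> - w) / 2)\<bar> = \<bar>sin ((Im w - \<tau>) / 2)\<bar>"
      using sin_minus[of "(Im w - \<tau>) / 2"] by (simp add: minus_divide_left)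
    ultimately have s: "\<sigma> \<le> \<bar>sin (Im (Complex s \<tau> - w) / 2)\<bar>" by linarith
    then have "sin (Im (Complex s \<tau> - w) / 2) \<noteq> 0" using sp by force
    then have "norm (mellin_kernel \<gamma> (Complex s \<tau> - w)) \<le> mellin_weight \<gamma> (s - Re w) / \<bar>sin (Im (Complex s \<tau> - w) / 2)\<bar>"
      using norm_mellin_kernel_le[of "Complex s \<tau> - w" \<gamma>] by simp
    also have "\<dots> \<le> exp (\<gamma> * (s - Re w)) / \<sigma>"
      using s sp mellin_weight_le_left by (intro frac_le) auto
    also have "\<dots> \<le> exp (\<gamma> * (s + (\<rho> - Re \<zeta>))) / \<sigma>"
      using sp d gamma(1) by (intro divide_right_mono) auto
    finally have k: "norm (mellin_kernel \<gamma> (Complex s \<tau> - w)) \<le> exp (\<gamma> * (s + (\<rho> - Re \<zeta>))) / \<sigma>" .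
    have "norm (N (Complex s \<tau>) * mellin_kernel \<gamma> (Complex s \<tau> - w)) \<le> C * (exp (\<gamma> * (s + (\<rho> - Re \<zeta>))) / \<sigma>)"
      unfolding norm_mult using C True assms k by (intro mult_mono) auto
    also have "\<dots> = B s" using True by (simp add: B_def distrib_left exp_add)
    finally show ?thesis using True by simp
  qed (simp add: B_def)
  ultimately show ?thesis using \<rho> by blast
qed

lemma ray_integrable:
  assumes "a < \<tau>" "\<tau> < b" "\<tau> < Im \<zeta>" "Im \<zeta> < \<tau> + 2 * pi"
  shows "set_integrable lborel {..l} (\<lambda>s. N (Complex s \<tau>) * mellin_kernel \<gamma> (Complex s \<tau> - \<zeta>))"
proof -
  obtain \<rho> B where "\<rho> > 0" and B: "integrable lborel B"
    "\<And>w s. w\<in>cball \<zeta> \<rho> \<Longrightarrow> norm (indicator {..l} s *\<^sub>R (N (Complex s \<tau>) * mellin_kernel \<gamma> (Complex s \<tau> - w))) \<le> B s"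
    using ray_dominated[OF assms] by blast
  show ?thesis unfolding set_integrable_def
    by (rule Bochner_Integration.integrable_bound[OF B(1) ray_measurable[OF assms]])
       (use B(2)[of \<zeta>] \<open>\<rho> > 0\<close> in \<open>auto intro!: AE_I2 intro: order_trans[OF _ abs_ge_self] simp del: norm_scaleR\<close>)
qed

lemma holomorphic_ray:
  assumes "a < \<tau>" "\<tau> < b"
  shows "ray \<tau> holomorphic_on {z. \<tau> < Im z \<and> Im z < \<tau> + 2 * pi}"
  unfolding ray_def[abs_def] set_lebesgue_integral_def
proof (rule holomorphic_on_lebesgue_integral)
  show "open {z. \<tau> < Im z \<and> Im z < \<tau> + 2 * pi}"
    by (intro open_Collect_conj open_Collect_less continuous_intros)
  show "(\<lambda>z. indicator {..l} s *\<^sub>R (N (Complex s \<tau>) * mellin_kernel \<gamma> (Complex s \<tau> - z)))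
      holomorphic_on {z. \<tau> < Im z \<and> Im z < \<tau> + 2 * pi}" for s
  proof -
    have "(mellin_kernel \<gamma> \<circ> (\<lambda>z. Complex s \<tau> - z)) holomorphic_on {z. \<tau> < Im z \<and> Im z < \<tau> + 2 * pi}"
    proof (rule holomorphic_on_compose_gen[OF _ holomorphic_mellin_kernel])
      show "(\<lambda>z. Complex s \<tau> - z) ` {z. \<tau> < Im z \<and> Im z < \<tau> + 2 * pi} \<subseteq> {v. exp v \<noteq> 1}"
        using exp_neq_1_if_sin[of "Complex s \<tau> - _"] sin_half_nonzero[of "Im _ - \<tau>"] by fastforce
    qed (intro holomorphic_intros)
    then show ?thesis unfolding scaleR_conv_of_real comp_def by (intro holomorphic_intros)
  qed
qed (use assms ray_measurable ray_dominated in auto)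

lemma arc_kernel_bound:
  assumes "Re \<zeta> \<le> l - ln 2"
  shows "norm (mellin_kernel \<gamma> (Complex l t - \<zeta>)) \<le> 2 * exp (- (1 - \<gamma>) * (l - Re \<zeta>))"
  using norm_mellin_kernel_right_le[of "Complex l t - \<zeta>" \<gamma>] assms by simp

lemma arc_measurable:
  assumes "a < \<tau>" "Re \<zeta> < l"
  shows "(\<lambda>t. indicator {\<tau>..0} t *\<^sub>R (\<i> * (N (Complex l t) * mellin_kernel \<gamma> (Complex l t - \<zeta>)))) \<in> borel_measurable lborel"
  unfolding measurable_lborel2 using assms
  by (intro borel_measurable_continuous_on_indicator continuous_on_mult continuous_on_const
      continuous_on_N_vertical continuous_on_kernel_vertical) auto

lemma holomorphic_arc:
  assumes "a < \<tau>"
  shows "arc \<tau> holomorphic_on {z. Re z < l - ln 2}"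
  unfolding arc_def[abs_def] set_lebesgue_integral_def
proof (rule holomorphic_on_lebesgue_integral)
  obtain C where C: "C > 0" "\<And>u t. u \<le> l \<Longrightarrow> a < t \<Longrightarrow> t < b \<Longrightarrow> norm (N (Complex u t)) \<le> C"
    using N_bounded by blast
  show op: "open {z. Re z < l - ln 2}" by (rule open_halfspace_Re_lt)
  have l2: "ln 2 > (0::real)" by simp
  show "(\<lambda>z. indicator {\<tau>..0} t *\<^sub>R (\<i> * (N (Complex l t) * mellin_kernel \<gamma> (Complex l t - z))))
      holomorphic_on {z. Re z < l - ln 2}" for t
  proof -
    have "(mellin_kernel \<gamma> \<circ> (\<lambda>z. Complex l t - z)) holomorphic_on {z. Re z < l - ln 2}"
    proof (rule holomorphic_on_compose_gen[OF _ holomorphic_mellin_kernel])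
      show "(\<lambda>z. Complex l t - z) ` {z. Re z < l - ln 2} \<subseteq> {v. exp v \<noteq> 1}"
      proof clarify
        fix z assume "Re z < l - ln 2" "exp (Complex l t - z) = 1"
        then show False using exp_neq_1_if_Re[of "Complex l t - z"] l2 by simp
      qed
    qed (intro holomorphic_intros)
    then show ?thesis unfolding scaleR_conv_of_real comp_def by (intro holomorphic_intros)
  qed
  fix z assume z: "z \<in> {z. Re z < l - ln 2}"
  then have zl: "Re z < l" using ln_gt_zero[of "2::real"] by (auto simp del: ln_gt_zero_iff)
  show "(\<lambda>t. indicator {\<tau>..0} t *\<^sub>R (\<i> * (N (Complex l t) * mellin_kernel \<gamma> (Complex l t - z)))) \<in> borel_measurable lborel"
    by (intro arc_measurable assms zl)
  obtain \<rho> where \<rho>: "\<rho> > 0" "cball z \<rho> \<subseteq> {z. Re z < l - ln 2}" using op z by (meson open_contains_cball)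
  \<comment> \<open>Re w < l - ln 2 makes the exponential in \<open>arc_kernel_bound\<close> at most
    1, so the kernel is at most 2 on the arc.\<close>
  define B where "B = (\<lambda>t. indicator {\<tau>..0} t * (2 * C) :: real)"
  have "integrable lborel B" unfolding B_def
    by (intro integrable_mult_left integrable_real_indicator) (auto simp: emeasure_lborel_Icc_eq)
  moreover have "norm (indicator {\<tau>..0} t *\<^sub>R (\<i> * (N (Complex l t) * mellin_kernel \<gamma> (Complex l t - w)))) \<le> B t"
    if w: "w \<in> cball z \<rho>" for w t
  proof (cases "t \<in> {\<tau>..0}")
    case True
    have w': "Re w < l - ln 2" using w \<rho>(2) by auto
    have "norm (mellin_kernel \<gamma> (Complex l t - w)) \<le> 2 * exp (- (1 - \<gamma>) * (l - Re w))"
      using w' by (intro arc_kernel_bound) auto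
    moreover have "- (1 - \<gamma>) * (l - Re w) \<le> 0"
      using w' l2 gamma by (intro mult_nonpos_nonneg) linarith+
    ultimately have "norm (mellin_kernel \<gamma> (Complex l t - w)) \<le> 2 * 1"
      by (smt (verit) exp_le_one_iff)
    then have "norm (N (Complex l t) * mellin_kernel \<gamma> (Complex l t - w)) \<le> C * (2 * 1)"
      unfolding norm_mult using C True assms ab by (intro mult_mono) auto
    then show ?thesis using True by (simp add: B_def norm_mult)
  qed (auto simp: B_def)
  ultimately show "\<exists>r>0. \<exists>B. cball z r \<subseteq> {z. Re z < l - ln 2} \<and> integrable lborel B \<and>
      (\<forall>w\<in>cball z r. \<forall>t\<in>space lborel. norm (indicator {\<tau>..0} t *\<^sub>R (\<i> * (N (Complex l t) * mellin_kernel \<gamma> (Complex l t - w)))) \<le> B t)"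
    using \<rho> by blast
qed

text \<open>Shifting the ray from \<tau> to \<tau>' produces exactly the piece of arc between the
  two arguments. No pole is crossed as long as \<zeta> lies above both rays and less than 2 pi away
  from them.\<close>

lemma ray_arc_independent_aux:
  assumes "a < \<tau>'" "\<tau>' \<le> \<tau>" "\<tau> \<le> 0" "\<tau> < Im \<zeta>" "Im \<zeta> < \<tau>' + 2 * pi" "Re \<zeta> < l"
  shows "ray \<tau> \<zeta> + arc \<tau> \<zeta> = ray \<tau>' \<zeta> + arc \<tau>' \<zeta>"
proof -
  obtain C where C: "C > 0" "\<And>u t. u \<le> l \<Longrightarrow> a < t \<Longrightarrow> t < b \<Longrightarrow> norm (N (Complex u t)) \<le> C"
    using N_bounded by blast
  let ?f = "\<lambda>s. N s * mellin_kernel \<gamma> (s - \<zeta>)"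
  \<comment> \<open>Between \<zeta> and its translate by - 2 pi i the kernel has no pole; S is the
    part of that strip where N is holomorphic too.\<close>
  define S where "S = half_strip (max a (Im \<zeta> - 2 * pi)) (min b (Im \<zeta>)) r"
  define \<sigma> where "\<sigma> = min (sin ((Im \<zeta> - \<tau>) / 2)) (sin ((Im \<zeta> - \<tau>') / 2))"
  have sp: "\<sigma> > 0" unfolding \<sigma>_def using assms by (auto intro!: sin_gt_zero)
  have "(LBINT u:{..l}. ?f (Complex u \<tau>)) = (LBINT u:{..l}. ?f (Complex u \<tau>')) + (LBINT t:{\<tau>'..\<tau>}. \<i> * ?f (Complex l t))"
  proof (rule shift_left_ray[where S=S and B="\<lambda>u. C / \<sigma> * exp (\<gamma> * (u - Re \<zeta>))"])
    show "open S" "convex S" unfolding S_def by (rule open_half_strip convex_half_strip)+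
    have "(mellin_kernel \<gamma> \<circ> (\<lambda>s. s - \<zeta>)) holomorphic_on S"
    proof (rule holomorphic_on_compose_gen[OF _ holomorphic_mellin_kernel])
      show "(\<lambda>s. s - \<zeta>) ` S \<subseteq> {v. exp v \<noteq> 1}"
      proof clarify
        fix s assume "s \<in> S" "exp (s - \<zeta>) = 1"
        then show False using exp_neq_1_if_sin[of "s - \<zeta>"] sin_half_nonzero[of "Im \<zeta> - Im s"]
          by (auto simp: S_def half_strip_def)
      qed
    qed (intro holomorphic_intros)
    moreover have "N holomorphic_on S"
      by (rule holomorphic_on_subset[OF hol_N]) (auto simp: S_def half_strip_def)
    ultimately show "?f holomorphic_on S" unfolding comp_def by (intro holomorphic_intros)
    show "Complex u t \<in> S" if "u \<le> l" "\<tau>' \<le> t" "t \<le> \<tau>" for u t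
      using that assms lr ab by (auto simp: S_def half_strip_def)
    show "norm (?f (Complex u t)) \<le> C / \<sigma> * exp (\<gamma> * (u - Re \<zeta>))" if t: "u \<le> l" "\<tau>' \<le> t" "t \<le> \<tau>" for u t
    proof -
      have "\<sigma> \<le> sin ((Im \<zeta> - t) / 2)"
        unfolding \<sigma>_def by (rule sin_lower_bound_interval) (use assms t in auto)
      moreover have "\<bar>sin (Im (Complex u t - \<zeta>) / 2)\<bar> = \<bar>sin ((Im \<zeta> - t) / 2)\<bar>"
        using sin_minus[of "(Im \<zeta> - t) / 2"] by (simp add: minus_divide_left)
      ultimately have s: "\<sigma> \<le> \<bar>sin (Im (Complex u t - \<zeta>) / 2)\<bar>" by linarith
      then have "sin (Im (Complex u t - \<zeta>) / 2) \<noteq> 0" using sp by force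
      then have "norm (mellin_kernel \<gamma> (Complex u t - \<zeta>)) \<le> mellin_weight \<gamma> (u - Re \<zeta>) / \<bar>sin (Im (Complex u t - \<zeta>) / 2)\<bar>"
        using norm_mellin_kernel_le[of "Complex u t - \<zeta>" \<gamma>] by simp
      also have "\<dots> \<le> exp (\<gamma> * (u - Re \<zeta>)) / \<sigma>"
        using s sp mellin_weight_le_left by (intro frac_le) auto
      finally have "norm (?f (Complex u t)) \<le> C * (exp (\<gamma> * (u - Re \<zeta>)) / \<sigma>)"
        unfolding norm_mult using C t assms ab by (intro mult_mono) auto
      then show ?thesis by simp
    qed
    show "((\<lambda>u. C / \<sigma> * exp (\<gamma> * (u - Re \<zeta>))) \<longlongrightarrow> 0) at_bot"
      using gamma(1) by (intro tendsto_mult_right_zero) real_asymp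
  qed (use assms ab in \<open>auto intro!: ray_integrable\<close>)
  moreover have "arc \<tau>' \<zeta> = (LBINT t:{\<tau>'..\<tau>}. \<i> * ?f (Complex l t)) + arc \<tau> \<zeta>"
  proof -
    have si: "set_integrable lborel {\<tau>'..0} (\<lambda>t. \<i> * ?f (Complex l t))"
      by (rule borel_integrable_atLeastAtMost')
         (intro continuous_intros continuous_on_N_vertical continuous_on_kernel_vertical assms)
    have "{\<tau>'..0} = {\<tau>'..\<tau>} \<union> {\<tau><..0}" using assms by auto
    moreover have "(LBINT t:{\<tau>'..\<tau>} \<union> {\<tau><..0}. \<i> * ?f (Complex l t)) =
       (LBINT t:{\<tau>'..\<tau>}. \<i> * ?f (Complex l t)) + (LBINT t:{\<tau><..0}. \<i> * ?f (Complex l t))"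
      by (rule set_integral_Un) (use assms in \<open>auto intro: set_integrable_subset[OF si] simp del: set_integrable_mult_right_iff set_integrable_mult_right\<close>)
    moreover have "(LBINT t:{\<tau><..0}. \<i> * ?f (Complex l t)) = arc \<tau> \<zeta>"
      unfolding arc_def set_lebesgue_integral_def
    proof (rule integral_cong_AE)
      show "(\<lambda>t. indicator {\<tau>..0} t *\<^sub>R (\<i> * ?f (Complex l t))) \<in> borel_measurable lborel"
        using assms by (intro arc_measurable) auto
      have "set_integrable lborel {\<tau><..0} (\<lambda>t. \<i> * ?f (Complex l t))"
        by (rule set_integrable_subset[OF si]) (use assms in auto)
      then show "(\<lambda>t. indicator {\<tau><..0} t *\<^sub>R (\<i> * ?f (Complex l t))) \<in> borel_measurable lborel"
        unfolding set_integrable_def by (rule borel_measurable_integrable)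
      show "AE t in lborel. indicator {\<tau><..0} t *\<^sub>R (\<i> * ?f (Complex l t)) = indicator {\<tau>..0} t *\<^sub>R (\<i> * ?f (Complex l t))"
        using AE_lborel_singleton[of \<tau>] by eventually_elim (auto simp: indicator_def)
    qed
    ultimately show ?thesis by (simp add: arc_def)
  qed
  ultimately show ?thesis by (simp add: ray_def)
qed

lemma ray_arc_independent:
  assumes "a < \<tau>" "a < \<tau>'" "\<tau> \<le> 0" "\<tau>' \<le> 0" "\<tau> < Im \<zeta>" "\<tau>' < Im \<zeta>"
    "Im \<zeta> < \<tau> + 2 * pi" "Im \<zeta> < \<tau>' + 2 * pi" "Re \<zeta> < l"
  shows "ray \<tau> \<zeta> + arc \<tau> \<zeta> = ray \<tau>' \<zeta> + arc \<tau>' \<zeta>"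
  using ray_arc_independent_aux[of \<tau> \<tau>' \<zeta>] ray_arc_independent_aux[of \<tau>' \<tau> \<zeta>] assms
  by (cases "\<tau> \<le> \<tau>'") auto

text \<open>The first factor bounds |N - c| / c along the ray, in the variable u = s - x. Its value
  1 beyond \<open>l\<close> is the error of the cut-off: there the integrand of \<open>ray\<close>
  has 0 in place of c.\<close>

definition ray_error :: "real \<Rightarrow> real" where
  "ray_error x = (LBINT u. (if u + x \<le> l then g (u + x) else 1) * mellin_weight \<gamma> u)"

lemma g_cut_measurable: "(\<lambda>s. if s \<le> l then g s else 1) \<in> borel_measurable borel"
proof -
  have "(\<lambda>s. indicator {..l} s *\<^sub>R g s + indicator {l<..} s) \<in> borel_measurable borel"
    by (intro borel_measurable_add borel_measurable_continuous_on_indicator continuous_on_subset[OF cont_g]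
        borel_measurable_indicator) (use lr in auto)
  also have "(\<lambda>s. indicator {..l} s *\<^sub>R g s + indicator {l<..} s) = (\<lambda>s. if s \<le> l then g s else 1)"
    by (auto simp: indicator_def fun_eq_iff)
  finally show ?thesis .
qed

lemma ray_error_bound:
  "\<exists>C\<ge>0. \<forall>x u. norm ((if u + x \<le> l then g (u + x) else 1) * mellin_weight \<gamma> u) \<le> C * mellin_weight \<gamma> u"
proof -
  obtain B where B: "B \<ge> 0" "\<And>u. u \<le> l \<Longrightarrow> g u \<le> B" using g_bounded by blast
  show ?thesis
  proof (intro exI[of _ "max B 1"] conjI allI)
    fix x u
    have "norm (if u + x \<le> l then g (u + x) else 1) \<le> max B 1"
      using B(2)[of "u + x"] g_nonneg[of "u + x"] lr by auto
    then show "norm ((if u + x \<le> l then g (u + x) else 1) * mellin_weight \<gamma> u) \<le> max B 1 * mellin_weight \<gamma> u"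
      unfolding norm_mult using mellin_weight_nonneg[of \<gamma> u] by (intro mult_mono) auto
  qed simp
qed

lemma ray_error_integrable: "integrable lborel (\<lambda>u. (if u + x \<le> l then g (u + x) else 1) * mellin_weight \<gamma> u)"
proof -
  obtain C where "C \<ge> 0"
    and bound: "\<forall>x u. norm ((if u + x \<le> l then g (u + x) else 1) * mellin_weight \<gamma> u) \<le> C * mellin_weight \<gamma> u"
    using ray_error_bound by blast
  note C = bound[rule_format]
  have [measurable]: "(\<lambda>u. if u + x \<le> l then g (u + x) else 1) \<in> borel_measurable borel"
    using measurable_compose[OF _ g_cut_measurable, of "\<lambda>u. u + x" borel] by simp
  show ?thesis
  proof (rule Bochner_Integration.integrable_bound[of lborel "\<lambda>u. C * mellin_weight \<gamma> u"])
    show "integrable lborel (\<lambda>u. C * mellin_weight \<gamma> u)"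
      using integrable_mellin_weight[OF gamma] by (rule integrable_mult_right)
    show "AE u in lborel. norm ((if u + x \<le> l then g (u + x) else 1) * mellin_weight \<gamma> u) \<le> norm (C * mellin_weight \<gamma> u)"
      by (intro AE_I2 order_trans[OF C]) simp
  qed measurable
qed

text \<open>For fixed u the point u + x runs to minus infinity with x, where g tends to 0; a
  constant multiple of the weight dominates. The reflection y = - x turns this into a limit at plus
  infinity.\<close>

lemma ray_error_tendsto: "(ray_error \<longlongrightarrow> 0) at_bot"
proof -
  obtain C where "C \<ge> 0"
    and bound: "\<forall>x u. norm ((if u + x \<le> l then g (u + x) else 1) * mellin_weight \<gamma> u) \<le> C * mellin_weight \<gamma> u"
    using ray_error_bound by blast
  note C = bound[rule_format]
  have "((\<lambda>y. ray_error (- y)) \<longlongrightarrow> (LBINT u::real. 0)) at_top"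
    unfolding ray_error_def
  proof (rule integral_dominated_convergence_at_top[where w="\<lambda>u. C * mellin_weight \<gamma> u"])
    show "AE u in lborel. ((\<lambda>y. (if u + - y \<le> l then g (u + - y) else 1) * mellin_weight \<gamma> u) \<longlongrightarrow> 0) at_top"
    proof (rule AE_I2)
      fix u
      have "eventually (\<lambda>y. g (u + - y) * mellin_weight \<gamma> u = (if u + - y \<le> l then g (u + - y) else 1) * mellin_weight \<gamma> u) at_top"
        using eventually_ge_at_top[of "u - l"] by eventually_elim auto
      moreover have "((\<lambda>y. g (u + - y) * mellin_weight \<gamma> u) \<longlongrightarrow> 0) at_top"
      proof (rule tendsto_mult_left_zero, rule filterlim_compose[OF g_lim])
        show "filterlim (\<lambda>y. u + - y) at_bot at_top" by real_asymp
      qed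
      ultimately show "((\<lambda>y. (if u + - y \<le> l then g (u + - y) else 1) * mellin_weight \<gamma> u) \<longlongrightarrow> 0) at_top"
        by (rule Lim_transform_eventually[rotated])
    qed
    show "\<forall>\<^sub>F y in at_top. AE u in lborel. norm ((if u + - y \<le> l then g (u + - y) else 1) * mellin_weight \<gamma> u) \<le> C * mellin_weight \<gamma> u"
      using C by (intro always_eventually allI AE_I2)
    show "(\<lambda>u. (if u + - y \<le> l then g (u + - y) else 1) * mellin_weight \<gamma> u) \<in> borel_measurable lborel" for y
      using ray_error_integrable[of "- y"] by (rule borel_measurable_integrable)
  qed (use integrable_mellin_weight[OF gamma] in auto)
  then show ?thesis by (simp add: filterlim_at_bot_mirror)
qed

text \<open>Once the ray is placed at angle \<kappa> below \<zeta>, the translation s = u + Re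
  \<zeta> removes \<zeta> from the kernel and leaves it in the argument of N and in the cut-off.
  Replacing N by its limit c costs \<open>ray_error\<close>, whatever Im \<zeta> is.\<close>

lemma ray_asymptotics:
  assumes "0 < \<kappa>" "\<kappa> < 2 * pi" "a < Im \<zeta> - \<kappa>" "Im \<zeta> - \<kappa> < b"
  shows "norm (ray (Im \<zeta> - \<kappa>) \<zeta> - of_real c * (LBINT u. mellin_kernel \<gamma> (Complex u (- \<kappa>))))
     \<le> c / \<bar>sin (- \<kappa> / 2)\<bar> * ray_error (Re \<zeta>)"
proof -
  define x \<tau> where "x = Re \<zeta>" and "\<tau> = Im \<zeta> - \<kappa>"
  have z: "Complex s \<tau> - \<zeta> = Complex (s - x) (- \<kappa>)" for s by (simp add: complex_eq_iff x_def \<tau>_def)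
  let ?q = "\<lambda>u. mellin_kernel \<gamma> (Complex u (- \<kappa>))"
  let ?R = "\<lambda>s. indicator {..l} s *\<^sub>R (N (Complex s \<tau>) * mellin_kernel \<gamma> (Complex s \<tau> - \<zeta>))"
  have sn: "sin (- \<kappa> / 2) \<noteq> 0" using sin_half_nonzero assms by blast
  have iR: "integrable lborel ?R"
    using ray_integrable[of \<tau> \<zeta>] assms unfolding set_integrable_def \<tau>_def by simp
  from lborel_integrable_real_affine[OF this, of 1 x]
  have iR': "integrable lborel (\<lambda>u. ?R (x + u))" by simp
  have "ray \<tau> \<zeta> = (LBINT s. ?R s)" by (simp add: ray_def set_lebesgue_integral_def)
  also have "\<dots> = (LBINT u. ?R (x + u))" using lborel_integral_real_affine[of 1 ?R x] by simp
  finally have ray: "ray \<tau> \<zeta> = (LBINT u. ?R (x + u))" .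
  have iq: "integrable lborel ?q" by (rule integrable_mellin_kernel[OF gamma assms(1,2)])
  have eq: "ray \<tau> \<zeta> - of_real c * (LBINT u. ?q u) = (LBINT u. ?R (x + u) - of_real c * ?q u)"
    using iR' iq by (simp add: ray)
  have "norm (LBINT u. ?R (x + u) - of_real c * ?q u) \<le> (LBINT u. c / \<bar>sin (- \<kappa> / 2)\<bar> * ((if u + x \<le> l then g (u + x) else 1) * mellin_weight \<gamma> u))"
  proof (rule Bochner_Integration.integral_norm_bound_integral)
    show "integrable lborel (\<lambda>u. ?R (x + u) - of_real c * ?q u)" using iR' iq by simp
    show "integrable lborel (\<lambda>u. c / \<bar>sin (- \<kappa> / 2)\<bar> * ((if u + x \<le> l then g (u + x) else 1) * mellin_weight \<gamma> u))"
      using ray_error_integrable by (rule integrable_mult_right)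
    fix u
    define h where "h = (if u + x \<le> l then g (u + x) else 1)"
    have h: "norm (indicator {..l} (x + u) *\<^sub>R N (Complex (x + u) \<tau>) - of_real c) \<le> c * h"
      using N_bound[of "Complex (x + u) \<tau>"] assms lr c
      by (auto simp: h_def indicator_def half_strip_def \<tau>_def add.commute)
    have q: "norm (?q u) \<le> mellin_weight \<gamma> u / \<bar>sin (- \<kappa> / 2)\<bar>"
      using norm_mellin_kernel_le[of "Complex u (- \<kappa>)" \<gamma>] sn by simp
    have "?R (x + u) - of_real c * ?q u = (indicator {..l} (x + u) *\<^sub>R N (Complex (x + u) \<tau>) - of_real c) * ?q u"
      by (simp add: z algebra_simps)
    also have "norm \<dots> \<le> (c * h) * (mellin_weight \<gamma> u / \<bar>sin (- \<kappa> / 2)\<bar>)"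
      unfolding norm_mult using h q order_trans[OF norm_ge_zero h] by (intro mult_mono) auto
    finally show "norm (?R (x + u) - of_real c * ?q u) \<le> c / \<bar>sin (- \<kappa> / 2)\<bar> * ((if u + x \<le> l then g (u + x) else 1) * mellin_weight \<gamma> u)"
      by (simp add: h_def mult_ac)
  qed
  also have "\<dots> = c / \<bar>sin (- \<kappa> / 2)\<bar> * ray_error x" by (simp add: ray_error_def)
  finally have "norm (ray \<tau> \<zeta> - of_real c * (LBINT u. ?q u)) \<le> c / \<bar>sin (- \<kappa> / 2)\<bar> * ray_error x"
    unfolding eq .
  then show ?thesis unfolding x_def \<tau>_def .
qed

text \<open>The arc keeps the fixed radius \<open>exp l\<close>, so the decay of the kernel to the
  right governs it; its angular length is less than \<open>- a\<close>, which makes the bound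
  uniform in \<tau>.\<close>

lemma arc_bound: "\<exists>C\<ge>0. \<forall>\<tau> \<zeta>. a < \<tau> \<longrightarrow> \<tau> \<le> 0 \<longrightarrow> Re \<zeta> < l - ln 2 \<longrightarrow> norm (arc \<tau> \<zeta>) \<le> C * exp (- (1 - \<gamma>) * (l - Re \<zeta>))"
proof -
  obtain C where C: "C > 0" "\<And>u t. u \<le> l \<Longrightarrow> a < t \<Longrightarrow> t < b \<Longrightarrow> norm (N (Complex u t)) \<le> C"
    using N_bounded by blast
  have "norm (arc \<tau> \<zeta>) \<le> (2 * C * - a) * exp (- (1 - \<gamma>) * (l - Re \<zeta>))"
    if t: "a < \<tau>" "\<tau> \<le> 0" and z: "Re \<zeta> < l - ln 2" for \<tau> \<zeta>
  proof -
    let ?E = "exp (- (1 - \<gamma>) * (l - Re \<zeta>))"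
    have z': "Re \<zeta> < l" using z ln_gt_zero[of "2::real"] by linarith
    have "norm (arc \<tau> \<zeta>) \<le> (LBINT t. indicator {\<tau>..0} t * (C * (2 * ?E)))"
      unfolding arc_def set_lebesgue_integral_def
    proof (rule Bochner_Integration.integral_norm_bound_integral)
      have "set_integrable lborel {\<tau>..0} (\<lambda>t. \<i> * (N (Complex l t) * mellin_kernel \<gamma> (Complex l t - \<zeta>)))"
        by (rule borel_integrable_atLeastAtMost')
           (intro continuous_intros continuous_on_N_vertical continuous_on_kernel_vertical t z')
      then show "integrable lborel (\<lambda>t. indicator {\<tau>..0} t *\<^sub>R (\<i> * (N (Complex l t) * mellin_kernel \<gamma> (Complex l t - \<zeta>))))"
        by (simp add: set_integrable_def)
      show "integrable lborel (\<lambda>t. indicator {\<tau>..0} t * (C * (2 * ?E)))"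
        by (intro integrable_mult_left integrable_real_indicator) (auto simp: emeasure_lborel_Icc_eq)
      fix s
      have "norm (N (Complex l s) * mellin_kernel \<gamma> (Complex l s - \<zeta>)) \<le> C * (2 * ?E)" if "s \<in> {\<tau>..0}"
        unfolding norm_mult using C that t ab z arc_kernel_bound[of \<zeta> s] by (intro mult_mono) auto
      then show "norm (indicator {\<tau>..0} s *\<^sub>R (\<i> * (N (Complex l s) * mellin_kernel \<gamma> (Complex l s - \<zeta>)))) \<le> indicator {\<tau>..0} s * (C * (2 * ?E))"
        by (auto simp: indicator_def norm_mult)
    qed
    also have "\<dots> = (- \<tau>) * (C * (2 * ?E))" using t by simp
    also have "\<dots> \<le> (- a) * (C * (2 * ?E))" using t C by (intro mult_right_mono) auto
    finally show ?thesis by (simp add: mult_ac)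
  qed
  moreover have "2 * C * - a \<ge> 0" using C ab by (simp add: mult_le_0_iff)
  ultimately show ?thesis by blast
qed

end

subsection \<open>The Cauchy transform near the edge\<close>

lemma local_density_integral:
  fixes h :: "real \<Rightarrow> complex"
  assumes "real_distribution \<mu>" and dens: "has_local_density \<mu> I p" and I: "I \<in> sets borel"
    and J: "J \<in> sets borel" "J \<subseteq> I" and h: "h \<in> borel_measurable borel"
  shows "set_integrable \<mu> J h \<longleftrightarrow> set_integrable lborel J (\<lambda>t. p t *\<^sub>R h t)"
    and "(LINT t:J|\<mu>. h t) = (LBINT t:J. p t *\<^sub>R h t)"
proof -
  interpret real_distribution \<mu> by fact
  let ?L = "restrict_space lborel I"
  have p: "p \<in> borel_measurable ?L" "\<forall>x\<in>I. 0 \<le> p x" and eq: "restrict_space \<mu> I = density ?L (\<lambda>x. ennreal (p x))"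
    using dens by (auto simp: has_local_density_def)
  have AE: "AE x in ?L. 0 \<le> p x" using p(2) I by (auto simp: AE_restrict_space_iff)
  define k where "k = (\<lambda>t. indicator J t *\<^sub>R h t)"
  have k: "k \<in> borel_measurable borel"
    unfolding k_def using J h by (intro borel_measurable_scaleR) auto
  then have kL: "k \<in> borel_measurable ?L"
    by (intro measurable_restrict_space1) simp
  have IM: "I \<inter> space \<mu> \<in> sets \<mu>" "I \<inter> space lborel \<in> sets lborel" using I by auto
  have k1: "(\<lambda>t. indicator I t *\<^sub>R k t) = (\<lambda>t. indicator J t *\<^sub>R h t)"
    and k2: "(\<lambda>t. indicator I t *\<^sub>R (p t *\<^sub>R k t)) = (\<lambda>t. indicator J t *\<^sub>R (p t *\<^sub>R h t))"
    using J(2) by (auto simp: k_def indicator_def fun_eq_iff)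
  have "set_integrable \<mu> J h \<longleftrightarrow> integrable (restrict_space \<mu> I) k"
    unfolding set_integrable_def integrable_restrict_space[OF IM(1)] k1 ..
  also have "\<dots> \<longleftrightarrow> integrable ?L (\<lambda>t. p t *\<^sub>R k t)"
    unfolding eq by (rule integrable_density[OF kL p(1) AE])
  also have "\<dots> \<longleftrightarrow> set_integrable lborel J (\<lambda>t. p t *\<^sub>R h t)"
    unfolding set_integrable_def integrable_restrict_space[OF IM(2)] k2 ..
  finally show "set_integrable \<mu> J h \<longleftrightarrow> set_integrable lborel J (\<lambda>t. p t *\<^sub>R h t)" .
  have "(LINT t:J|\<mu>. h t) = (LINT t|restrict_space \<mu> I. k t)"
    unfolding set_lebesgue_integral_def integral_restrict_space[OF IM(1)] k1 ..
  also have "\<dots> = (LINT t|?L. p t *\<^sub>R k t)"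
    unfolding eq by (rule integral_density[OF kL p(1) AE])
  also have "\<dots> = (LBINT t:J. p t *\<^sub>R h t)"
    unfolding set_lebesgue_integral_def integral_restrict_space[OF IM(2)] k2 ..
  finally show "(LINT t:J|\<mu>. h t) = (LBINT t:J. p t *\<^sub>R h t)" .
qed

text \<open>Integrability of \<open>f\<close> comes first, by the substitution rule for nonnegative
  functions applied to the norm; the rule for complex-valued functions presupposes it.\<close>

lemma exp_substitution:
  fixes f :: "real \<Rightarrow> complex"
  assumes cont: "continuous_on {x\<^sub>0<..<x\<^sub>0 + exp l} f"
    and int: "set_integrable lborel {..l} (\<lambda>s. exp s *\<^sub>R f (x\<^sub>0 + exp s))"
  shows "set_integrable lborel {x\<^sub>0<..<x\<^sub>0 + exp l} f"
    and "(LBINT t:{x\<^sub>0<..<x\<^sub>0 + exp l}. f t) = (LBINT s:{..l}. exp s *\<^sub>R f (x\<^sub>0 + exp s))"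
proof -
  have E: "einterval (-\<infinity>) (ereal l) = {..<l}" "einterval (ereal x\<^sub>0) (ereal (x\<^sub>0 + exp l)) = {x\<^sub>0<..<x\<^sub>0 + exp l}"
    by (auto simp: einterval_def)
  have isC: "isCont f (x\<^sub>0 + exp s)" if "s < l" for s
    using cont that by (subst (asm) continuous_on_eq_continuous_at) auto
  have int': "set_integrable lborel {..<l} (\<lambda>s. exp s *\<^sub>R f (x\<^sub>0 + exp s))"
    by (rule set_integrable_subset[OF int]) auto
  have "set_integrable lborel {..<l} (\<lambda>s. norm (exp s *\<^sub>R f (x\<^sub>0 + exp s)))"
    using set_integrable_norm[OF int'] by simp
  then have nint: "set_integrable lborel (einterval (-\<infinity>) (ereal l)) (\<lambda>s. norm (f (x\<^sub>0 + exp s)) * exp s)"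
    by (simp add: E mult.commute)
  have A: "((ereal \<circ> (\<lambda>s. x\<^sub>0 + exp s) \<circ> real_of_ereal) \<longlongrightarrow> ereal x\<^sub>0) (at_right (-\<infinity>))"
    unfolding ereal_tendsto_simps by real_asymp
  have B: "((ereal \<circ> (\<lambda>s. x\<^sub>0 + exp s) \<circ> real_of_ereal) \<longlongrightarrow> ereal (x\<^sub>0 + exp l)) (at_left (ereal l))"
    unfolding ereal_tendsto_simps by (auto intro!: tendsto_intros)
  have nf: "set_integrable lborel (einterval (ereal x\<^sub>0) (ereal (x\<^sub>0 + exp l))) (\<lambda>t. norm (f t))"
    by (rule interval_integral_substitution_nonneg(1)[where g="\<lambda>s. x\<^sub>0 + exp s" and g'=exp, OF _ _ _ _ _ _ A B nint])
       (auto intro!: derivative_eq_intros isC continuous_intros)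
  have mf: "(\<lambda>t. indicator {x\<^sub>0<..<x\<^sub>0 + exp l} t *\<^sub>R f t) \<in> borel_measurable lborel"
    unfolding measurable_lborel2 by (rule borel_measurable_continuous_on_indicator[OF _ cont]) simp
  show fi: "set_integrable lborel {x\<^sub>0<..<x\<^sub>0 + exp l} f"
    using nf mf unfolding E set_integrable_def
    by (subst integrable_norm_iff[symmetric]) (auto simp: abs_mult)
  have "(LBINT t=ereal x\<^sub>0..ereal (x\<^sub>0 + exp l). f t) = (LBINT s=-\<infinity>..ereal l. exp s *\<^sub>R f (x\<^sub>0 + exp s))"
    by (rule interval_integral_substitution_integrable[where g="\<lambda>s. x\<^sub>0 + exp s" and g'=exp, OF _ _ _ _ _ A B])
       (use int' fi in \<open>auto simp: E intro!: derivative_eq_intros isC continuous_intros\<close>)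
  then have "(LBINT t:{x\<^sub>0<..<x\<^sub>0 + exp l}. f t) = (LBINT s:{..<l}. exp s *\<^sub>R f (x\<^sub>0 + exp s))"
    by (simp add: interval_lebesgue_integral_def E)
  also have "\<dots> = (LBINT s:{..l}. exp s *\<^sub>R f (x\<^sub>0 + exp s))"
    unfolding set_lebesgue_integral_def
  proof (rule integral_cong_AE)
    show "AE s in lborel. indicator {..<l} s *\<^sub>R (exp s *\<^sub>R f (x\<^sub>0 + exp s)) = indicator {..l} s *\<^sub>R (exp s *\<^sub>R f (x\<^sub>0 + exp s))"
      using AE_lborel_singleton[of l] by eventually_elim (auto simp: indicator_def)
  qed (use int int' in \<open>auto simp: set_integrable_def intro: borel_measurable_integrable\<close>)
  finally show "(LBINT t:{x\<^sub>0<..<x\<^sub>0 + exp l}. f t) = (LBINT s:{..l}. exp s *\<^sub>R f (x\<^sub>0 + exp s))" .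
qed

text \<open>
  For \<open>m = 1\<close>, used when \<open>\<beta> > 0\<close>, the kernel \<open>1 / (z - t)\<close> is replaced by its difference with its value at
  the edge, which keeps \<open>\<gamma>\<close> in \<open>(0, 1)\<close>.
\<close>

locale edge_density = log_density + \<mu>: real_distribution \<mu> for \<mu> :: "real measure" +
  fixes x\<^sub>0 \<beta> :: real and p Nr :: "real \<Rightarrow> real" and m :: nat
  assumes m: "m = 0 \<or> m = 1" and gamma_eq: "\<gamma> = \<beta> + 1 - real m"
    and dens: "has_local_density \<mu> {x\<^sub>0 - exp r<..<x\<^sub>0 + exp r} p"
    and p_right: "\<And>s. s < r \<Longrightarrow> p (x\<^sub>0 + exp s) = exp (\<beta> * s) * Nr s"
    and p_left: "\<And>x. x\<^sub>0 - exp r < x \<Longrightarrow> x < x\<^sub>0 \<Longrightarrow> p x = 0"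
    and N_real: "\<And>s. s < r \<Longrightarrow> N (Complex s 0) = of_real (Nr s)"
begin

section \<open>Mass at positive distance from the edge\<close>

definition nbhd :: "real set" where "nbhd = {x\<^sub>0 - exp l..x\<^sub>0 + exp l}"

text \<open>With T = t - x0 and w = exp \<zeta>, 1 / (w - T) = (w / T) / (w - T) - 1 / T. For
  \<open>m = 1\<close> the second term goes into \<open>edge_value\<close>, and the first gains a
  factor w, which makes it negligible against w^\<beta>.\<close>

definition outer :: "complex \<Rightarrow> complex" where
  "outer \<zeta> = (LINT t:- nbhd|\<mu>. (exp \<zeta> / of_real (t - x\<^sub>0)) ^ m / (exp \<zeta> - of_real (t - x\<^sub>0)))"

text \<open>For \<open>m = 1\<close> this is the integral of 1 / (x0 - t), the real boundary value
  of G at the edge. For \<open>m = 0\<close> that integral diverges, nothing is subtracted, and the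
  constant is 0.\<close>

definition edge_value :: real where
  "edge_value = - real m * ((LINT t:- nbhd|\<mu>. 1 / (t - x\<^sub>0)) + (LBINT s:{..l}. exp (\<beta> * s) * Nr s))"

lemma outer_kernel_bound:
  assumes "t \<notin> nbhd" "Re \<zeta> < l - ln 2"
  shows "norm ((exp \<zeta> / of_real (t - x\<^sub>0)) ^ m / (exp \<zeta> - of_real (t - x\<^sub>0))) \<le> exp (real m * (Re \<zeta> - l)) * (2 / exp l)"
    and "exp \<zeta> \<noteq> of_real (t - x\<^sub>0)"
proof -
  have t: "\<bar>t - x\<^sub>0\<bar> > exp l" using assms(1) by (auto simp: nbhd_def)
  have "exp (Re \<zeta>) < exp (l - ln 2)" using assms(2) by simp
  \<comment> \<open>This is what \<open>ln 2\<close> is for: exp \<zeta> has less than half the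
    modulus of every t - x0 with t outside \<open>nbhd\<close>.\<close>
  then have e: "exp (Re \<zeta>) < exp l / 2" by (simp add: exp_diff)
  have "norm (exp \<zeta> - of_real (t - x\<^sub>0)) \<ge> \<bar>t - x\<^sub>0\<bar> - exp (Re \<zeta>)"
    using norm_triangle_ineq2[of "of_real (t - x\<^sub>0)" "exp \<zeta>"] by (simp add: norm_minus_commute flip: of_real_diff)
  then have d: "norm (exp \<zeta> - of_real (t - x\<^sub>0)) \<ge> exp l / 2" using t e by linarith
  then show "exp \<zeta> \<noteq> of_real (t - x\<^sub>0)" by auto
  have "norm (exp \<zeta> / of_real (t - x\<^sub>0)) \<le> exp (Re \<zeta>) / exp l"
    using t by (simp add: norm_divide flip: of_real_diff) (intro divide_left_mono mult_pos_pos; auto intro: less_trans[OF exp_gt_zero])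
  then have "norm ((exp \<zeta> / of_real (t - x\<^sub>0)) ^ m) \<le> (exp (Re \<zeta>) / exp l) ^ m"
    unfolding norm_power by (intro power_mono) auto
  also have "\<dots> = exp (real m * (Re \<zeta> - l))" by (simp add: exp_of_nat_mult exp_diff)
  finally have "norm ((exp \<zeta> / of_real (t - x\<^sub>0)) ^ m) \<le> exp (real m * (Re \<zeta> - l))" .
  then have "norm ((exp \<zeta> / of_real (t - x\<^sub>0)) ^ m / (exp \<zeta> - of_real (t - x\<^sub>0))) \<le> exp (real m * (Re \<zeta> - l)) / (exp l / 2)"
    unfolding norm_divide using d by (intro frac_le) auto
  then show "norm ((exp \<zeta> / of_real (t - x\<^sub>0)) ^ m / (exp \<zeta> - of_real (t - x\<^sub>0))) \<le> exp (real m * (Re \<zeta> - l)) * (2 / exp l)"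
    by simp
qed

lemma outer_measurable:
  fixes \<zeta> :: complex
  shows "(\<lambda>t. indicator (- nbhd) t *\<^sub>R ((exp \<zeta> / of_real (t - x\<^sub>0)) ^ m / (exp \<zeta> - of_real (t - x\<^sub>0)))) \<in> borel_measurable \<mu>"
proof -
  have [measurable]: "- nbhd \<in> sets borel" by (simp add: nbhd_def)
  show ?thesis by measurable
qed

lemma outer_integrable:
  assumes "Re \<zeta> < l - ln 2"
  shows "set_integrable \<mu> (- nbhd) (\<lambda>t. (exp \<zeta> / of_real (t - x\<^sub>0)) ^ m / (exp \<zeta> - of_real (t - x\<^sub>0)))"
  unfolding set_integrable_def
  by (rule \<mu>.integrable_const_bound[OF _ outer_measurable, where B="exp (real m * (Re \<zeta> - l)) * (2 / exp l)"])
     (use outer_kernel_bound(1)[OF _ assms] in \<open>auto intro!: AE_I2 simp: indicator_def\<close>)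

lemma norm_outer_le:
  assumes "Re \<zeta> < l - ln 2"
  shows "norm (outer \<zeta>) \<le> exp (real m * (Re \<zeta> - l)) * (2 / exp l)"
proof -
  have "norm (outer \<zeta>) \<le> (LINT t|\<mu>. exp (real m * (Re \<zeta> - l)) * (2 / exp l))"
    unfolding outer_def set_lebesgue_integral_def
    by (rule Bochner_Integration.integral_norm_bound_integral)
       (use outer_integrable[OF assms] outer_kernel_bound(1)[OF _ assms] in \<open>auto simp: set_integrable_def indicator_def\<close>)
  then show ?thesis using \<mu>.prob_space by simp
qed

lemma holomorphic_outer: "outer holomorphic_on {\<zeta>. Re \<zeta> < l - ln 2}"
  unfolding outer_def[abs_def] set_lebesgue_integral_def
proof (rule holomorphic_on_lebesgue_integral)
  show op: "open {\<zeta>. Re \<zeta> < l - ln 2}" by (rule open_halfspace_Re_lt)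
  show "(\<lambda>\<zeta>. indicator (- nbhd) t *\<^sub>R ((exp \<zeta> / of_real (t - x\<^sub>0)) ^ m / (exp \<zeta> - of_real (t - x\<^sub>0)))) holomorphic_on {\<zeta>. Re \<zeta> < l - ln 2}" for t
  proof (cases "t \<in> nbhd")
    case False
    then have "t - x\<^sub>0 \<noteq> 0" by (auto simp: nbhd_def)
    then show ?thesis unfolding scaleR_conv_of_real
      using outer_kernel_bound(2)[OF False] by (intro holomorphic_intros) auto
  qed simp
  show "(\<lambda>t. indicator (- nbhd) t *\<^sub>R ((exp \<zeta> / of_real (t - x\<^sub>0)) ^ m / (exp \<zeta> - of_real (t - x\<^sub>0)))) \<in> borel_measurable \<mu>" for \<zeta> :: complex
    by (rule outer_measurable)
  fix z assume z: "z \<in> {\<zeta>. Re \<zeta> < l - ln 2}"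
  obtain \<rho> where \<rho>: "\<rho> > 0" "cball z \<rho> \<subseteq> {\<zeta>. Re \<zeta> < l - ln 2}" using op z by (meson open_contains_cball)
  have "norm (indicator (- nbhd) t *\<^sub>R ((exp w / of_real (t - x\<^sub>0)) ^ m / (exp w - of_real (t - x\<^sub>0)))) \<le> 2 / exp l"
    if "w \<in> cball z \<rho>" for w t
  proof (cases "t \<in> nbhd")
    case False
    have w: "Re w < l - ln 2" using that \<rho> by auto
    then have "Re w \<le> l" using ln_gt_zero[of "2::real"] by linarith
    then have "exp (real m * (Re w - l)) * (2 / exp l) \<le> 1 * (2 / exp l)"
      by (intro mult_right_mono) (auto simp: mult_nonneg_nonpos)
    then show ?thesis using outer_kernel_bound(1)[OF False w] False by simp
  qed simp
  then show "\<exists>r>0. \<exists>B. cball z r \<subseteq> {\<zeta>. Re \<zeta> < l - ln 2} \<and> integrable \<mu> B \<and>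
      (\<forall>w\<in>cball z r. \<forall>t\<in>space \<mu>. norm (indicator (- nbhd) t *\<^sub>R ((exp w / of_real (t - x\<^sub>0)) ^ m / (exp w - of_real (t - x\<^sub>0)))) \<le> B t)"
    using \<rho> by (intro exI[of _ \<rho>] conjI exI[of _ "\<lambda>_. 2 / exp l"]) auto
qed

section \<open>Mass near the edge\<close>

lemma continuous_on_Nr: "continuous_on {..<r} Nr"
proof -
  have "continuous_on {..<r} (\<lambda>s. Re (N (Complex s 0)))"
    by (intro continuous_intros continuous_on_compose2[OF holomorphic_on_imp_continuous_on[OF hol_N]])
       (use ab in \<open>auto simp: half_strip_def Complex_eq intro!: continuous_intros\<close>)
  then show ?thesis by (rule continuous_on_eq) (use N_real in auto)
qed

lemma continuous_on_p: "continuous_on {x\<^sub>0<..<x\<^sub>0 + exp r} p"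
proof -
  have less_r: "ln (t - x\<^sub>0) < r" if "x\<^sub>0 < t" "t < x\<^sub>0 + exp r" for t
    using that ln_less_cancel_iff[of "t - x\<^sub>0" "exp r"] by simp
  have "continuous_on {x\<^sub>0<..<x\<^sub>0 + exp r} (\<lambda>t. exp (\<beta> * ln (t - x\<^sub>0)) * Nr (ln (t - x\<^sub>0)))"
    by (intro continuous_intros continuous_on_compose2[OF continuous_on_Nr])
       (use less_r in auto)
  then show ?thesis
  proof (rule continuous_on_eq)
    fix t assume t: "t \<in> {x\<^sub>0<..<x\<^sub>0 + exp r}"
    then show "exp (\<beta> * ln (t - x\<^sub>0)) * Nr (ln (t - x\<^sub>0)) = p t"
      using p_right[of "ln (t - x\<^sub>0)"] less_r[of t] by simp
  qed
qed

lemma Nr_integrable: "m = 1 \<Longrightarrow> set_integrable lborel {..l} (\<lambda>s. exp (\<beta> * s) * Nr s)"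
proof -
  assume "m = 1"
  then have b: "\<beta> = \<gamma>" using gamma_eq by simp
  obtain C where C: "C > 0" "\<And>u t. u \<le> l \<Longrightarrow> a < t \<Longrightarrow> t < b \<Longrightarrow> norm (N (Complex u t)) \<le> C"
    using N_bounded by blast
  have "integrable lborel (\<lambda>s. C * (indicator {..l} s *\<^sub>R exp (\<gamma> * s)))"
    using set_integrable_exp_left[OF gamma(1), of l] unfolding set_integrable_def by (intro integrable_mult_right)
  then show ?thesis unfolding set_integrable_def
  proof (rule Bochner_Integration.integrable_bound)
    show "(\<lambda>s. indicator {..l} s *\<^sub>R (exp (\<beta> * s) * Nr s)) \<in> borel_measurable lborel"
      unfolding measurable_lborel2
      by (intro borel_measurable_continuous_on_indicator continuous_intros continuous_on_subset[OF continuous_on_Nr])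
         (use lr in auto)
    show "AE s in lborel. norm (indicator {..l} s *\<^sub>R (exp (\<beta> * s) * Nr s)) \<le> norm (C * (indicator {..l} s *\<^sub>R exp (\<gamma> * s)))"
    proof (rule AE_I2)
      fix s
      have "s \<le> l \<Longrightarrow> \<bar>Nr s\<bar> \<le> C" using C(2)[of s 0] N_real[of s] ab lr by simp
      then show "norm (indicator {..l} s *\<^sub>R (exp (\<beta> * s) * Nr s)) \<le> norm (C * (indicator {..l} s *\<^sub>R exp (\<gamma> * s)))"
        using C(1) by (auto simp: indicator_def b abs_mult)
    qed
  qed
qed

text \<open>With q = exp (s - \<zeta>) and B = exp (\<beta> s), the left side is B q / (1 - q) times
  \<open>Nr s\<close>, and the product on the right is B q^(1 - m) / (1 - q) times
  \<open>Nr s\<close>. For \<open>m = 1\<close> the two differ by B times \<open>Nr s\<close>, the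
  subtracted term.\<close>

lemma kernel_identity:
  assumes "s < r" "0 < Im \<zeta>" "Im \<zeta> < 2 * pi"
  shows "exp s *\<^sub>R (p (x\<^sub>0 + exp s) *\<^sub>R (1 / (exp \<zeta> - of_real (exp s)))) =
    exp (of_real \<beta> * \<zeta>) * (N (Complex s 0) * mellin_kernel \<gamma> (Complex s 0 - \<zeta>)) - of_real (real m * (exp (\<beta> * s) * Nr s))"
proof -
  have ne: "exp (Complex s 0 - \<zeta>) \<noteq> 1"
    using exp_neq_1_if_sin[of "Complex s 0 - \<zeta>"] sin_half_nonzero[OF assms(2,3)] by auto
  define E where "E = exp (of_real s :: complex)"
  define B where "B = exp (of_real (\<beta> * s) :: complex)"
  have BE: "of_real (exp (\<beta> * s)) = B" "of_real (exp s) = E"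
    by (simp_all only: E_def B_def exp_of_real)
  have cs: "Complex s 0 = of_real s" by (simp add: complex_of_real_def)
  have ex: "exp (Complex s 0 - \<zeta>) = E / exp \<zeta>" by (simp add: cs exp_diff E_def)
  have ne': "exp \<zeta> - E \<noteq> 0" using ne unfolding ex by (auto simp: field_simps)
  have L: "exp s *\<^sub>R (p (x\<^sub>0 + exp s) *\<^sub>R (1 / (exp \<zeta> - of_real (exp s)))) = E * B * of_real (Nr s) / (exp \<zeta> - E)"
    using p_right[OF assms(1)] by (simp add: scaleR_conv_of_real BE)
  have "exp (of_real \<beta> * \<zeta>) * exp (of_real \<gamma> * (Complex s 0 - \<zeta>)) = B * (E / exp \<zeta>) / (E / exp \<zeta>) ^ m"
  proof -
    have "exp (of_real \<beta> * \<zeta>) * exp (of_real \<gamma> * (Complex s 0 - \<zeta>)) * (E / exp \<zeta>) ^ m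
        = exp (of_real \<beta> * \<zeta> + of_real \<gamma> * (of_real s - \<zeta>) + of_nat m * (of_real s - \<zeta>))"
      by (simp add: exp_add exp_of_nat_mult E_def cs flip: exp_diff)
    also have "of_real \<beta> * \<zeta> + of_real \<gamma> * (of_real s - \<zeta>) + of_nat m * (of_real s - \<zeta>) = of_real (\<beta> * s) + (of_real s - \<zeta>)"
      by (simp add: gamma_eq algebra_simps)
    also have "exp \<dots> = B * (E / exp \<zeta>)" by (simp add: exp_add exp_diff B_def E_def)
    finally show ?thesis by (simp add: field_simps E_def)
  qed
  then have "exp (of_real \<beta> * \<zeta>) * (N (Complex s 0) * mellin_kernel \<gamma> (Complex s 0 - \<zeta>))
     = of_real (Nr s) * (B * (E / exp \<zeta>) / (E / exp \<zeta>) ^ m) / (1 - E / exp \<zeta>)"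
    using N_real[OF assms(1)] by (simp add: mellin_kernel_def ex mult_ac)
  also have "\<dots> = E * B * of_real (Nr s) / (exp \<zeta> - E) + of_nat m * (B * of_real (Nr s))"
    using m
  proof
    assume "m = 0" then show ?thesis using ne' by (simp add: field_simps)
  next
    assume "m = 1"
    then show ?thesis using ne' by (simp add: E_def divide_simps) (simp add: algebra_simps)
  qed
  finally show ?thesis unfolding L by (simp add: BE)
qed

text \<open>The measure is replaced by its density, which vanishes to the left of the edge; the
  points x0 and x0 + exp l are Lebesgue null. The substitution t = x0 + exp s then brings in
  \<open>kernel_identity\<close>.\<close>

lemma cauchy_G_inner:
  assumes "0 < Im \<zeta>" "Im \<zeta> < pi"
  shows "(LINT t:nbhd|\<mu>. 1 / (of_real x\<^sub>0 + exp \<zeta> - of_real t)) =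
    exp (of_real \<beta> * \<zeta>) * ray 0 \<zeta> - of_real (real m * (LBINT s:{..l}. exp (\<beta> * s) * Nr s))"
proof -
  let ?h = "\<lambda>t. 1 / (of_real x\<^sub>0 + exp \<zeta> - of_real t) :: complex"
  have im: "Im (exp \<zeta>) > 0" using assms by (simp add: Im_exp sin_gt_zero)
  have hc: "continuous_on A ?h" for A
    by (intro continuous_intros) (use im in \<open>auto simp: complex_eq_iff\<close>)
  have hb: "?h \<in> borel_measurable borel" by (rule borel_measurable_continuous_onI[OF hc])
  have sub: "nbhd \<subseteq> {x\<^sub>0 - exp r<..<x\<^sub>0 + exp r}" 
  proof -
    have "exp l < exp r" using lr by simp
    then show ?thesis unfolding nbhd_def subset_iff atLeastAtMost_iff greaterThanLessThan_iff
      by (intro allI impI conjI; linarith)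
  qed
  let ?k = "\<lambda>s. exp (of_real \<beta> * \<zeta>) * (N (Complex s 0) * mellin_kernel \<gamma> (Complex s 0 - \<zeta>))"
  let ?k' = "\<lambda>s. of_real (real m * (exp (\<beta> * s) * Nr s)) :: complex"
  have i1: "set_integrable lborel {..l} ?k"
    using ray_integrable[of 0 \<zeta>] ab assms by simp
  have i2r: "set_integrable lborel {..l} (\<lambda>s. real m * (exp (\<beta> * s) * Nr s))"
    using m Nr_integrable by auto
  then have i2: "set_integrable lborel {..l} ?k'"
    unfolding set_integrable_def scaleR_conv_of_real
    by (simp flip: of_real_mult add: integrable_of_real)
  have eq: "exp s *\<^sub>R (p (x\<^sub>0 + exp s) *\<^sub>R ?h (x\<^sub>0 + exp s)) = ?k s - ?k' s" if "s \<in> {..l}" for s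
    using kernel_identity[of s \<zeta>] that lr assms by (simp add: algebra_simps)
  have "set_integrable lborel {..l} (\<lambda>s. ?k s - ?k' s)" using i1 i2 by (rule set_integral_diff)
  then have i3: "set_integrable lborel {..l} (\<lambda>s. exp s *\<^sub>R (p (x\<^sub>0 + exp s) *\<^sub>R ?h (x\<^sub>0 + exp s)))"
    by (subst set_integrable_cong[OF refl refl eq]) auto
  have cph: "continuous_on {x\<^sub>0<..<x\<^sub>0 + exp l} (\<lambda>t. p t *\<^sub>R ?h t)"
    by (intro continuous_on_scaleR hc continuous_on_subset[OF continuous_on_p])
       (use lr in \<open>simp add: greaterThanLessThan_subseteq_greaterThanLessThan\<close>)
  have "(LINT t:nbhd|\<mu>. ?h t) = (LBINT t:nbhd. p t *\<^sub>R ?h t)"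
    by (rule local_density_integral(2)[OF _ dens _ _ sub hb]) (auto simp: nbhd_def \<mu>.real_distribution_axioms)
  also have "\<dots> = (LBINT t:{x\<^sub>0<..<x\<^sub>0 + exp l}. p t *\<^sub>R ?h t)"
  proof -
    have "AE t in lborel. indicator {x\<^sub>0<..<x\<^sub>0 + exp l} t *\<^sub>R (p t *\<^sub>R ?h t) = indicator nbhd t *\<^sub>R (p t *\<^sub>R ?h t)"
      using AE_lborel_singleton[of x\<^sub>0] AE_lborel_singleton[of "x\<^sub>0 + exp l"]
    proof eventually_elim
      case (elim t)
      have "p t = 0" if "t < x\<^sub>0" "x\<^sub>0 - exp l \<le> t" using p_left[of t] that lr exp_less_cancel_iff[of l r] by linarith
      then show ?case using elim exp_gt_zero[of l]
        by (cases t x\<^sub>0 rule: linorder_cases) (auto simp: indicator_def nbhd_def)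
    qed
    moreover have "(\<lambda>t. indicator {x\<^sub>0<..<x\<^sub>0 + exp l} t *\<^sub>R (p t *\<^sub>R ?h t)) \<in> borel_measurable lborel"
      unfolding measurable_lborel2 by (rule borel_measurable_continuous_on_indicator[OF _ cph]) simp
    moreover have "(\<lambda>t. indicator nbhd t *\<^sub>R (p t *\<^sub>R ?h t)) \<in> borel_measurable lborel"
    proof -
      let ?I = "{x\<^sub>0 - exp r<..<x\<^sub>0 + exp r}"
      have "p \<in> borel_measurable (restrict_space lborel ?I)" using dens by (simp add: has_local_density_def)
      then have k: "(\<lambda>t. indicator ?I t *\<^sub>R p t) \<in> borel_measurable lborel"
        by (subst (asm) borel_measurable_restrict_space_iff) auto
      have "(\<lambda>t. indicator nbhd t :: real) \<in> borel_measurable lborel" by (simp add: nbhd_def)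
      moreover have "?h \<in> borel_measurable lborel" using hb by simp
      ultimately have "(\<lambda>t. indicator nbhd t *\<^sub>R ((indicator ?I t *\<^sub>R p t) *\<^sub>R ?h t)) \<in> borel_measurable lborel"
        by (rule borel_measurable_scaleR[OF _ borel_measurable_scaleR[OF k]])
      also have "(\<lambda>t. indicator nbhd t *\<^sub>R ((indicator ?I t *\<^sub>R p t) *\<^sub>R ?h t)) = (\<lambda>t. indicator nbhd t *\<^sub>R (p t *\<^sub>R ?h t))"
        using sub by (auto simp: indicator_def fun_eq_iff)
      finally show ?thesis .
    qed
    ultimately show ?thesis unfolding set_lebesgue_integral_def by (intro integral_cong_AE) (auto elim: eventually_mono)
  qed
  also have "\<dots> = (LBINT s:{..l}. exp s *\<^sub>R (p (x\<^sub>0 + exp s) *\<^sub>R ?h (x\<^sub>0 + exp s)))"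
    by (rule exp_substitution(2)[OF cph i3])
  also have "\<dots> = (LBINT s:{..l}. ?k s - ?k' s)"
    by (rule set_lebesgue_integral_cong) (use eq in auto)
  also have "\<dots> = (LBINT s:{..l}. ?k s) - (LBINT s:{..l}. ?k' s)"
    using i1 i2 by (rule set_integral_diff)
  also have "(LBINT s:{..l}. ?k s) = exp (of_real \<beta> * \<zeta>) * ray 0 \<zeta>" by (simp add: ray_def)
  also have "(LBINT s:{..l}. ?k' s) = of_real (LBINT s:{..l}. real m * (exp (\<beta> * s) * Nr s))"
  proof -
    have "indicator {..l} s *\<^sub>R ?k' s = of_real (indicator {..l} s *\<^sub>R (real m * (exp (\<beta> * s) * Nr s)))" for s
      by (simp add: scaleR_conv_of_real)
    then show ?thesis unfolding set_lebesgue_integral_def by (simp only: integral_complex_of_real)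
  qed
  also have "(LBINT s:{..l}. real m * (exp (\<beta> * s) * Nr s)) = real m * (LBINT s:{..l}. exp (\<beta> * s) * Nr s)"
    by simp
  finally show ?thesis .
qed

lemma cauchy_G_outer:
  assumes "0 < Im \<zeta>" "Im \<zeta> < pi" "Re \<zeta> < l - ln 2"
  shows "(LINT t:- nbhd|\<mu>. 1 / (of_real x\<^sub>0 + exp \<zeta> - of_real t)) =
    outer \<zeta> - of_real (real m * (LINT t:- nbhd|\<mu>. 1 / (t - x\<^sub>0)))"
proof -
  let ?k = "\<lambda>t. (exp \<zeta> / of_real (t - x\<^sub>0)) ^ m / (exp \<zeta> - of_real (t - x\<^sub>0))"
  have i2: "integrable \<mu> (\<lambda>t. indicator (- nbhd) t *\<^sub>R (1 / (t - x\<^sub>0)))"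
  proof (rule \<mu>.integrable_const_bound[where B="1 / exp l"])
    show "AE t in \<mu>. norm (indicator (- nbhd) t *\<^sub>R (1 / (t - x\<^sub>0))) \<le> 1 / exp l"
    proof (rule AE_I2)
      fix t
      have "\<bar>t - x\<^sub>0\<bar> > exp l" if "t \<notin> nbhd" using that by (auto simp: nbhd_def)
      then show "norm (indicator (- nbhd) t *\<^sub>R (1 / (t - x\<^sub>0))) \<le> 1 / exp l"
        by (auto simp: indicator_def intro!: divide_left_mono mult_pos_pos intro: less_trans[OF exp_gt_zero])
    qed
    have [measurable]: "- nbhd \<in> sets borel" by (simp add: nbhd_def)
    show "(\<lambda>t. indicator (- nbhd) t *\<^sub>R (1 / (t - x\<^sub>0))) \<in> borel_measurable \<mu>" by measurable
  qed
  have "(LINT t:- nbhd|\<mu>. 1 / (of_real x\<^sub>0 + exp \<zeta> - of_real t)) =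
    (LINT t|\<mu>. indicator (- nbhd) t *\<^sub>R ?k t - of_real (real m * (indicator (- nbhd) t *\<^sub>R (1 / (t - x\<^sub>0)))))"
    unfolding set_lebesgue_integral_def
  proof (rule Bochner_Integration.integral_cong[OF refl])
    fix t
    show "indicator (- nbhd) t *\<^sub>R (1 / (of_real x\<^sub>0 + exp \<zeta> - of_real t)) =
      indicator (- nbhd) t *\<^sub>R ?k t - of_real (real m * (indicator (- nbhd) t *\<^sub>R (1 / (t - x\<^sub>0))))"
    proof (cases "t \<in> nbhd")
      case False
      define T where "T = (of_real (t - x\<^sub>0) :: complex)"
      have T0: "T \<noteq> 0" using False by (auto simp: T_def nbhd_def)
      have ne: "exp \<zeta> - T \<noteq> 0" using outer_kernel_bound(2)[OF False assms(3)] by (simp add: T_def)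
      have e1: "1 / (exp \<zeta> - T) = (exp \<zeta> / T) ^ m / (exp \<zeta> - T) - of_nat m * (1 / T)"
        using m T0 ne by (auto simp: field_simps)
      have e2: "of_real x\<^sub>0 + exp \<zeta> - of_real t = exp \<zeta> - T" by (simp add: T_def)
      have e3: "of_real (real m * (1 / (t - x\<^sub>0))) = of_nat m * (1 / T)" by (simp add: T_def)
      have ind: "indicator (- nbhd) t = (1::real)" using False by simp
      show ?thesis unfolding ind scaleR_one real_scaleR_def mult_1 e2 e3 T_def[symmetric] by (rule e1)
    qed simp
  qed
  also have "\<dots> = (LINT t|\<mu>. indicator (- nbhd) t *\<^sub>R ?k t) - (LINT t|\<mu>. of_real (real m * (indicator (- nbhd) t *\<^sub>R (1 / (t - x\<^sub>0)))))"
    using outer_integrable[OF assms(3)] i2 unfolding set_integrable_def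
    by (intro Bochner_Integration.integral_diff integrable_of_real integrable_mult_right) auto
  also have "(LINT t|\<mu>. of_real (real m * (indicator (- nbhd) t *\<^sub>R (1 / (t - x\<^sub>0))))) =
      (of_real (real m * (LINT t|\<mu>. indicator (- nbhd) t *\<^sub>R (1 / (t - x\<^sub>0)))) :: complex)"
    by (simp only: integral_complex_of_real integral_mult_right_zero)
  finally show ?thesis by (simp only: outer_def set_lebesgue_integral_def)
qed

lemma cauchy_G_edge:
  assumes "0 < Im \<zeta>" "Im \<zeta> < pi" "Re \<zeta> < l - ln 2"
  shows "cauchy_G \<mu> (of_real x\<^sub>0 + exp \<zeta>) = of_real edge_value + exp (of_real \<beta> * \<zeta>) * ray 0 \<zeta> + outer \<zeta>"
proof -
  let ?h = "\<lambda>t. 1 / (of_real x\<^sub>0 + exp \<zeta> - of_real t) :: complex"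
  have "Im (of_real x\<^sub>0 + exp \<zeta>) > 0" using assms by (simp add: Im_exp sin_gt_zero)
  then have i: "integrable \<mu> ?h" by (rule \<mu>.integrable_resolvent)
  have si: "set_integrable \<mu> A ?h" if "A \<in> sets borel" for A
    unfolding set_integrable_def by (rule integrable_mult_indicator[OF _ i]) (use that in simp)
  have "cauchy_G \<mu> (of_real x\<^sub>0 + exp \<zeta>) = (LINT t:nbhd \<union> - nbhd|\<mu>. ?h t)"
    by (simp add: cauchy_G_def set_lebesgue_integral_def)
  also have "\<dots> = (LINT t:nbhd|\<mu>. ?h t) + (LINT t:- nbhd|\<mu>. ?h t)"
    by (rule set_integral_Un) (auto intro!: si simp: nbhd_def)
  finally show ?thesis
    unfolding cauchy_G_inner[OF assms(1,2)] cauchy_G_outer[OF assms]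
    by (simp add: edge_value_def algebra_simps)
qed

end

subsection \<open>The continued Cauchy transform and free infinite divisibility\<close>

context edge_density
begin

text \<open>The continued G minus \<open>edge_value\<close>, divided by exp (\<beta> \<zeta>). The
  contour moves with Im \<zeta> and stays the angle \<kappa> behind it, so that the asymptotics have
  the same constants over the whole strip.\<close>

definition amplitude :: "real \<Rightarrow> complex \<Rightarrow> complex" where
  "amplitude \<kappa> \<zeta> = ray (Im \<zeta> - \<kappa>) \<zeta> + arc (Im \<zeta> - \<kappa>) \<zeta> + exp (- of_real \<beta> * \<zeta>) * outer \<zeta>"

definition continued_G :: "real \<Rightarrow> complex \<Rightarrow> complex" where
  "continued_G \<kappa> \<zeta> = of_real edge_value + exp (of_real \<beta> * \<zeta>) * amplitude \<kappa> \<zeta>"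

text \<open>A contour that depends on Im \<zeta> hides holomorphy. Near any point it can be
  exchanged for one fixed contour, whose integrals are holomorphic.\<close>

lemma continued_G_fixed_contour:
  assumes "0 < \<kappa>" "\<kappa> < pi" "a + \<kappa> < Im \<zeta>" "Im \<zeta> < \<kappa>" "Re \<zeta> < l - ln 2"
    and "a < \<tau>" "\<tau> \<le> 0" "\<tau> < Im \<zeta>" "Im \<zeta> < \<tau> + 2 * pi"
  shows "continued_G \<kappa> \<zeta> = of_real edge_value + exp (of_real \<beta> * \<zeta>) * (ray \<tau> \<zeta> + arc \<tau> \<zeta>) + outer \<zeta>"
proof -
  have "Re \<zeta> < l" using assms(5) ln_gt_zero[of "2::real"] by linarith
  then have "ray (Im \<zeta> - \<kappa>) \<zeta> + arc (Im \<zeta> - \<kappa>) \<zeta> = ray \<tau> \<zeta> + arc \<tau> \<zeta>"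
    using assms by (intro ray_arc_independent) auto
  moreover have "exp (of_real \<beta> * \<zeta>) * exp (- of_real \<beta> * \<zeta>) = 1" by (simp flip: exp_add)
  ultimately show ?thesis
    unfolding continued_G_def amplitude_def by (simp only: distrib_left mult.assoc[symmetric]) (simp add: add.assoc)
qed

text \<open>For positive arguments the contour with \<tau> = 0 is admissible: the ray lies on the
  real half line and the arc degenerates to a point.\<close>

lemma continued_G_eq_cauchy_G:
  assumes "0 < \<kappa>" "\<kappa> < pi" "0 < Im \<zeta>" "Im \<zeta> < \<kappa>" "Re \<zeta> < l - ln 2" "a + \<kappa> \<le> 0"
  shows "continued_G \<kappa> \<zeta> = cauchy_G \<mu> (of_real x\<^sub>0 + exp \<zeta>)"
proof -
  have "arc 0 \<zeta> = (LBINT t::real. 0)"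
    unfolding arc_def set_lebesgue_integral_def
  proof (rule integral_cong_AE)
    show "(\<lambda>t. indicator {0..0} t *\<^sub>R (\<i> * (N (Complex l t) * mellin_kernel \<gamma> (Complex l t - \<zeta>)))) \<in> borel_measurable lborel"
      using assms ab ln_gt_zero[of "2::real"] by (intro arc_measurable; linarith)
    show "AE t in lborel. indicator {0..0} t *\<^sub>R (\<i> * (N (Complex l t) * mellin_kernel \<gamma> (Complex l t - \<zeta>))) = 0"
      using AE_lborel_singleton[of 0] by eventually_elim auto
  qed auto
  then have arc: "arc 0 \<zeta> = 0" by simp
  show ?thesis
    using continued_G_fixed_contour[of \<kappa> \<zeta> 0] cauchy_G_edge[of \<zeta>] arc assms ab by simp
qed

lemma holomorphic_continued_G:
  assumes "0 < \<kappa>" "\<kappa> < pi"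
  shows "continued_G \<kappa> holomorphic_on half_strip (a + \<kappa>) \<kappa> (l - ln 2)"
proof -
  let ?S = "half_strip (a + \<kappa>) \<kappa> (l - ln 2)"
  have "continued_G \<kappa> field_differentiable at \<zeta>" if z: "\<zeta> \<in> ?S" for \<zeta>
  proof -
    \<comment> \<open>The contour is frozen at the position belonging to \<zeta>; it stays
      admissible throughout the neighbourhood \<open>T\<close>.\<close>
    define \<tau> where "\<tau> = Im \<zeta> - \<kappa>"
    define T where "T = ?S \<inter> {z. \<tau> < Im z \<and> Im z < \<tau> + 2 * pi}"
    have \<tau>: "a < \<tau>" "\<tau> \<le> 0" "\<tau> < b" using z ab by (auto simp: \<tau>_def half_strip_def)
    have "open {z. \<tau> < Im z \<and> Im z < \<tau> + 2 * pi}"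
      by (intro open_Collect_conj open_Collect_less continuous_intros)
    then have T: "open T" "\<zeta> \<in> T"
      using z assms by (auto simp: T_def \<tau>_def intro!: open_Int open_half_strip)
    have "(\<lambda>z. of_real edge_value + exp (of_real \<beta> * z) * (ray \<tau> z + arc \<tau> z) + outer z) holomorphic_on T"
      by (intro holomorphic_intros holomorphic_on_subset[OF holomorphic_ray[OF \<tau>(1,3)]]
          holomorphic_on_subset[OF holomorphic_arc[OF \<tau>(1)]] holomorphic_on_subset[OF holomorphic_outer])
         (auto simp: T_def half_strip_def)
    then have "continued_G \<kappa> holomorphic_on T"
      by (rule holomorphic_transform)
         (use continued_G_fixed_contour[OF assms] \<tau> in \<open>auto simp: T_def half_strip_def\<close>)
    then show ?thesis using T holomorphic_on_imp_differentiable_at by blast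
  qed
  then show ?thesis
    by (simp add: holomorphic_on_def field_differentiable_at_within)
qed

lemma amplitude_asymptotics:
  assumes "0 < \<kappa>" "\<kappa> < pi" "\<epsilon> > 0"
  shows "eventually (\<lambda>x. \<forall>y. a + \<kappa> < y \<longrightarrow> y < \<kappa> \<longrightarrow>
    norm (amplitude \<kappa> (Complex x y) - of_real (c * (LBINT u. mellin_weight \<gamma> u)) * cis (- \<gamma> * pi)) \<le> \<epsilon>) at_bot"
proof -
  obtain C where C: "C \<ge> 0" "\<And>\<tau> \<zeta>. a < \<tau> \<Longrightarrow> \<tau> \<le> 0 \<Longrightarrow> Re \<zeta> < l - ln 2 \<Longrightarrow>
      norm (arc \<tau> \<zeta>) \<le> C * exp (- (1 - \<gamma>) * (l - Re \<zeta>))"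
    using arc_bound by blast
  define e1 e2 e3 where "e1 = (\<lambda>x. c / \<bar>sin (- \<kappa> / 2)\<bar> * ray_error x)"
    and "e2 = (\<lambda>x. C * exp (- (1 - \<gamma>) * (l - x)))"
    and "e3 = (\<lambda>x. exp (- \<beta> * x) * (exp (real m * (x - l)) * (2 / exp l)))"
  have "(e1 \<longlongrightarrow> 0) at_bot"
    unfolding e1_def using ray_error_tendsto by (rule tendsto_mult_right_zero)
  moreover have "(e2 \<longlongrightarrow> 0) at_bot"
    unfolding e2_def using gamma(2) by (intro tendsto_mult_right_zero) real_asymp
  moreover have "(e3 \<longlongrightarrow> 0) at_bot"
  proof -
    \<comment> \<open>Both values of \<open>m\<close> lead to the exponent 1 - \<gamma> = m -
      \<beta>: for \<beta> > 0 the growth of exp (- \<beta> x) is beaten by the factor exp x gained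
      from the subtraction.\<close>
    have "e3 = (\<lambda>x. (2 / exp l * exp (- real m * l)) * exp ((1 - \<gamma>) * x))"
      by (rule ext) (simp add: e3_def gamma_eq algebra_simps flip: exp_add)
    moreover have "((\<lambda>x. exp ((1 - \<gamma>) * x)) \<longlongrightarrow> 0) at_bot" using gamma(2) by real_asymp
    ultimately show ?thesis by (simp only: tendsto_mult_right_zero)
  qed
  ultimately have "((\<lambda>x. e1 x + e2 x + e3 x) \<longlongrightarrow> 0 + 0 + 0) at_bot"
    by (intro tendsto_intros)
  then have "eventually (\<lambda>x. e1 x + e2 x + e3 x < \<epsilon>) at_bot"
    using \<open>\<epsilon> > 0\<close> by (intro order_tendstoD(2)) auto
  moreover have "eventually (\<lambda>x. x < l - ln 2) at_bot" by (rule eventually_gt_at_bot)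
  ultimately show ?thesis
  proof eventually_elim
    case (elim x)
    show ?case
    proof (intro allI impI)
      fix y assume y: "a + \<kappa> < y" "y < \<kappa>"
      let ?\<zeta> = "Complex x y"
      let ?J = "of_real c * (LBINT u. mellin_kernel \<gamma> (Complex u (- \<kappa>)))"
      have J: "of_real (c * (LBINT u. mellin_weight \<gamma> u)) * cis (- \<gamma> * pi) = ?J"
      proof -
        have "\<kappa> < 2 * pi" using assms(2) pi_gt_zero by linarith
        then show ?thesis unfolding mellin_integral[OF gamma assms(1) \<open>\<kappa> < 2 * pi\<close>] by (simp add: mult_ac)
      qed
      have "norm (ray (y - \<kappa>) ?\<zeta> - ?J) \<le> e1 x"
        using ray_asymptotics[of \<kappa> ?\<zeta>] assms y ab by (simp add: e1_def)
      moreover have "norm (arc (y - \<kappa>) ?\<zeta>) \<le> e2 x"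
        using C(2)[of "y - \<kappa>" ?\<zeta>] y elim by (simp add: e2_def)
      moreover have "norm (exp (- of_real \<beta> * ?\<zeta>) * outer ?\<zeta>) \<le> e3 x"
        unfolding norm_mult e3_def using norm_outer_le[of ?\<zeta>] elim by (intro mult_mono) auto
      ultimately have "norm (ray (y - \<kappa>) ?\<zeta> - ?J + arc (y - \<kappa>) ?\<zeta> + exp (- of_real \<beta> * ?\<zeta>) * outer ?\<zeta>) \<le> e1 x + e2 x + e3 x"
        by (intro order_trans[OF norm_triangle_ineq] add_mono)
      moreover have "amplitude \<kappa> ?\<zeta> - ?J = ray (y - \<kappa>) ?\<zeta> - ?J + arc (y - \<kappa>) ?\<zeta> + exp (- of_real \<beta> * ?\<zeta>) * outer ?\<zeta>"
        by (simp add: amplitude_def)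
      ultimately have "norm (amplitude \<kappa> ?\<zeta> - ?J) \<le> e1 x + e2 x + e3 x" by (simp only:)
      then show "norm (amplitude \<kappa> ?\<zeta> - of_real (c * (LBINT u. mellin_weight \<gamma> u)) * cis (- \<gamma> * pi)) \<le> \<epsilon>"
        unfolding J using elim(1) by linarith
    qed
  qed
qed

text \<open>
  Along a vertical segment on which the continued reciprocal stays in the upper half plane, the
  subordination identity for a sufficiently large number of convolution factors continues with it.
\<close>

lemma FID_continued_ineq:
  assumes "FID \<mu>" and \<kappa>: "0 < \<kappa>" "\<kappa> < pi" "a + \<kappa> \<le> 0"
    and y: "a + \<kappa> < y" "y \<le> y\<^sub>0" "0 < y\<^sub>0" "y\<^sub>0 < \<kappa>" and x: "x < l - ln 2"
    and neg: "\<And>t. y \<le> t \<Longrightarrow> t \<le> y\<^sub>0 \<Longrightarrow> Im (continued_G \<kappa> (Complex x t)) < 0"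
  shows "exp x * sin y * (norm (continued_G \<kappa> (Complex x y)))\<^sup>2 \<le> - Im (continued_G \<kappa> (Complex x y))"
proof -
  let ?G = "continued_G \<kappa>"
  let ?S = "half_strip (a + \<kappa>) \<kappa> (l - ln 2)"
  define K where "K = Complex x ` {y..y\<^sub>0}"
  have Kc: "continuous_on {y..y\<^sub>0} (Complex x)" by (auto simp: Complex_eq intro!: continuous_intros)
  have K: "compact K" "connected K"
    unfolding K_def by (intro compact_continuous_image connected_continuous_image Kc; simp)+
  have KS: "K \<subseteq> ?S" using y x by (auto simp: K_def half_strip_def)
  have contG: "continuous_on ?S ?G" by (rule holomorphic_on_imp_continuous_on[OF holomorphic_continued_G[OF \<kappa>(1,2)]])
  have Kneg: "Im (?G \<zeta>) < 0" if "\<zeta> \<in> K" for \<zeta> using that neg by (auto simp: K_def)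
  have Im_inv: "Im (1 / w) > 0" if "Im w < 0" for w
  proof -
    have "Im (1 / w) = - Im w / (norm w)\<^sup>2" by (simp add: Im_divide cmod_power2)
    moreover have "w \<noteq> 0" using that by auto
    ultimately show ?thesis using that by (simp add: divide_neg_pos)
  qed
  have "continuous_on K (\<lambda>\<zeta>. Im (1 / ?G \<zeta>))"
    by (intro continuous_intros continuous_on_subset[OF contG KS]) (use Kneg in force)
  moreover have "K \<noteq> {}" using y by (auto simp: K_def)
  ultimately obtain \<zeta>\<^sub>1 where z1: "\<zeta>\<^sub>1 \<in> K" "\<And>\<zeta>. \<zeta> \<in> K \<Longrightarrow> Im (1 / ?G \<zeta>\<^sub>1) \<le> Im (1 / ?G \<zeta>)"
    using continuous_attains_inf[OF K(1)] by metis
  \<comment> \<open>Compactness makes the minimum \<open>d\<close> positive. With n - 1 >= k and k d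
    > exp x, the first term of \<omega> outweighs Im (exp \<zeta>), which may be as low as - exp x
    on the other sheets.\<close>
  define d where "d = Im (1 / ?G \<zeta>\<^sub>1)"
  have d: "d > 0" unfolding d_def using Kneg[OF z1(1)] by (rule Im_inv)
  obtain k where k: "exp x < real k * d" using reals_Archimedean3[OF d] by metis
  define n where "n = k + 2"
  obtain \<nu> where \<nu>: "real_distribution \<nu>"
    "\<And>z. z \<in> upper_half \<Longrightarrow> recip_F \<nu> ((of_nat (n - 1) * recip_F \<mu> z + z) / of_nat n) = recip_F \<mu> z"
    using FID_subordination[OF \<open>FID \<mu>\<close>, of n] by (auto simp: n_def)
  interpret \<nu>: real_distribution \<nu> by fact
  define \<omega> where "\<omega> = (\<lambda>\<zeta>. (of_nat (n - 1) * (1 / ?G \<zeta>) + (of_real x\<^sub>0 + exp \<zeta>)) / of_nat n)"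
  have Im_\<omega>: "Im (\<omega> \<zeta>) = (real (n - 1) * Im (1 / ?G \<zeta>) + Im (exp \<zeta>)) / real n" for \<zeta>
  proof -
    have "Im (of_nat k * w) = real k * Im w" for k w by simp
    then show ?thesis unfolding \<omega>_def Im_divide_of_nat plus_complex.sel by (simp only: Im_complex_of_real add_0)
  qed
  define S1 where "S1 = ?S \<inter> (\<lambda>\<zeta>. Im (?G \<zeta>)) -` {..<0}"
  have S1: "open S1" unfolding S1_def
    using continuous_on_open_vimage[OF open_half_strip] by (metis (no_types) continuous_on_Im contG open_lessThan inf_commute)
  have G0: "?G \<zeta> \<noteq> 0" if "\<zeta> \<in> S1" for \<zeta> using that by (force simp: S1_def)
  have hol1: "?G holomorphic_on S1"
    by (rule holomorphic_on_subset[OF holomorphic_continued_G[OF \<kappa>(1,2)]]) (auto simp: S1_def)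
  have hol\<omega>: "\<omega> holomorphic_on S1"
    unfolding \<omega>_def using G0 by (intro holomorphic_intros hol1) (auto simp: n_def)
  define U where "U = S1 \<inter> \<omega> -` upper_half"
  have U: "open U" unfolding U_def
    using continuous_on_open_vimage[OF S1] holomorphic_on_imp_continuous_on[OF hol\<omega>] open_upper_half
    by (metis inf_commute)
  have KU: "K \<subseteq> U"
  proof
    fix \<zeta> assume \<zeta>: "\<zeta> \<in> K"
    have "real (n - 1) * Im (1 / ?G \<zeta>) \<ge> real k * d"
      using z1(2)[OF \<zeta>] d unfolding d_def by (intro mult_mono) (auto simp: n_def)
    moreover have "Im (exp \<zeta>) \<ge> - exp x"
      using \<zeta> abs_Im_le_cmod[of "exp \<zeta>"] by (auto simp: K_def)
    ultimately have "Im (\<omega> \<zeta>) > 0" unfolding Im_\<omega> using k by (intro divide_pos_pos) (auto simp: n_def)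
    then show "\<zeta> \<in> U" using \<zeta> KS Kneg by (auto simp: U_def S1_def upper_half_def)
  qed
  \<comment> \<open>\<open>U\<close> may be disconnected; the identity theorem is applied on the
    component that contains the segment.\<close>
  define W where "W = connected_component_set U (Complex x y\<^sub>0)"
  have y0K: "Complex x y\<^sub>0 \<in> K" using y by (auto simp: K_def)
  have W: "open W" "connected W" "W \<subseteq> U"
    unfolding W_def using U by (auto intro: open_connected_component connected_component_subset[THEN subsetD])
  have KW: "K \<subseteq> W" unfolding W_def by (rule connected_component_maximal[OF y0K K(2) KU])
  \<comment> \<open>On the sheet of positive arguments the continued function is G itself and the
    subordination identity is known; the segment meets this part at its upper end
    \<open>y\<^sub>0\<close>.\<close>
  define V where "V = W \<inter> {\<zeta>. 0 < Im \<zeta>}"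
  have "recip_F \<nu> (\<omega> (Complex x y)) = 1 / ?G (Complex x y)"
  proof (rule analytic_continuation_open[of V W "\<lambda>\<zeta>. recip_F \<nu> (\<omega> \<zeta>)" "\<lambda>\<zeta>. 1 / ?G \<zeta>"])
    show "open V" unfolding V_def using W by (intro open_Int open_halfspace_Im_gt)
    show "V \<noteq> {}" using y0K KW y by (auto simp: V_def)
    have "(recip_F \<nu> \<circ> \<omega>) holomorphic_on W"
      by (rule holomorphic_on_compose_gen[OF holomorphic_on_subset[OF hol\<omega>] \<nu>.holomorphic_recip_F])
         (use W(3) in \<open>auto simp: U_def\<close>)
    then show "(\<lambda>\<zeta>. recip_F \<nu> (\<omega> \<zeta>)) holomorphic_on W" by (simp add: comp_def)
    show "(\<lambda>\<zeta>. 1 / ?G \<zeta>) holomorphic_on W"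
      using W(3) G0 by (intro holomorphic_intros holomorphic_on_subset[OF hol1]) (auto simp: U_def)
    show "Complex x y \<in> W" using KW y by (auto simp: K_def)
    fix \<zeta> assume "\<zeta> \<in> V"
    then have \<zeta>: "0 < Im \<zeta>" "\<zeta> \<in> ?S" using W(3) by (auto simp: V_def U_def S1_def)
    then have \<zeta>': "Im \<zeta> < \<kappa>" "Re \<zeta> < l - ln 2" by (auto simp: half_strip_def)
    let ?z = "of_real x\<^sub>0 + exp \<zeta>"
    have "?z \<in> upper_half" using \<zeta>(1) \<zeta>' \<kappa> by (simp add: upper_half_def Im_exp sin_gt_zero)
    moreover have "recip_F \<mu> ?z = 1 / ?G \<zeta>"
      using continued_G_eq_cauchy_G[OF \<kappa>(1,2) \<zeta>(1) \<zeta>' \<kappa>(3)] by (simp add: recip_F_def)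
    ultimately show "recip_F \<nu> (\<omega> \<zeta>) = 1 / ?G \<zeta>" using \<nu>(2)[of ?z] by (simp add: \<omega>_def)
  qed (use W V_def in auto)
  moreover have "Complex x y \<in> U" using KU y by (auto simp: K_def)
  then have "Im (\<omega> (Complex x y)) > 0" by (auto simp: U_def upper_half_def)
  then have "Im (recip_F \<nu> (\<omega> (Complex x y))) \<ge> Im (\<omega> (Complex x y))" by (rule \<nu>.Im_recip_F_ge)
  ultimately have "Im (\<omega> (Complex x y)) \<le> Im (1 / ?G (Complex x y))" by simp
  \<comment> \<open>After multiplication by \<open>n\<close> the n - 1 equal terms cancel, so the
    resulting inequality is free of \<open>n\<close>, although \<open>n\<close> depends on the
    segment.\<close>
  then have "real (n - 1) * Im (1 / ?G (Complex x y)) + Im (exp (Complex x y)) \<le> real n * Im (1 / ?G (Complex x y))"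
    unfolding Im_\<omega> by (simp add: n_def divide_le_eq mult.commute)
  moreover have "real n * q = real (n - 1) * q + q" for q by (simp add: n_def algebra_simps)
  ultimately have "Im (exp (Complex x y)) \<le> Im (1 / ?G (Complex x y))" by (smt (verit))
  then have "exp x * sin y \<le> - Im (?G (Complex x y)) / (norm (?G (Complex x y)))\<^sup>2"
    by (simp add: Im_exp Im_divide cmod_power2)
  moreover have "(norm (?G (Complex x y)))\<^sup>2 > 0" using neg[of y] y by force
  ultimately show ?thesis by (simp only: pos_le_divide_eq)
qed

text \<open>\<gamma> is \<beta> + 1 for \<beta> < 0 and \<beta> for \<beta> > 0. The extra phase pi
  in the first case compensates the sign of \<beta>, so both cases give one expression in
  |\<beta>|.\<close>

lemma Im_phase:
  assumes "\<beta> \<noteq> 0" "m = 0 \<longleftrightarrow> \<beta> < 0"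
  shows "Im (cis (\<beta> * y) * cis (- \<gamma> * pi)) = - sin (\<bar>\<beta>\<bar> * (pi - y))"
proof (cases "\<beta> < 0")
  case True
  then have "\<beta> * y + - \<gamma> * pi = \<bar>\<beta>\<bar> * (pi - y) - pi"
    using assms gamma_eq by (simp add: algebra_simps)
  then show ?thesis unfolding cis_mult by (simp add: sin_diff)
next
  case False
  then have "m = 1" using m assms by auto
  then have "\<beta> * y + - \<gamma> * pi = - (\<bar>\<beta>\<bar> * (pi - y))"
    using False gamma_eq by (simp add: algebra_simps)
  then show ?thesis unfolding cis_mult by simp
qed

text \<open>One sufficiently negative real part x is chosen, and everything happens on a vertical
  segment over it. The angle 2 \<kappa> beyond \<theta> leaves room both for the lag \<kappa> of the
  contour and for passing the zero of the leading sine.\<close>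

lemma not_FID:
  assumes \<beta>: "\<beta> \<noteq> 0" "\<bar>\<beta>\<bar> < 1 / 2" "m = 0 \<longleftrightarrow> \<beta> < 0"
    and \<theta>: "\<theta> = (1 / \<bar>\<beta>\<bar> - 1) * pi" "sin \<theta> < 0"
    and a: "a = - \<theta> - 2 * \<kappa>" and \<kappa>: "0 < \<kappa>" "\<kappa> < pi / 2"
  shows "\<not> FID \<mu>"
proof
  assume FID: "FID \<mu>"
  let ?B = "\<bar>\<beta>\<bar>" and ?G = "continued_G \<kappa>"
  have B: "0 < ?B" using \<beta> by simp
  \<comment> \<open>The defining property of \<theta>: the phase |\<beta>| (pi - y) runs from 0 to
    pi as y decreases from pi to - \<theta>.\<close>
  have B\<theta>: "?B * (pi + \<theta>) = pi" using B by (simp add: \<theta>(1) field_simps)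
  have "1 / ?B > 2" using \<beta> B by (simp add: field_simps)
  then have "(1 / ?B - 1) * pi > 0" by (intro mult_pos_pos) auto
  then have \<theta>pos: "\<theta> > 0" by (simp add: \<theta>(1))
  have a0: "a + \<kappa> \<le> 0" using a \<theta>pos \<kappa> by simp
  have "isCont (\<lambda>t. sin t) (- \<theta>)" by simp
  then have "eventually (\<lambda>t. sin t > 0) (at (- \<theta>))"
    unfolding isCont_def using \<theta>(2) by (intro order_tendstoD(1)) auto
  then obtain d where d: "d > 0" "\<And>t. t \<noteq> - \<theta> \<Longrightarrow> dist t (- \<theta>) < d \<Longrightarrow> sin t > 0"
    unfolding eventually_at by auto
  \<comment> \<open>\<open>d / 2\<close> keeps the sine positive within \<eta> of - \<theta>;
    \<open>\<kappa> / 2\<close> keeps - \<theta> - \<eta> above the lower edge a + \<kappa> = -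
    \<theta> - \<kappa> of the strip.\<close>
  define \<eta> where "\<eta> = min (d / 2) (\<kappa> / 2)"
  have \<eta>: "\<eta> > 0" "\<eta> < \<kappa>" "\<eta> < d" using d(1) \<kappa>(1) by (auto simp: \<eta>_def)
  have sin_pos: "sin t > 0" if "- \<theta> - \<eta> \<le> t" "t \<le> - \<theta> + \<eta>" for t
    using that d(2)[of t] \<eta> \<theta>(2) by (cases "t = - \<theta>") (auto simp: dist_real_def)
  define y\<^sub>0 y\<^sub>2 where "y\<^sub>0 = \<kappa> / 2" and "y\<^sub>2 = - \<theta> - \<eta>"
  \<comment> \<open>A lower bound for the modulus of the leading sine on the arguments from -
    \<theta> + \<eta> to \<open>y\<^sub>0\<close> and at \<open>y\<^sub>2\<close>; at distance
    \<eta> from its zero this modulus is sin (|\<beta>| \<eta>).\<close>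
  define \<sigma> where "\<sigma> = min (sin (?B * (pi - y\<^sub>0))) (sin (?B * \<eta>))"
  have "?B * \<eta> < 1 * pi" using \<beta> \<eta> \<kappa> B by (intro mult_strict_mono) auto
  moreover have "?B * (pi - y\<^sub>0) < 1 * pi" using \<beta> \<kappa> B by (intro mult_strict_mono) (auto simp: y\<^sub>0_def)
  moreover have "pi - y\<^sub>0 > 0" using \<kappa> by (simp add: y\<^sub>0_def)
  ultimately have \<sigma>: "\<sigma> > 0" unfolding \<sigma>_def using B \<eta> by (auto intro!: sin_gt_zero mult_pos_pos)
  have \<sigma>1: "\<sigma> \<le> 1" unfolding \<sigma>_def using sin_le_one by (auto simp: min_le_iff_disj)
  define A where "A = c * (LBINT u. mellin_weight \<gamma> u)"
  have A: "A > 0" unfolding A_def using c mellin_integral_pos[OF gamma] by simp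
  \<comment> \<open>Half of the guaranteed leading term, so that the error cannot change its
    sign.\<close>
  define \<epsilon> where "\<epsilon> = A * \<sigma> / 2"
  have \<epsilon>: "\<epsilon> > 0" using A \<sigma> by (simp add: \<epsilon>_def)
  have "A * \<sigma> \<le> A * 1" using A \<sigma>1 by (intro mult_left_mono) auto
  then have \<epsilon>2: "\<epsilon> \<le> A / 2" by (simp add: \<epsilon>_def)
  \<comment> \<open>This excludes cancellation in G: either the constant is 0 and the nonzero
    amplitude decides, or \<beta> > 0 and the power term becomes smaller than the constant.\<close>
  have "eventually (\<lambda>x. edge_value = 0 \<or> exp (\<beta> * x) * (2 * A) < \<bar>edge_value\<bar>) at_bot"
  proof (cases "edge_value = 0")
    case False
    then have "\<beta> > 0" using \<beta> by (auto simp: edge_value_def)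
    then have "((\<lambda>x. exp (\<beta> * x) * (2 * A)) \<longlongrightarrow> 0) at_bot"
      by (intro tendsto_mult_left_zero) real_asymp
    then show ?thesis using False by (intro eventually_mono[OF order_tendstoD(2)[of _ 0 _ "\<bar>edge_value\<bar>"]]) auto
  qed simp
  moreover have "eventually (\<lambda>x. x < l - ln 2) at_bot" by (rule eventually_gt_at_bot)
  ultimately have "eventually (\<lambda>x. (\<forall>y. a + \<kappa> < y \<longrightarrow> y < \<kappa> \<longrightarrow>
      norm (amplitude \<kappa> (Complex x y) - of_real A * cis (- \<gamma> * pi)) \<le> \<epsilon>) \<and> x < l - ln 2 \<and>
      (edge_value = 0 \<or> exp (\<beta> * x) * (2 * A) < \<bar>edge_value\<bar>)) at_bot"
    using amplitude_asymptotics[OF \<kappa>(1) _ \<epsilon>] \<kappa> unfolding A_def by (auto intro!: eventually_conj)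
  then obtain x where x: "\<And>y. a + \<kappa> < y \<Longrightarrow> y < \<kappa> \<Longrightarrow> norm (amplitude \<kappa> (Complex x y) - of_real A * cis (- \<gamma> * pi)) \<le> \<epsilon>"
     "x < l - ln 2" "edge_value = 0 \<or> exp (\<beta> * x) * (2 * A) < \<bar>edge_value\<bar>"
    unfolding eventually_at_bot_linorder by blast
  have ex: "exp (of_real \<beta> * Complex x y) = of_real (exp (\<beta> * x)) * cis (\<beta> * y)" for y
    by (simp add: exp_eq_polar)
  have dom: "a + \<kappa> < y\<^sub>2" "y\<^sub>0 < \<kappa>" "0 < y\<^sub>0" "y\<^sub>2 < y\<^sub>0"
    using a \<eta> \<kappa> \<theta>pos by (auto simp: y\<^sub>0_def y\<^sub>2_def)
  have nz: "?G (Complex x y) \<noteq> 0" if y: "a + \<kappa> < y" "y < \<kappa>" for y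
  proof
    assume "?G (Complex x y) = 0"
    then have e: "exp (of_real \<beta> * Complex x y) * amplitude \<kappa> (Complex x y) = - of_real edge_value"
      by (simp add: continued_G_def add_eq_0_iff)
    have "norm (of_real A * cis (- \<gamma> * pi)) = A" using A by (simp add: norm_mult)
    then have am: "norm (amplitude \<kappa> (Complex x y)) \<ge> A / 2" "norm (amplitude \<kappa> (Complex x y)) \<le> 2 * A"
      using x(1)[OF y] \<epsilon>2 norm_triangle_ineq2[of "of_real A * cis (- \<gamma> * pi)" "amplitude \<kappa> (Complex x y)"]
        norm_triangle_ineq2[of "amplitude \<kappa> (Complex x y)" "of_real A * cis (- \<gamma> * pi)"] A
      by (auto simp: norm_minus_commute)
    have "exp (\<beta> * x) * norm (amplitude \<kappa> (Complex x y)) = \<bar>edge_value\<bar>"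
      using arg_cong[OF e, of norm] by (simp add: norm_mult)
    moreover have "exp (\<beta> * x) * norm (amplitude \<kappa> (Complex x y)) \<le> exp (\<beta> * x) * (2 * A)"
      using am by (intro mult_left_mono) auto
    moreover have "exp (\<beta> * x) * norm (amplitude \<kappa> (Complex x y)) > 0"
      using am A by (intro mult_pos_pos) auto
    ultimately show False using x(3) by auto
  qed
  \<comment> \<open>\<open>edge_value\<close> is real and drops out of the imaginary part, so the
    power term decides the sign there even when it is much smaller than the constant.\<close>
  have im: "\<bar>Im (?G (Complex x y)) + exp (\<beta> * x) * (A * sin (?B * (pi - y)))\<bar> \<le> exp (\<beta> * x) * \<epsilon>"
    if y: "a + \<kappa> < y" "y < \<kappa>" for y
  proof -
    let ?D = "amplitude \<kappa> (Complex x y) - of_real A * cis (- \<gamma> * pi)"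
    have "?G (Complex x y) = of_real edge_value + of_real (exp (\<beta> * x)) * (of_real A * (cis (\<beta> * y) * cis (- \<gamma> * pi)) + cis (\<beta> * y) * ?D)"
      unfolding continued_G_def ex by (simp add: algebra_simps)
    moreover have "Im (of_real e + of_real s * (of_real A * z + w)) = s * (A * Im z + Im w)" for e s z w by simp
    ultimately have "Im (?G (Complex x y)) = exp (\<beta> * x) * (A * Im (cis (\<beta> * y) * cis (- \<gamma> * pi)) + Im (cis (\<beta> * y) * ?D))"
      by simp
    then have "Im (?G (Complex x y)) + exp (\<beta> * x) * (A * sin (?B * (pi - y))) = exp (\<beta> * x) * Im (cis (\<beta> * y) * ?D)"
      unfolding Im_phase[OF \<beta>(1,3)] by (simp add: algebra_simps)
    moreover have "\<bar>Im (cis (\<beta> * y) * ?D)\<bar> \<le> \<epsilon>"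
      using abs_Im_le_cmod[of "cis (\<beta> * y) * ?D"] x(1)[OF y] by (simp add: norm_mult)
    ultimately show ?thesis by (simp add: abs_mult)
  qed
  have neg: "Im (?G (Complex x y)) < 0" if y: "- \<theta> + \<eta> \<le> y" "y \<le> y\<^sub>0" for y
  proof -
    have "?B * (pi - y) \<le> ?B * (pi + \<theta> - \<eta>)" using y B by (intro mult_left_mono) auto
    also have "\<dots> = pi - ?B * \<eta>" using B\<theta> by (simp add: algebra_simps)
    finally have "min (sin (?B * (pi - y\<^sub>0))) (sin (pi - ?B * \<eta>)) \<le> sin (?B * (pi - y))"
      using B y \<eta> \<open>pi - y\<^sub>0 > 0\<close> by (intro sin_lower_bound_interval) (auto intro!: mult_left_mono mult_pos_pos)
    then have "\<sigma> \<le> sin (?B * (pi - y))" by (simp add: \<sigma>_def)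
    then have "A * \<sigma> \<le> A * sin (?B * (pi - y))" using A by (intro mult_left_mono) auto
    then have "exp (\<beta> * x) * (2 * \<epsilon>) \<le> exp (\<beta> * x) * (A * sin (?B * (pi - y)))"
      by (intro mult_left_mono) (auto simp: \<epsilon>_def)
    moreover have "exp (\<beta> * x) * \<epsilon> > 0" using \<epsilon> by simp
    moreover have yc: "a + \<kappa> < y" "y < \<kappa>" using y dom \<eta> by (auto simp: y\<^sub>2_def)
    ultimately show ?thesis using im[OF yc] by linarith
  qed
  have pos: "Im (?G (Complex x y\<^sub>2)) > 0"
  proof -
    have "?B * (pi - y\<^sub>2) = pi + ?B * \<eta>" using B\<theta> by (simp add: y\<^sub>2_def algebra_simps)
    then have "sin (?B * (pi - y\<^sub>2)) = - sin (?B * \<eta>)" by (simp add: sin_add)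
    then have "A * sin (?B * (pi - y\<^sub>2)) \<le> - (A * \<sigma>)" using A by (simp add: \<sigma>_def)
    then have "exp (\<beta> * x) * (A * sin (?B * (pi - y\<^sub>2))) \<le> exp (\<beta> * x) * - (2 * \<epsilon>)"
      by (intro mult_left_mono) (auto simp: \<epsilon>_def)
    moreover have "exp (\<beta> * x) * \<epsilon> > 0" using \<epsilon> by simp
    ultimately show ?thesis using im[of y\<^sub>2] dom by auto
  qed
  have contG: "continuous_on {y\<^sub>2..y\<^sub>0} (\<lambda>y. ?G (Complex x y))"
    by (rule continuous_on_compose2[OF holomorphic_on_imp_continuous_on[OF holomorphic_continued_G]])
       (use \<kappa> dom x(2) in \<open>auto simp: half_strip_def Complex_eq intro!: continuous_intros\<close>)
  \<comment> \<open>The largest zero of Im G on the segment is the first one met as the argument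
    decreases from \<open>y\<^sub>0\<close>; above it the sign is negative, as
    \<open>FID_continued_ineq\<close> requires.\<close>
  define Z where "Z = {y \<in> {y\<^sub>2..y\<^sub>0}. Im (?G (Complex x y)) = 0}"
  have contIm: "continuous_on {y\<^sub>2..y\<^sub>0} (\<lambda>y. Im (?G (Complex x y)))" by (intro continuous_intros contG)
  have "- \<theta> + \<eta> \<le> y\<^sub>0" using \<theta>pos by (simp add: y\<^sub>0_def \<eta>_def)
  have zero: "\<exists>t\<in>Z. y \<le> t" if y: "y\<^sub>2 \<le> y" "y \<le> y\<^sub>0" "Im (?G (Complex x y)) \<ge> 0" for y
  proof -
    have "\<exists>t. y \<le> t \<and> t \<le> y\<^sub>0 \<and> Im (?G (Complex x t)) = 0"
      using neg[OF \<open>- \<theta> + \<eta> \<le> y\<^sub>0\<close> order_refl] y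
      by (intro IVT2' continuous_on_subset[OF contIm]) (auto simp: y\<^sub>2_def)
    then obtain t where t: "y \<le> t" "t \<le> y\<^sub>0" "Im (?G (Complex x t)) = 0" by blast
    then have "t \<in> Z" using y by (auto simp: Z_def)
    then show ?thesis using t by blast
  qed
  have "closed Z" unfolding Z_def
    using continuous_closed_preimage_constant[OF contIm] by simp
  then have "compact Z"
    by (rule compact_eq_bounded_closed[THEN iffD2, OF conjI[rotated]])
       (rule bounded_subset[of "{y\<^sub>2..y\<^sub>0}"], auto simp: Z_def)
  moreover have "Z \<noteq> {}" using zero[of y\<^sub>2] pos dom by auto
  ultimately obtain ys where ys: "ys \<in> Z" "\<And>t. t \<in> Z \<Longrightarrow> t \<le> ys"
    using compact_attains_sup by metis
  have ys2: "y\<^sub>2 \<le> ys" "ys \<le> y\<^sub>0" "Im (?G (Complex x ys)) = 0" using ys(1) by (auto simp: Z_def)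
  have ys3: "ys < - \<theta> + \<eta>" using neg[of ys] ys2 by force
  have ys4: "ys < y\<^sub>0" using ys3 \<open>- \<theta> + \<eta> \<le> y\<^sub>0\<close> by linarith
  have after: "Im (?G (Complex x t)) < 0" if "ys < t" "t \<le> y\<^sub>0" for t
    using zero[of t] ys(2) that ys2 by force
  \<comment> \<open>The inequality is available where Im G < 0 strictly; continuity carries it to
    \<open>ys\<close>, where it would put a positive number below 0.\<close>
  let ?d = "\<lambda>y. - Im (?G (Complex x y)) - exp x * sin y * (norm (?G (Complex x y)))\<^sup>2"
  have "?d y \<ge> 0" if y: "y \<in> {ys<..<y\<^sub>0}" for y
    using FID_continued_ineq[OF FID \<kappa>(1) _ a0, of y y\<^sub>0 x] \<kappa> y dom x(2) ys2 after by auto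
  moreover have "closure {ys<..<y\<^sub>0} = {ys..y\<^sub>0}" using ys4 by (rule closure_greaterThanLessThan)
  moreover have "continuous_on {ys..y\<^sub>0} ?d"
    by (intro continuous_intros continuous_on_subset[OF contG]) (use ys2 in auto)
  ultimately have "?d ys \<ge> 0"
    using continuous_ge_on_closure[of "{ys<..<y\<^sub>0}" ?d ys 0] ys4 by auto
  moreover have "exp x * sin ys * (norm (?G (Complex x ys)))\<^sup>2 > 0"
    using sin_pos[of ys] nz[of ys] ys2 ys3 dom by (intro mult_pos_pos) (auto simp: y\<^sub>2_def)
  ultimately show False using ys2(3) by simp
qed

end

subsection \<open>The exponents and the logarithmic chart\<close>

text \<open>Both families of intervals say that |\<alpha> - 1| lies between 1 / (2n + 1) and 1 /
  (2n). Then 1 / |\<alpha> - 1| lies between 2n and 2n + 1, and \<open>theta \<alpha>\<close>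
  between (2n - 1) pi and 2n pi, where the sine is negative.\<close>

lemma exponent_set_gap:
  assumes "\<alpha> \<in> exponent_set"
  shows "\<alpha> \<noteq> 1" "\<bar>\<alpha> - 1\<bar> < 1 / 2" "sin (theta \<alpha>) < 0"
proof -
  define B where "B = \<bar>\<alpha> - 1\<bar>"
  obtain n :: nat where n: "n \<ge> 1" "1 / (2 * real n + 1) < B" "B < 1 / (2 * real n)"
  proof -
    consider n :: nat where "n \<ge> 1" "(2 * real n - 1) / (2 * real n) < \<alpha>" "\<alpha> < (2 * real n) / (2 * real n + 1)"
      | n :: nat where "n \<ge> 1" "(2 * real n + 2) / (2 * real n + 1) < \<alpha>" "\<alpha> < (2 * real n + 1) / (2 * real n)"
      using assms unfolding exponent_set_def by auto
    then show ?thesis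
    proof cases
      case (1 n)
      have eq: "(2 * real n - 1) / (2 * real n) = 1 - 1 / (2 * real n)" "(2 * real n) / (2 * real n + 1) = 1 - 1 / (2 * real n + 1)"
        using 1(1) by (auto simp: field_simps)
      moreover have "1 / (2 * real n + 1) > 0" by simp
      ultimately have "\<alpha> < 1" using 1(3) by linarith
      with eq show ?thesis using 1 by (intro that[of n]) (auto simp: B_def abs_if)
    next
      case (2 n)
      have eq: "(2 * real n + 2) / (2 * real n + 1) = 1 + 1 / (2 * real n + 1)" "(2 * real n + 1) / (2 * real n) = 1 + 1 / (2 * real n)"
        using 2(1) by (auto simp: field_simps)
      moreover have "1 / (2 * real n + 1) > 0" by simp
      ultimately have "1 < \<alpha>" using 2(2) by linarith
      with eq show ?thesis using 2 by (intro that[of n]) (auto simp: B_def abs_if)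
    qed
  qed
  have B0: "B > 0" using n(2) less_trans[of 0 "1 / (2 * real n + 1)" B] by simp
  then show "\<alpha> \<noteq> 1" by (auto simp: B_def)
  have "1 / (2 * real n) \<le> 1 / 2" using n(1) by (simp add: field_simps)
  then show "\<bar>\<alpha> - 1\<bar> < 1 / 2" using n(3) by (simp add: B_def)
  have i: "2 * real n < 1 / B" "1 / B < 2 * real n + 1"
    using n B0 by (auto simp: field_simps)
  define t where "t = theta \<alpha> - (2 * real n - 1) * pi"
  have t: "t = (1 / B - 2 * real n) * pi" by (simp add: t_def theta_def B_def algebra_simps)
  have "0 < t" unfolding t using i by (intro mult_pos_pos) auto
  moreover have "t < 1 * pi" unfolding t using i by (intro mult_strict_right_mono) auto
  then have "t < pi" by simp
  ultimately have "sin t > 0" by (rule sin_gt_zero)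
  moreover have "theta \<alpha> = (t - pi) + real n * (2 * pi)" by (simp add: t_def algebra_simps)
  then have "sin (theta \<alpha>) = - sin t"
    using sin.plus_of_nat[of "t - pi" n] by (simp add: sin_diff)
  ultimately show "sin (theta \<alpha>) < 0" by simp
qed

text \<open>The map v -> (exp (Re v), Im v) followed by \<open>log_proj\<close> is exp, so locally
  the function is some holomorphic h composed with exp.\<close>

lemma log_chart_holomorphic:
  assumes "analytic_on_log_surface F (log_sector {a<..<b} \<delta>)" and "\<delta> > 0"
  shows "(\<lambda>v. F (exp (Re v), Im v)) holomorphic_on half_strip a b (ln \<delta>)"
  unfolding holomorphic_on_def
proof
  fix v assume v: "v \<in> half_strip a b (ln \<delta>)"
  let ?\<phi> = "\<lambda>v. (exp (Re v), Im v)"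
  have "exp (Re v) < exp (ln \<delta>)" using v unfolding exp_less_cancel_iff by (simp add: half_strip_def)
  then have "?\<phi> v \<in> log_sector {a<..<b} \<delta>"
    using v \<open>\<delta> > 0\<close> by (simp add: log_sector_def log_surface_def half_strip_def)
  then obtain h where h: "h analytic_on {log_proj (?\<phi> v)}" "\<forall>\<^sub>F w in nhds (?\<phi> v). F w = h (log_proj w)"
    using assms(1) unfolding analytic_on_log_surface_def by blast
  have proj: "log_proj (?\<phi> w) = exp w" for w
    by (simp add: log_proj_def rcis_def exp_eq_polar)
  have "(?\<phi> \<longlongrightarrow> ?\<phi> v) (at v)" by (intro tendsto_intros)
  then have "filterlim ?\<phi> (nhds (?\<phi> v)) (nhds v)" by (rule tendsto_at_iff_tendsto_nhds[THEN iffD1])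
  then have ev: "\<forall>\<^sub>F w in nhds v. F (?\<phi> w) = h (exp w)"
    using h(2) unfolding filterlim_iff proj[symmetric] by blast
  have "h field_differentiable at (exp v)"
    using h(1) analytic_on_imp_differentiable_at[of h] by (simp add: proj)
  then have "(h \<circ> exp) field_differentiable at v"
    by (intro field_differentiable_compose holomorphic_on_imp_differentiable_at[of exp UNIV] holomorphic_on_exp) auto
  then obtain D where "((\<lambda>w. h (exp w)) has_field_derivative D) (at v)"
    by (auto simp: field_differentiable_def comp_def)
  then have "((\<lambda>w. F (?\<phi> w)) has_field_derivative D) (at v)"
    using DERIV_cong_ev[OF refl ev refl] by blast
  then show "(\<lambda>v. F (exp (Re v), Im v)) field_differentiable (at v within half_strip a b (ln \<delta>))"
    using field_differentiable_at_within field_differentiable_def by blast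
qed

theorem theorem5p1:
  fixes \<mu> :: "real measure"
    and p f g :: "real \<Rightarrow> real"
    and f_ext :: "real \<times> real \<Rightarrow> complex"
    and x\<^sub>0 c \<delta> \<alpha> \<theta>\<^sub>0 :: real
  assumes "real_distribution \<mu>"
    and "c > 0" and "\<delta> > 0"
    and "has_local_density \<mu> {x\<^sub>0 - \<delta><..<x\<^sub>0 + \<delta>} p"
    and "\<And>x. x\<^sub>0 < x \<Longrightarrow> x < x\<^sub>0 + \<delta> \<Longrightarrow> p x = c * (x - x\<^sub>0) powr (\<alpha> - 1) * (1 + f x)"
    and "\<And>x. x\<^sub>0 - \<delta> < x \<Longrightarrow> x < x\<^sub>0 \<Longrightarrow> p x = 0"
    and "\<alpha> \<in> exponent_set"
    and "real_analytic_on (\<lambda>r. f (r + x\<^sub>0)) {0<..<\<delta>}"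
    and "\<theta>\<^sub>0 \<in> {0<..<pi / 4}"
    and "analytic_on_log_surface f_ext (log_sector {- theta \<alpha> - \<theta>\<^sub>0<..<\<theta>\<^sub>0} \<delta>)"
    and "\<And>r. r \<in> {0<..<\<delta>} \<Longrightarrow> f_ext (r, 0) = complex_of_real (f (r + x\<^sub>0))"
    and "continuous_on {0..<\<delta>} g"
    and "\<And>r. r \<in> {0..<\<delta>} \<Longrightarrow> g r \<ge> 0"
    and "g 0 = 0"
    and "\<And>r \<theta>. r \<in> {0<..<\<delta>} \<Longrightarrow> \<theta> \<in> {- theta \<alpha> - \<theta>\<^sub>0<..<\<theta>\<^sub>0} \<Longrightarrow> norm (f_ext (r, \<theta>)) \<le> g r"
  shows "\<not> FID \<mu>"
proof -
  \<comment> \<open>This choice puts \<gamma> = \<beta> + 1 - m into (0, 1), the range in which the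
    weight is integrable: \<gamma> is \<alpha> for \<alpha> < 1 and \<alpha> - 1 for \<alpha> >
    1.\<close>
  define \<beta> m where "\<beta> = \<alpha> - 1" and "m = (if \<beta> < 0 then 0 else 1 :: nat)"
  \<comment> \<open>With this \<kappa> the lower angle of the given sector has the form - \<theta> -
    2 \<kappa> that \<open>not_FID\<close> asks for.\<close>
  define \<kappa> where "\<kappa> = \<theta>\<^sub>0 / 2"
  note gap = exponent_set_gap[OF \<open>\<alpha> \<in> exponent_set\<close>]
  have \<theta>0: "0 < \<theta>\<^sub>0" "\<theta>\<^sub>0 < pi / 4" using \<open>\<theta>\<^sub>0 \<in> {0<..<pi / 4}\<close> by auto
  have "2 < 1 / \<bar>\<alpha> - 1\<bar>" using gap(1,2) by (simp add: field_simps)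
  then have "theta \<alpha> > 0" unfolding theta_def by (intro mult_pos_pos) auto
  have exp_less: "exp s < \<delta>" if "s < ln \<delta>" for s
    using that exp_less_cancel_iff[of s "ln \<delta>"] \<open>\<delta> > 0\<close> by simp
  note ext_hol = log_chart_holomorphic[OF assms(10) \<open>\<delta> > 0\<close>]
  interpret \<mu>: real_distribution \<mu> by fact
  \<comment> \<open>In the coordinate u = ln r the radius \<delta> becomes
    \<open>ln \<delta>\<close>; \<open>ln \<delta> - 1\<close> ends the contour at distance \<delta>
    / e, inside the domain of the extension.\<close>
  interpret edge_density "\<beta> + 1 - real m" "- theta \<alpha> - \<theta>\<^sub>0" "\<theta>\<^sub>0" "ln \<delta>" "ln \<delta> - 1" c
    "\<lambda>v. of_real c * (1 + f_ext (exp (Re v), Im v))" "\<lambda>u. g (exp u)" \<mu> x\<^sub>0 \<beta> p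
    "\<lambda>s. c * (1 + f (exp s + x\<^sub>0))" m
  proof
    show "0 < \<beta> + 1 - real m" "\<beta> + 1 - real m < 1"
      using gap(1,2) by (auto simp: \<beta>_def m_def abs_if split: if_splits)
    show "(\<lambda>v. of_real c * (1 + f_ext (exp (Re v), Im v))) holomorphic_on half_strip (- theta \<alpha> - \<theta>\<^sub>0) \<theta>\<^sub>0 (ln \<delta>)"
      by (intro holomorphic_intros ext_hol)
    show "norm (of_real c * (1 + f_ext (exp (Re v), Im v)) - of_real c) \<le> c * g (exp (Re v))"
      if "v \<in> half_strip (- theta \<alpha> - \<theta>\<^sub>0) \<theta>\<^sub>0 (ln \<delta>)" for v
    proof -
      have "norm (f_ext (exp (Re v), Im v)) \<le> g (exp (Re v))"
        by (rule assms(15)) (use that exp_less in \<open>auto simp: half_strip_def\<close>)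
      then show ?thesis using \<open>c > 0\<close> by (simp add: algebra_simps norm_mult)
    qed
    show "continuous_on {..<ln \<delta>} (\<lambda>u. g (exp u))"
      by (rule continuous_on_compose2[OF assms(12)]) (use exp_less in \<open>auto intro!: continuous_intros\<close>)
    have "(g \<longlongrightarrow> g 0) (at 0 within {0..<\<delta>})"
      using assms(12) \<open>\<delta> > 0\<close> by (auto simp: continuous_on_def)
    moreover have "filterlim exp (at 0 within {0..<\<delta>}) (at_bot :: real filter)"
      unfolding filterlim_at
    proof
      show "(exp \<longlongrightarrow> (0 :: real)) at_bot" by (rule exp_at_bot)
      show "\<forall>\<^sub>F u in at_bot. exp u \<in> {0..<\<delta>} \<and> exp u \<noteq> 0"
        using eventually_gt_at_bot[of "ln \<delta>"] by eventually_elim (use exp_less in auto)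
    qed
    ultimately show "((\<lambda>u. g (exp u)) \<longlongrightarrow> 0) at_bot"
      using filterlim_compose \<open>g 0 = 0\<close> by fastforce
    show "p (x\<^sub>0 + exp s) = exp (\<beta> * s) * (c * (1 + f (exp s + x\<^sub>0)))" if "s < ln \<delta>" for s
      using assms(5)[of "x\<^sub>0 + exp s"] exp_less[OF that]
      by (simp add: \<beta>_def powr_def add.commute mult.commute mult.left_commute)
    show "of_real c * (1 + f_ext (exp (Re (Complex s 0)), Im (Complex s 0))) = of_real (c * (1 + f (exp s + x\<^sub>0)))" if "s < ln \<delta>" for s
      using assms(11)[of "exp s"] exp_less[OF that] by simp
  qed (use assms \<theta>0 \<open>theta \<alpha> > 0\<close> exp_less in \<open>auto simp: m_def\<close>)
  show ?thesis
    by (rule not_FID[where \<theta> = "theta \<alpha>" and \<kappa> = \<kappa>])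
       (use gap \<theta>0 in \<open>auto simp: \<beta>_def m_def \<kappa>_def theta_def\<close>)
qed

end
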